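(* In the bond market model described in the context, suppose that the operator $\Gamma_t:l^2\to G$ is injective $\mathbb P\otimes\lambda$-a.e. on $\Omega\times[0,\bar S]$ ($\lambda$ is Lebesgue measure). Let $S\le\bar S$. Then for every predictable $l^2$-valued process $\psi$ with $\mathbf E\int_0^{S}|\psi_s|_{l^2}^2ds<\infty$ the equation $$\int_0^S(\varphi_s,d\hat P_s)=\int_0^S\langle\psi_s,dW_s\rangle_{l^2}$$ has a solution $\varphi$ in the class of $\hat P$-integrable processes (in the generalized sense, with values in not necessarily continuous linear functionals on $G$) satisfying $$\mathbf E\left(\int_0^{\bar S}|\varphi_t(Q_t^{1/2})|^2_{G^*}dt\right)<\infty .$$
   Context: Setting. Fix $0<\bar S<\infty$ and a filtered probability space $(\Omega,\mathcal F,(\mathcal F_t)_{t\in[0,\bar S]},\mathbb P)$ satisfying the usual conditions, whose filtration is generated (up to the usual augmentation) by a sequence of independent standard Wiener processes $W^i$, $i=1,2,\dots$; $W=(W^1,W^2,\dots)$ is regarded as a cylindrical Wiener process in $l^2$. Let $H=L^2[0,\bar S]$ and let $G=H^1[0,\bar S]$ be the Hilbert space of absolutely continuous functions with square integrable derivative, with norm $|g|_G^2=|g(0)|^2+\int_0^{\bar S}(g'(s))^2ds$; $G^*$ is its dual. Forward rates. $f_t=f_0+\int_0^t\alpha_s\,ds+\int_0^t\sigma_s\,dW_s$ in $H$, $t\in[0,\bar S]$, with initial curve $f_0\in H$, i.e. $df(t,T)=\alpha(t,T)dt+\sum_{i}\sigma^i(t,T)dW^i(t)$, where $\alpha_t=\alpha(t,\cdot)$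 and $\sigma_t:l^2\to H$, $(\sigma_tu)(T)=\sum_i\sigma^i(t,T)u^i$. One assumes: $\alpha(t,T)=\sigma^i(t,T)=0$ for $t\ge T$ and all $i$; $\alpha$ is an $H$-valued process with $\int_0^{\bar S}|\alpha_t|_H\,dt<\infty$ a.s.; $\sigma$ is a predictable process with values in the Hilbert-Schmidt operators $L_{HS}(l^2,H)$ (a.s.) and $\int_0^{\bar S}\|\sigma_t\|^2_{L_{HS}(l^2,H)}dt<\infty$ a.s.; and the HJM (no-arbitrage) condition $\int_t^T\alpha(t,u)du=\frac12\sum_i\big(\int_t^T\sigma^i(t,u)du\big)^2$ for all $t,T\in[0,\bar S]$. Prices. The discounted bond price is $\hat P(t,T)=e^{-\int_0^Tf(t,u)du}$, and $\hat P_t=\hat P(t,\cdot)\in G$. Put $b^i(t,T)=-\int_0^T\sigma^i(t,u)du$ and $\Gamma_t:l^2\to G$, $(\Gamma_tu)(T)=\hat P(t,T)\sum_ib^i(t,T)u^i$ (a Hilbert-Schmidt operator). Then $\hat P_t=\hat P_0+\int_0^t\Gamma_s\,dW_s$. Let $\Gamma'_t:G\to l^2$ be the Hilbert-space adjoint of $\Gamma_t$ and $Q_t=\Gamma_t\Gamma_t'$. Generalized integrands. A $\hat P$-integrable process $\varphi$ is a predictable process whose values $\varphi_t$ are linear, not necessarily continuous, functionals defined on linear subspaces $\mathrm{Dom}\,\varphi_t\subseteq G$, such that $\mathrm{Im}\,Q_t^{1/2}\subseteq\mathrm{Dom}\,\varphi_t$ and $\varphi_t(Q_t^{1/2}):=\varphi_t\circ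 Q_t^{1/2}\in G^*$ (for a.e. $(\omega,t)$), and $\int_0^{\bar S}|\varphi_t(Q_t^{1/2})|^2_{G^*}dt<\infty$ a.s. Predictability is understood as predictability of the $G^*$-valued process $\varphi_t\circ Q_t^{1/2}$ (equivalently of the $l^2$-valued process $\varphi_t\circ\Gamma_t$). The stochastic integral is $$\int_0^t(\varphi_s,d\hat P_s)=\int_0^t\langle\Gamma_s^*\circ\varphi_s,dW_s\rangle_{l^2},\qquad (\Gamma_s^*\circ\varphi_s)(u):=\varphi_s(\Gamma_su),\ u\in l^2,$$ where the bounded functional $\Gamma_s^*\circ\varphi_s$ on $l^2$ is identified with an element of $l^2$. *)

theory Defs
  imports "HOL-Probability.Probability"
begin

section \<open>Square-summable sequences\<close>

text \<open>
  \<open>real l2\<close> is the space \<open>l\<^sup>2\<close>.  For a Hilbert space \<open>'v\<close>, \<open>'v l2\<close> is the space of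
  Hilbert--Schmidt operators from \<open>l\<^sup>2\<close> to \<open>'v\<close> with the Hilbert--Schmidt norm: an operator is
  represented by its columns, i.e. \<open>x\<close> stands for \<open>u \<mapsto> (\<Sum>i. u i *\<^sub>R x i)\<close>, and its squared norm is
  the sum of the squared norms of the columns.
\<close>

typedef (overloaded) 'a l2 = "{x :: nat \<Rightarrow> 'a::real_inner. summable (\<lambda>i. (norm (x i))\<^sup>2)}"
  morphisms coord Abs_l2
  by (rule exI[of _ "\<lambda>_. 0"]) simp

setup_lifting type_definition_l2

lemma summable_coord: "summable (\<lambda>i. (norm (coord x i))\<^sup>2)"
  using coord[of x] by simp

lemma l2_summable_add:
  fixes x y :: "nat \<Rightarrow> 'a::real_inner"
  assumes "summable (\<lambda>i. (norm (x i))\<^sup>2)" "summable (\<lambda>i. (norm (y i))\<^sup>2)"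
  shows "summable (\<lambda>i. (norm (x i + y i))\<^sup>2)"
proof (rule summable_comparison_test')
  show "summable (\<lambda>i. 2 * (norm (x i))\<^sup>2 + 2 * (norm (y i))\<^sup>2)"
    using assms by (intro summable_add summable_mult)
  fix i
  have "(norm (x i + y i))\<^sup>2 \<le> (norm (x i) + norm (y i))\<^sup>2"
    by (intro power_mono norm_triangle_ineq) auto
  also have "\<dots> \<le> 2 * (norm (x i))\<^sup>2 + 2 * (norm (y i))\<^sup>2"
    using sum_squares_bound[of "norm (x i)" "norm (y i)"] by (simp add: power2_sum)
  finally show "norm ((norm (x i + y i))\<^sup>2) \<le> 2 * (norm (x i))\<^sup>2 + 2 * (norm (y i))\<^sup>2"
    by simp
qed

lemma l2_summable_scaleR:
  fixes x :: "nat \<Rightarrow> 'a::real_inner"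
  assumes "summable (\<lambda>i. (norm (x i))\<^sup>2)"
  shows "summable (\<lambda>i. (norm (c *\<^sub>R x i))\<^sup>2)"
  using summable_mult[OF assms, of "c\<^sup>2"] by (simp add: power_mult_distrib)

lemma l2_summable_inner:
  fixes x y :: "nat \<Rightarrow> 'a::real_inner"
  assumes "summable (\<lambda>i. (norm (x i))\<^sup>2)" "summable (\<lambda>i. (norm (y i))\<^sup>2)"
  shows "summable (\<lambda>i. x i \<bullet> y i)"
proof (rule summable_comparison_test')
  show "summable (\<lambda>i. (norm (x i))\<^sup>2 + (norm (y i))\<^sup>2)"
    using assms by (intro summable_add)
  fix i
  have "\<bar>x i \<bullet> y i\<bar> \<le> norm (x i) * norm (y i)"
    by (rule Cauchy_Schwarz_ineq2)
  also have "\<dots> \<le> (norm (x i))\<^sup>2 + (norm (y i))\<^sup>2"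
    using sum_squares_bound[of "norm (x i)" "norm (y i)"]
      mult_nonneg_nonneg[OF norm_ge_zero[of "x i"] norm_ge_zero[of "y i"]] by linarith
  finally show "norm (x i \<bullet> y i) \<le> (norm (x i))\<^sup>2 + (norm (y i))\<^sup>2"
    by simp
qed

instantiation l2 :: (real_inner) real_vector
begin

lift_definition zero_l2 :: "'a l2" is "\<lambda>_. 0" by simp

lift_definition plus_l2 :: "'a l2 \<Rightarrow> 'a l2 \<Rightarrow> 'a l2" is "\<lambda>x y i. x i + y i"
  by (rule l2_summable_add)

lift_definition uminus_l2 :: "'a l2 \<Rightarrow> 'a l2" is "\<lambda>x i. - x i" by simp

lift_definition minus_l2 :: "'a l2 \<Rightarrow> 'a l2 \<Rightarrow> 'a l2" is "\<lambda>x y i. x i - y i"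
  by (simp add: l2_summable_add[where y = "\<lambda>i. - y i" for y, simplified])

lift_definition scaleR_l2 :: "real \<Rightarrow> 'a l2 \<Rightarrow> 'a l2" is "\<lambda>c x i. c *\<^sub>R x i"
  by (rule l2_summable_scaleR)

instance
proof
  fix x y z :: "'a l2" and a b :: real
  show "x + y + z = x + (y + z)" by transfer (simp add: add.assoc)
  show "x + y = y + x" by transfer (simp add: add.commute)
  show "0 + x = x" by transfer simp
  show "- x + x = 0" by transfer simp
  show "x - y = x + - y" by transfer simp
  show "a *\<^sub>R (x + y) = a *\<^sub>R x + a *\<^sub>R y" by transfer (simp add: scaleR_add_right)
  show "(a + b) *\<^sub>R x = a *\<^sub>R x + b *\<^sub>R x" by transfer (simp add: scaleR_add_left)
  show "a *\<^sub>R b *\<^sub>R x = (a * b) *\<^sub>R x" by transfer simp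
  show "1 *\<^sub>R x = x" by transfer simp
qed

end

instantiation l2 :: (real_inner) real_inner
begin

definition inner_l2 :: "'a l2 \<Rightarrow> 'a l2 \<Rightarrow> real"
  where "x \<bullet> y = (\<Sum>i. coord x i \<bullet> coord y i)" for x y :: "'a l2"

definition norm_l2 :: "'a l2 \<Rightarrow> real"
  where "norm x = sqrt (x \<bullet> x)" for x :: "'a l2"

definition dist_l2 :: "'a l2 \<Rightarrow> 'a l2 \<Rightarrow> real"
  where "dist x y = norm (x - y)" for x y :: "'a l2"

definition sgn_l2 :: "'a l2 \<Rightarrow> 'a l2"
  where "sgn x = x /\<^sub>R norm x" for x :: "'a l2"

definition uniformity_l2 :: "('a l2 \<times> 'a l2) filter"
  where "uniformity = (INF e\<in>{0 <..}. principal {(x :: 'a l2, y). dist x y < e})"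

definition open_l2 :: "'a l2 set \<Rightarrow> bool"
  where "open U = (\<forall>x\<in>U. eventually (\<lambda>(x', y). x' = x \<longrightarrow> y \<in> U) uniformity)"
  for U :: "'a l2 set"

instance
proof
  fix x y z :: "'a l2" and a :: real
  note summ = l2_summable_inner[OF summable_coord summable_coord]
  show "x \<bullet> y = y \<bullet> x" by (simp add: inner_l2_def inner_commute)
  show "(x + y) \<bullet> z = x \<bullet> z + y \<bullet> z"
    by (simp add: inner_l2_def plus_l2.rep_eq inner_add_left suminf_add summ)
  show "a *\<^sub>R x \<bullet> y = a * (x \<bullet> y)"
    by (simp add: inner_l2_def scaleR_l2.rep_eq suminf_mult summ)
  show "0 \<le> x \<bullet> x"
    by (simp add: inner_l2_def suminf_nonneg summ)
  show "(x \<bullet> x = 0) = (x = 0)"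
    by (simp add: inner_l2_def suminf_eq_zero_iff summ coord_inject[symmetric] zero_l2.rep_eq
        fun_eq_iff)
qed (fact norm_l2_def dist_l2_def sgn_l2_def uniformity_l2_def open_l2_def)+

end

text \<open>The element of \<open>l\<^sup>2\<close> representing a bounded functional on \<open>l\<^sup>2\<close>.\<close>

definition l2_riesz :: "(real l2 \<Rightarrow> real) \<Rightarrow> real l2"
  where "l2_riesz \<eta> = (THE v. \<forall>u. \<eta> u = v \<bullet> u)"


section \<open>Filtration, predictability\<close>

definition standard_wiener :: "'w measure \<Rightarrow> real \<Rightarrow> (real \<Rightarrow> 'w \<Rightarrow> real) \<Rightarrow> bool"
  where "standard_wiener M S B \<longleftrightarrow>
    (\<forall>t\<in>{0..S}. B t \<in> borel_measurable M) \<and>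
    (AE \<omega> in M. B 0 \<omega> = 0) \<and>
    (AE \<omega> in M. continuous_on {0..S} (\<lambda>t. B t \<omega>)) \<and>
    (\<forall>s t. 0 \<le> s \<and> s < t \<and> t \<le> S \<longrightarrow>
      distributed M lborel (\<lambda>\<omega>. B t \<omega> - B s \<omega>) (normal_density 0 (sqrt (t - s)))) \<and>
    (\<forall>n. \<forall>\<tau> :: nat \<Rightarrow> real. mono_on {..n} \<tau> \<and> \<tau> ` {..n} \<subseteq> {0..S} \<longrightarrow>
      prob_space.indep_vars M (\<lambda>_. borel) (\<lambda>k \<omega>. B (\<tau> (Suc k)) \<omega> - B (\<tau> k) \<omega>) {..<n})"

text \<open>Wiener processes \<open>W i\<close>, \<open>i = 0, 1, \<dots>\<close>, on \<open>[0,S]\<close>; independence is that of the whole paths.\<close>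

definition cylindrical_wiener :: "'w measure \<Rightarrow> real \<Rightarrow> (nat \<Rightarrow> real \<Rightarrow> 'w \<Rightarrow> real) \<Rightarrow> bool"
  where "cylindrical_wiener M S W \<longleftrightarrow>
    (\<forall>i. standard_wiener M S (W i)) \<and>
    prob_space.indep_vars M (\<lambda>_. PiM {0..S} (\<lambda>_. borel)) (\<lambda>i \<omega>. \<lambda>t\<in>{0..S}. W i t \<omega>) UNIV"

text \<open>Sigma-algebra generated by the null sets and by \<open>W\<close> on \<open>[0,u]\<close>.\<close>

definition wiener_sigma :: "'w measure \<Rightarrow> (nat \<Rightarrow> real \<Rightarrow> 'w \<Rightarrow> real) \<Rightarrow> real \<Rightarrow> 'w set set"
  where "wiener_sigma M W u = sigma_sets (space M)
    ({W i s -` A \<inter> space M | i s A. 0 \<le> s \<and> s \<le> u \<and> A \<in> sets borel} \<union> null_sets M)"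

text \<open>The usual augmentation on the time interval \<open>[0,S]\<close>: for \<open>t < S\<close> the intersection over all
  \<open>u \<in> (t,S]\<close>, at \<open>t = S\<close> just the completed sigma-algebra.\<close>

definition wiener_filtration ::
    "'w measure \<Rightarrow> real \<Rightarrow> (nat \<Rightarrow> real \<Rightarrow> 'w \<Rightarrow> real) \<Rightarrow> real \<Rightarrow> 'w measure"
  where "wiener_filtration M S W t =
    sigma (space M) (\<Inter>u\<in>{u. u = S \<or> t < u \<and> u < S}. wiener_sigma M W u)"

definition predictable_sigma ::
    "'w measure \<Rightarrow> (real \<Rightarrow> 'w measure) \<Rightarrow> real \<Rightarrow> ('w \<times> real) measure"
  where "predictable_sigma M F S = sigma (space M \<times> {0..S})
    ({A \<times> {0} | A. A \<in> sets (F 0)} \<union>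
     {A \<times> {s<..t} | A s t. 0 \<le> s \<and> s < t \<and> t \<le> S \<and> A \<in> sets (F s)})"

definition predictable ::
    "'w measure \<Rightarrow> (real \<Rightarrow> 'w measure) \<Rightarrow> real \<Rightarrow> (real \<Rightarrow> 'w \<Rightarrow> 'v::topological_space) \<Rightarrow> bool"
  where "predictable M F S X \<longleftrightarrow>
    (\<lambda>(\<omega>, t). X t \<omega>) \<in> borel_measurable (predictable_sigma M F S)"

text \<open>The product of \<open>M\<close> and Lebesgue measure on \<open>[0,S]\<close>.\<close>

definition prod_leb :: "'w measure \<Rightarrow> real \<Rightarrow> ('w \<times> real) measure"
  where "prod_leb M S = M \<Otimes>\<^sub>M restrict_space lborel {0..S}"

definition ae_predictable ::
    "'w measure \<Rightarrow> (real \<Rightarrow> 'w measure) \<Rightarrow> real \<Rightarrow> (real \<Rightarrow> 'w \<Rightarrow> 'v::topological_space) \<Rightarrow> bool"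
  where "ae_predictable M F S X \<longleftrightarrow>
    (\<exists>Y. predictable M F S Y \<and> (AE (\<omega>, t) in prod_leb M S. X t \<omega> = Y t \<omega>))"


section \<open>Stochastic integral with respect to the cylindrical Wiener process\<close>

text \<open>
  An elementary integrand \<open>(n, \<tau>, m, \<xi>)\<close> on \<open>[0,S]\<close> is the process taking on each interval
  \<open>(\<tau> k, \<tau> (k+1)]\<close>, \<open>k < n\<close>, the value \<open>\<xi> k\<close>, a bounded random Hilbert--Schmidt operator known
  at time \<open>\<tau> k\<close> and living on the first \<open>m\<close> coordinates.
\<close>

definition elementary_integrand ::
    "(real \<Rightarrow> 'w measure) \<Rightarrow> real \<Rightarrow> nat \<Rightarrow> (nat \<Rightarrow> real) \<Rightarrow> nat \<Rightarrow> (nat \<Rightarrow> 'w \<Rightarrow> 'v::real_inner l2) \<Rightarrow> bool"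
  where "elementary_integrand F S n \<tau> m \<xi> \<longleftrightarrow>
    mono_on {..n} \<tau> \<and> \<tau> ` {..n} \<subseteq> {0..S} \<and>
    (\<forall>k<n. \<xi> k \<in> borel_measurable (F (\<tau> k)) \<and>
      (\<exists>K. \<forall>\<omega>\<in>space (F (\<tau> k)). norm (\<xi> k \<omega>) \<le> K) \<and>
      (\<forall>\<omega>\<in>space (F (\<tau> k)). \<forall>i\<ge>m. coord (\<xi> k \<omega>) i = 0))"

definition elementary_process ::
    "nat \<Rightarrow> (nat \<Rightarrow> real) \<Rightarrow> (nat \<Rightarrow> 'w \<Rightarrow> 'v::real_inner l2) \<Rightarrow> real \<Rightarrow> 'w \<Rightarrow> 'v l2"
  where "elementary_process n \<tau> \<xi> t \<omega> = (\<Sum>k<n. indicator {\<tau> k<..\<tau> (Suc k)} t *\<^sub>R \<xi> k \<omega>)"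

definition elementary_integral ::
    "(nat \<Rightarrow> real \<Rightarrow> 'w \<Rightarrow> real) \<Rightarrow> nat \<Rightarrow> (nat \<Rightarrow> real) \<Rightarrow> nat \<Rightarrow> (nat \<Rightarrow> 'w \<Rightarrow> 'v::real_inner l2) \<Rightarrow> 'w \<Rightarrow> 'v"
  where "elementary_integral W n \<tau> m \<xi> \<omega> =
    (\<Sum>k<n. \<Sum>i<m. (W i (\<tau> (Suc k)) \<omega> - W i (\<tau> k) \<omega>) *\<^sub>R coord (\<xi> k \<omega>) i)"

text \<open>
  \<open>X\<close> is \<open>\<integral>\<^sub>0\<^sup>S \<Phi> dW\<close>: it is the limit in probability of integrals of elementary integrands whose
  squared \<open>L\<^sup>2[0,S]\<close> distance from \<open>\<Phi>\<close> tends to zero in probability.  This covers every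
  predictable \<open>\<Phi>\<close> with \<open>\<integral>\<^sub>0\<^sup>S \<parallel>\<Phi>\<^sub>t\<parallel>\<^sup>2 dt < \<infinity>\<close> almost surely, and for such \<open>\<Phi>\<close> the integral is unique
  up to almost sure equality.  With \<open>'v = real\<close> it is \<open>\<integral>\<^sub>0\<^sup>S \<langle>\<Phi>\<^sub>t, dW\<^sub>t\<rangle>\<close>.  The measurability requirements
  are essential because \<open>measure M\<close> of a non-measurable set is \<open>0\<close>.
\<close>

definition has_ito_integral ::
    "'w measure \<Rightarrow> (real \<Rightarrow> 'w measure) \<Rightarrow> (nat \<Rightarrow> real \<Rightarrow> 'w \<Rightarrow> real) \<Rightarrow> real \<Rightarrow>
     (real \<Rightarrow> 'w \<Rightarrow> 'v::real_inner l2) \<Rightarrow> ('w \<Rightarrow> 'v) \<Rightarrow> bool"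
  where "has_ito_integral M F W S \<Phi> X \<longleftrightarrow>
    ae_predictable M F S \<Phi> \<and> X \<in> borel_measurable M \<and>
    (\<exists>n \<tau> m \<xi>. (\<forall>j. elementary_integrand F S (n j) (\<tau> j) (m j) (\<xi> j)) \<and>
      (\<forall>\<epsilon>>0. (\<lambda>j. measure M {\<omega>\<in>space M. ennreal \<epsilon> <
          (\<integral>\<^sup>+t\<in>{0..S}. ennreal ((norm (elementary_process (n j) (\<tau> j) (\<xi> j) t \<omega> - \<Phi> t \<omega>))\<^sup>2) \<partial>lborel)})
        \<longlonglongrightarrow> 0) \<and>
      (\<forall>\<epsilon>>0. (\<lambda>j. measure M {\<omega>\<in>space M.
          \<epsilon> < norm (elementary_integral W (n j) (\<tau> j) (m j) (\<xi> j) \<omega> - X \<omega>)})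
        \<longlonglongrightarrow> 0))"

definition ito_integral ::
    "'w measure \<Rightarrow> (real \<Rightarrow> 'w measure) \<Rightarrow> (nat \<Rightarrow> real \<Rightarrow> 'w \<Rightarrow> real) \<Rightarrow> real \<Rightarrow>
     (real \<Rightarrow> 'w \<Rightarrow> 'v::real_inner l2) \<Rightarrow> 'w \<Rightarrow> 'v"
  where "ito_integral M F W S \<Phi> = (SOME X. has_ito_integral M F W S \<Phi> X)"


section \<open>The spaces \<open>H = L\<^sup>2[0,S]\<close> and \<open>G = H\<^sup>1[0,S]\<close>\<close>

text \<open>
  As a type cannot depend on the real number \<open>S\<close>, the two Hilbert spaces are types \<open>'h\<close>, \<open>'g\<close>
  together with a map sending an element of the type to the function it stands for, and this map
  is required to be an isometric isomorphism onto \<open>L\<^sup>2[0,S]\<close> (resp. \<open>H\<^sup>1[0,S]\<close>).  This determines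
  the spaces up to isometric isomorphism.  Both are complete and separable, so that placing \<open>'h\<close>
  and \<open>'g\<close> in the corresponding type classes is no restriction; such types exist for every
  \<open>S > 0\<close>, e.g. \<open>real l2\<close> with coordinates with respect to an orthonormal basis.
\<close>

definition square_integrable :: "real \<Rightarrow> (real \<Rightarrow> real) \<Rightarrow> bool"
  where "square_integrable S d \<longleftrightarrow>
    set_borel_measurable lborel {0..S} d \<and> set_integrable lborel {0..S} (\<lambda>u. (d u)\<^sup>2)"

definition L2_space :: "real \<Rightarrow> ('h::real_inner \<Rightarrow> real \<Rightarrow> real) \<Rightarrow> bool"
  where "L2_space S repH \<longleftrightarrow>
    (\<forall>x. square_integrable S (repH x)) \<and>
    (\<forall>x y. AE u in lborel. u \<in> {0..S} \<longrightarrow> repH (x + y) u = repH x u + repH y u) \<and>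
    (\<forall>c x. AE u in lborel. u \<in> {0..S} \<longrightarrow> repH (c *\<^sub>R x) u = c * repH x u) \<and>
    (\<forall>d. square_integrable S d \<longrightarrow> (\<exists>x. AE u in lborel. u \<in> {0..S} \<longrightarrow> repH x u = d u)) \<and>
    (\<forall>x. (norm x)\<^sup>2 = (LBINT u:{0..S}. (repH x u)\<^sup>2))"

definition is_derivative :: "real \<Rightarrow> (real \<Rightarrow> real) \<Rightarrow> (real \<Rightarrow> real) \<Rightarrow> bool"
  where "is_derivative S g d \<longleftrightarrow>
    square_integrable S d \<and> (\<forall>T\<in>{0..S}. g T = g 0 + (LBINT u:{0..T}. d u))"

text \<open>Absolutely continuous functions on \<open>[0,S]\<close> with square integrable derivative; functions on
  \<open>[0,S]\<close> are extended by zero to get unique representatives.\<close>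

definition H1_functions :: "real \<Rightarrow> (real \<Rightarrow> real) set"
  where "H1_functions S = {g. (\<exists>d. is_derivative S g d) \<and> (\<forall>T. T \<notin> {0..S} \<longrightarrow> g T = 0)}"

definition H1_space :: "real \<Rightarrow> ('g::real_inner \<Rightarrow> real \<Rightarrow> real) \<Rightarrow> bool"
  where "H1_space S repG \<longleftrightarrow>
    bij_betw repG UNIV (H1_functions S) \<and>
    (\<forall>x y T. repG (x + y) T = repG x T + repG y T) \<and>
    (\<forall>c x T. repG (c *\<^sub>R x) T = c * repG x T) \<and>
    (\<forall>x d. is_derivative S (repG x) d \<longrightarrow>
      (norm x)\<^sup>2 = (repG x 0)\<^sup>2 + (LBINT u:{0..S}. (d u)\<^sup>2))"


section \<open>The bond market\<close>

text \<open>
  \<open>\<sigma> t \<omega>\<close> is a Hilbert--Schmidt operator given by its columns \<open>\<sigma>\<^sup>i(t,\<cdot>) = coord (\<sigma> t \<omega>) i\<close>.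
  Since elements of \<open>H\<close> are only defined almost everywhere, \<open>\<alpha>(t,T) = \<sigma>\<^sup>i(t,T) = 0\<close> for \<open>t \<ge> T\<close>
  is required for almost all \<open>T\<close>; conditions on \<open>\<alpha>\<^sub>t\<close> and \<open>\<sigma>\<^sub>t\<close> are imposed almost everywhere on
  \<open>\<Omega> \<times> [0,Sbar]\<close>.
\<close>

locale bond_market = prob_space M
  for M :: "'w measure" +
  fixes Sbar :: real
    and W :: "nat \<Rightarrow> real \<Rightarrow> 'w \<Rightarrow> real"
    and F :: "real \<Rightarrow> 'w measure"
    and repH :: "'h::{real_inner, banach, second_countable_topology} \<Rightarrow> real \<Rightarrow> real"
    and repG :: "'g::{real_inner, banach, second_countable_topology} \<Rightarrow> real \<Rightarrow> real"
    and f0 :: 'h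
    and f :: "real \<Rightarrow> 'w \<Rightarrow> 'h"
    and \<alpha> :: "real \<Rightarrow> 'w \<Rightarrow> 'h"
    and \<sigma> :: "real \<Rightarrow> 'w \<Rightarrow> 'h l2"
  assumes Sbar_pos: "0 < Sbar"
    and complete: "\<And>A N. N \<in> null_sets M \<Longrightarrow> A \<subseteq> N \<Longrightarrow> A \<in> sets M"
    and wiener: "cylindrical_wiener M Sbar W"
    and filtration: "F = wiener_filtration M Sbar W"
    and H_space: "L2_space Sbar repH"
    and G_space: "H1_space Sbar repG"
    and predictable_\<alpha>: "predictable M F Sbar \<alpha>"
    and predictable_\<sigma>: "predictable M F Sbar \<sigma>"
    and integrable_\<alpha>: "AE \<omega> in M. (\<integral>\<^sup>+t\<in>{0..Sbar}. ennreal (norm (\<alpha> t \<omega>)) \<partial>lborel) < \<infinity>"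
    and integrable_\<sigma>: "AE \<omega> in M. (\<integral>\<^sup>+t\<in>{0..Sbar}. ennreal ((norm (\<sigma> t \<omega>))\<^sup>2) \<partial>lborel) < \<infinity>"
    and adapted_f: "\<And>t. t \<in> {0..Sbar} \<Longrightarrow> f t \<in> borel_measurable (F t)"
    and continuous_f: "AE \<omega> in M. continuous_on {0..Sbar} (\<lambda>t. f t \<omega>)"
    and forward_rates: "\<And>t. t \<in> {0..Sbar} \<Longrightarrow> AE \<omega> in M.
      f t \<omega> = f0 + (LBINT s:{0..t}. \<alpha> s \<omega>) + ito_integral M F W t \<sigma> \<omega>"
    and vanish_\<alpha>: "AE (\<omega>, t) in prod_leb M Sbar. AE T in lborel.
      T \<in> {0..Sbar} \<and> T \<le> t \<longrightarrow> repH (\<alpha> t \<omega>) T = 0"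
    and vanish_\<sigma>: "AE (\<omega>, t) in prod_leb M Sbar. \<forall>i. AE T in lborel.
      T \<in> {0..Sbar} \<and> T \<le> t \<longrightarrow> repH (coord (\<sigma> t \<omega>) i) T = 0"
    and HJM: "AE (\<omega>, t) in prod_leb M Sbar. \<forall>T\<in>{0..Sbar}.
      (LBINT u=ereal t..ereal T. repH (\<alpha> t \<omega>) u) =
      (1/2) * (\<Sum>i. (LBINT u=ereal t..ereal T. repH (coord (\<sigma> t \<omega>) i) u)\<^sup>2)"

definition P_hat :: "('h \<Rightarrow> real \<Rightarrow> real) \<Rightarrow> (real \<Rightarrow> 'w \<Rightarrow> 'h) \<Rightarrow> real \<Rightarrow> 'w \<Rightarrow> real \<Rightarrow> real"
  where "P_hat repH f t \<omega> T = exp (- (LBINT u:{0..T}. repH (f t \<omega>) u))"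

definition bond_vol ::
    "('h::real_inner \<Rightarrow> real \<Rightarrow> real) \<Rightarrow> (real \<Rightarrow> 'w \<Rightarrow> 'h l2) \<Rightarrow> nat \<Rightarrow> real \<Rightarrow> 'w \<Rightarrow> real \<Rightarrow> real"
  where "bond_vol repH \<sigma> i t \<omega> T = - (LBINT u:{0..T}. repH (coord (\<sigma> t \<omega>) i) u)"

text \<open>The operator \<open>\<Gamma>\<^sub>t\<close>; \<open>inv repG\<close> turns a function on \<open>[0,S]\<close> (extended by zero) into the element
  of \<open>G\<close> it represents.\<close>

definition price_vol ::
    "real \<Rightarrow> ('h::real_inner \<Rightarrow> real \<Rightarrow> real) \<Rightarrow> ('g \<Rightarrow> real \<Rightarrow> real) \<Rightarrow>
     (real \<Rightarrow> 'w \<Rightarrow> 'h) \<Rightarrow> (real \<Rightarrow> 'w \<Rightarrow> 'h l2) \<Rightarrow> real \<Rightarrow> 'w \<Rightarrow> real l2 \<Rightarrow> 'g"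
  where "price_vol S repH repG f \<sigma> t \<omega> u = inv repG (\<lambda>T.
    if T \<in> {0..S} then P_hat repH f t \<omega> T * (\<Sum>i. bond_vol repH \<sigma> i t \<omega> T * coord u i) else 0)"


section \<open>Generalized integrands\<close>

definition pos_sqrt :: "('g::real_inner \<Rightarrow> 'g) \<Rightarrow> 'g \<Rightarrow> 'g"
  where "pos_sqrt A = (THE R. bounded_linear R \<and> (\<forall>x y. R x \<bullet> y = x \<bullet> R y) \<and>
    (\<forall>x. 0 \<le> R x \<bullet> x) \<and> R \<circ> R = A)"

text \<open>\<open>Q_half (\<Gamma> t \<omega>)\<close> is \<open>Q\<^sub>t\<^sup>1\<^sup>/\<^sup>2\<close>.\<close>

definition Q_half :: "(real l2 \<Rightarrow> 'g::real_inner) \<Rightarrow> 'g \<Rightarrow> 'g"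
  where "Q_half G = pos_sqrt (G \<circ> adjoint G)"

text \<open>A linear, not necessarily continuous, functional \<open>\<phi>\<close> with domain \<open>D\<close>; the values of \<open>\<phi>\<close>
  outside \<open>D\<close> are irrelevant.\<close>

definition linear_functional_on :: "'g::real_vector set \<Rightarrow> ('g \<Rightarrow> real) \<Rightarrow> bool"
  where "linear_functional_on D \<phi> \<longleftrightarrow> subspace D \<and>
    (\<forall>x\<in>D. \<forall>y\<in>D. \<phi> (x + y) = \<phi> x + \<phi> y) \<and> (\<forall>c. \<forall>x\<in>D. \<phi> (c *\<^sub>R x) = c * \<phi> x)"

text \<open>\<open>\<phi>\<^sub>t \<circ> Q\<^sub>t\<^sup>1\<^sup>/\<^sup>2\<close> as an element of \<open>G\<^sup>*\<close>, meaningful when it is a bounded functional.\<close>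

definition phi_Q_half ::
    "(real \<Rightarrow> 'w \<Rightarrow> real l2 \<Rightarrow> 'g::real_inner) \<Rightarrow> (real \<Rightarrow> 'w \<Rightarrow> 'g \<Rightarrow> real) \<Rightarrow> real \<Rightarrow> 'w \<Rightarrow> 'g \<Rightarrow>\<^sub>L real"
  where "phi_Q_half \<Gamma> \<phi> t \<omega> = Blinfun (\<phi> t \<omega> \<circ> Q_half (\<Gamma> t \<omega>))"

text \<open>Since \<open>\<phi>\<^sub>t \<circ> Q\<^sub>t\<^sup>1\<^sup>/\<^sup>2\<close> is in \<open>G\<^sup>*\<close> only almost everywhere, its predictability is understood up to
  null sets.\<close>

definition price_integrable ::
    "'w measure \<Rightarrow> (real \<Rightarrow> 'w measure) \<Rightarrow> real \<Rightarrow> (real \<Rightarrow> 'w \<Rightarrow> real l2 \<Rightarrow> 'g::real_inner) \<Rightarrow>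
     (real \<Rightarrow> 'w \<Rightarrow> 'g set) \<Rightarrow> (real \<Rightarrow> 'w \<Rightarrow> 'g \<Rightarrow> real) \<Rightarrow> bool"
  where "price_integrable M F S \<Gamma> D \<phi> \<longleftrightarrow>
    (\<forall>t\<in>{0..S}. \<forall>\<omega>\<in>space M. linear_functional_on (D t \<omega>) (\<phi> t \<omega>)) \<and>
    (AE (\<omega>, t) in prod_leb M S.
      range (Q_half (\<Gamma> t \<omega>)) \<subseteq> D t \<omega> \<and> bounded_linear (\<phi> t \<omega> \<circ> Q_half (\<Gamma> t \<omega>))) \<and>
    ae_predictable M F S (phi_Q_half \<Gamma> \<phi>) \<and>
    (AE \<omega> in M. (\<integral>\<^sup>+t\<in>{0..S}. ennreal ((norm (phi_Q_half \<Gamma> \<phi> t \<omega>))\<^sup>2) \<partial>lborel) < \<infinity>)"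

text \<open>\<open>\<integral>\<^sub>0\<^sup>S (\<phi>\<^sub>s, dP\<^sub>s)\<close>.\<close>

definition price_integral ::
    "'w measure \<Rightarrow> (real \<Rightarrow> 'w measure) \<Rightarrow> (nat \<Rightarrow> real \<Rightarrow> 'w \<Rightarrow> real) \<Rightarrow> real \<Rightarrow>
     (real \<Rightarrow> 'w \<Rightarrow> real l2 \<Rightarrow> 'g) \<Rightarrow> (real \<Rightarrow> 'w \<Rightarrow> 'g \<Rightarrow> real) \<Rightarrow> 'w \<Rightarrow> real"
  where "price_integral M F W S \<Gamma> \<phi> =
    ito_integral M F W S (\<lambda>s \<omega>. l2_riesz (\<lambda>u. \<phi> s \<omega> (\<Gamma> s \<omega> u)))"

end

theory Submission
  imports Defs
begin

text \<open>
  The integrand is obtained from the polar decomposition \<open>\<Gamma> = Q\<^sup>1\<^sup>/\<^sup>2 U\<close>, where \<open>U\<close> is an isometry because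
  \<open>\<Gamma>\<close> is injective.  On \<open>Dom \<phi> = Im Q\<^sup>1\<^sup>/\<^sup>2\<close> put \<open>\<phi> (Q\<^sup>1\<^sup>/\<^sup>2 z) = \<langle>U \<psi>, z\<rangle>\<close>.  Then
  \<open>\<phi> (\<Gamma> u) = \<langle>U \<psi>, U u\<rangle> = \<langle>\<psi>, u\<rangle>\<close> and \<open>\<phi> \<circ> Q\<^sup>1\<^sup>/\<^sup>2\<close> has norm at most \<open>\<parallel>\<psi>\<parallel>\<close>.  Both \<open>Q\<^sup>1\<^sup>/\<^sup>2\<close> and \<open>U \<psi>\<close>
  are limits of polynomials in \<open>Q\<close>, so \<open>U \<psi>\<close> is measurable in \<open>\<psi>\<close> and in the columns of \<open>\<Gamma>\<close>.
  These columns are the curves with values \<open>- exp (- \<integral>\<^sub>0\<^sup>T f) \<integral>\<^sub>0\<^sup>T \<sigma>\<^sup>i\<close> and depend continuously on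
  \<open>(f, \<sigma>\<^sup>i) \<in> H \<times> H\<close>, hence are predictable up to null sets.  As \<open>\<Gamma>\<^sup>* \<circ> \<phi>\<close> equals \<open>\<psi>\<close> almost everywhere,
  both sides of the equation are literally the same stochastic integral.
\<close>

section \<open>Completeness of the space of square-summable sequences\<close>

text \<open>Discontinuous functionals cannot be avoided. For continuous \<open>\<phi>\<close>, the
  relation \<open>\<phi> (\<Gamma> u) = \<psi> \<bullet> u\<close> for all \<open>u\<close> puts
  \<open>\<psi>\<close> in the range of the adjoint of \<open>\<Gamma>\<close>; as
  \<open>\<Gamma>\<close> is compact and injective, that range is dense in l2 but not closed. For
  the same reason Q has no bounded inverse, so U \<open>\<psi>\<close> cannot be computed by
  inverting Q^(1/2), and choosing it separately for each \<open>\<omega>\<close> and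
  \<open>t\<close> would lose predictability. The remedy is to use explicit series in the columns of
  \<open>\<Gamma>\<close> that converge for every Hilbert-Schmidt operator. With c at least the
  operator norm of \<open>\<Gamma>\<close>, the binomial series of sqrt(1 - t) is evaluated at t = 1
  - Q/c^2, whose spectrum may reach t = 1; it still converges absolutely there, because all
  coefficients but the first have the same sign. The Neumann series for the inverse of Q may
  diverge, but its image under Q^(1/2) converges. Since \<open>pos_sqrt\<close> is a definite
  description, the series must also be shown to be the only positive root.\<close>

lemma coord_simps [simp]:
  "coord (x + y) i = coord x i + coord y i"
  "coord (x - y) i = coord x i - coord y i"
  "coord (c *\<^sub>R x) i = c *\<^sub>R coord x i"
  "coord (- x) i = - coord x i"
  "coord 0 i = 0"
  by (simp_all add: plus_l2.rep_eq minus_l2.rep_eq scaleR_l2.rep_eq uminus_l2.rep_eq zero_l2.rep_eq)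

lemma coord_Abs_l2: "summable (\<lambda>i. (norm (x i))\<^sup>2) \<Longrightarrow> coord (Abs_l2 x) = x"
  by (simp add: Abs_l2_inverse)

lemma norm_l2_square: "(norm x)\<^sup>2 = (\<Sum>i. (norm (coord x i))\<^sup>2)"
  by (simp add: power2_norm_eq_inner inner_l2_def)

lemma sum_coord_le: "(\<Sum>i<k. (norm (coord x i))\<^sup>2) \<le> (norm x)\<^sup>2"
  unfolding norm_l2_square by (intro sum_le_suminf summable_coord) auto

lemma norm_coord_le: "norm (coord x i) \<le> norm x"
proof (rule power2_le_imp_le)
  show "(norm (coord x i))\<^sup>2 \<le> (norm x)\<^sup>2"
    unfolding norm_l2_square using sum_le_suminf[OF summable_coord[of x], of "{i}"] by simp
qed simp

lemma bounded_linear_coord: "bounded_linear (\<lambda>x. coord x i)"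
  by (rule bounded_linear_intro[where K=1]) (auto simp: norm_coord_le)

text \<open>The Cauchy estimate passes to the coordinatewise limit on finite partial sums, with a
  bound independent of their length; this gives both membership and norm convergence. Completeness
  of \<open>real l2\<close> is what lets powers of an operator on l2 converge later.\<close>

instance l2 :: ("{real_inner, banach}") banach
proof
  fix X :: "nat \<Rightarrow> 'a l2"
  assume X: "Cauchy X"
  have "Cauchy (\<lambda>n. coord (X n) i)" for i
    by (rule bounded_linear.Cauchy[OF bounded_linear_coord X])
  then have "\<forall>i. \<exists>y. (\<lambda>n. coord (X n) i) \<longlonglongrightarrow> y"
    by (simp add: Cauchy_convergent_iff convergent_def)
  then obtain y where y: "\<And>i. (\<lambda>n. coord (X n) i) \<longlonglongrightarrow> y i"
    by metis
  have partial: "\<exists>N. \<forall>n\<ge>N. \<forall>k. (\<Sum>i<k. (norm (coord (X n) i - y i))\<^sup>2) \<le> e\<^sup>2" if "e > 0" for e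
  proof -
    from X that obtain N where N: "\<And>m n. m \<ge> N \<Longrightarrow> n \<ge> N \<Longrightarrow> norm (X n - X m) < e"
      unfolding Cauchy_iff by metis
    have "(\<Sum>i<k. (norm (coord (X n) i - y i))\<^sup>2) \<le> e\<^sup>2" if n: "n \<ge> N" for n k
    proof (rule LIMSEQ_le_const2)
      show "(\<lambda>m. \<Sum>i<k. (norm (coord (X n) i - coord (X m) i))\<^sup>2) \<longlonglongrightarrow>
          (\<Sum>i<k. (norm (coord (X n) i - y i))\<^sup>2)"
        by (intro tendsto_intros y)
      have "(\<Sum>i<k. (norm (coord (X n) i - coord (X m) i))\<^sup>2) \<le> e\<^sup>2" if "m \<ge> N" for m
        using sum_coord_le[of "X n - X m" k] N[OF that n] power_mono[of "norm (X n - X m)" e 2]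
        by simp
      then show "\<exists>N. \<forall>m\<ge>N. (\<Sum>i<k. (norm (coord (X n) i - coord (X m) i))\<^sup>2) \<le> e\<^sup>2"
        by blast
    qed
    then show ?thesis by blast
  qed
  obtain N where N: "\<And>k. (\<Sum>i<k. (norm (coord (X N) i - y i))\<^sup>2) \<le> 1\<^sup>2"
    using partial[of 1] by auto
  have "summable (\<lambda>i. (norm (coord (X N) i - y i))\<^sup>2)"
    by (rule summableI_nonneg_bounded[OF _ N]) simp
  \<comment> \<open>The limit \<open>y\<close> is written as \<open>X N - (X N - y)\<close>, a
    difference of two square-summable sequences.\<close>
  from l2_summable_add[OF summable_coord[of "X N"] l2_summable_scaleR[OF this, of "-1"]]
  have "summable (\<lambda>i. (norm (y i))\<^sup>2)"
    by simp
  then have coord_y: "coord (Abs_l2 y) = y"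
    by (rule coord_Abs_l2)
  have "X \<longlonglongrightarrow> Abs_l2 y"
  proof (rule LIMSEQ_I)
    fix r :: real
    assume r: "0 < r"
    then obtain N where N: "\<And>n k. n \<ge> N \<Longrightarrow> (\<Sum>i<k. (norm (coord (X n) i - y i))\<^sup>2) \<le> (r/2)\<^sup>2"
      using partial[of "r/2"] by auto
    have "norm (X n - Abs_l2 y) < r" if "n \<ge> N" for n
    proof -
      have "(norm (X n - Abs_l2 y))\<^sup>2 \<le> (r/2)\<^sup>2"
        unfolding norm_l2_square using N[OF that]
        by (intro suminf_le_const summable_coord) (auto simp: coord_y)
      then have "norm (X n - Abs_l2 y) \<le> r/2"
        by (rule power2_le_imp_le) (use r in simp)
      then show ?thesis using r by simp
    qed
    then show "\<exists>no. \<forall>n\<ge>no. norm (X n - Abs_l2 y) < r" by blast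
  qed
  then show "convergent X"
    by (auto simp: convergent_def)
qed

section \<open>Hilbert--Schmidt operators\<close>

definition hs_op :: "'a::{real_inner, banach} l2 \<Rightarrow> real l2 \<Rightarrow> 'a"
  where "hs_op x u = (\<Sum>i. coord u i *\<^sub>R coord x i)"

definition hs_adj :: "'a::{real_inner, banach} l2 \<Rightarrow> 'a \<Rightarrow> real l2"
  where "hs_adj x y = Abs_l2 (\<lambda>i. coord x i \<bullet> y)"

text \<open>Cauchy-Schwarz for the two scalar sequences of norms gives absolute convergence of the
  column series.\<close>

lemma summable_hs: "summable (\<lambda>i. norm (coord u i *\<^sub>R coord x i))"
  using l2_summable_inner[of "\<lambda>i. \<bar>coord u i\<bar>" "\<lambda>i. norm (coord x i)"]
    summable_coord[of u] summable_coord[of x]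
  by simp

lemma hs_op_sums: "(\<lambda>i. coord u i *\<^sub>R coord x i) sums hs_op x u"
  unfolding hs_op_def by (rule summable_sums[OF summable_norm_cancel[OF summable_hs]])

lemma inner_coord_bound: "(norm (coord x i \<bullet> y))\<^sup>2 \<le> (norm (coord x i))\<^sup>2 * (norm y)\<^sup>2"
proof -
  have "(norm (coord x i \<bullet> y))\<^sup>2 \<le> (norm (coord x i) * norm y)\<^sup>2"
    by (intro power_mono) (auto simp: Cauchy_Schwarz_ineq2)
  then show ?thesis by (simp add: power_mult_distrib)
qed

lemma summable_inner_coord: "summable (\<lambda>i. (norm (coord x i \<bullet> y))\<^sup>2)"
  by (rule summable_comparison_test'[OF summable_mult2[OF summable_coord[of x], of "(norm y)\<^sup>2"]])
    (use inner_coord_bound in auto)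

lemma coord_hs_adj [simp]: "coord (hs_adj x y) i = coord x i \<bullet> y"
  unfolding hs_adj_def by (subst coord_Abs_l2[OF summable_inner_coord]) simp

lemma norm_hs_adj_le: "norm (hs_adj x y) \<le> norm x * norm y"
proof (rule power2_le_imp_le)
  have "(norm (hs_adj x y))\<^sup>2 \<le> (\<Sum>i. (norm (coord x i))\<^sup>2 * (norm y)\<^sup>2)"
    unfolding norm_l2_square coord_hs_adj
    by (intro suminf_le inner_coord_bound summable_inner_coord summable_mult2 summable_coord)
  also have "\<dots> = (norm x * norm y)\<^sup>2"
    by (simp add: norm_l2_square power_mult_distrib suminf_mult2[symmetric] summable_coord)
  finally show "(norm (hs_adj x y))\<^sup>2 \<le> (norm x * norm y)\<^sup>2" .
qed simp

lemma hs_op_inner: "hs_op x u \<bullet> y = u \<bullet> hs_adj x y"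
  using bounded_linear.sums[OF bounded_linear_inner_left[of y] hs_op_sums[of u x]]
  by (simp add: inner_l2_def sums_iff)

lemma adjoint_hs_op: "adjoint (hs_op x) = hs_adj x"
  by (rule adjoint_unique) (simp add: hs_op_inner)

text \<open>Duality: pairing \<open>hs_op x u\<close> with itself moves one factor to the adjoint,
  whose bound is known, and one factor of the norm cancels.\<close>

lemma norm_hs_op_le: "norm (hs_op x u) \<le> norm x * norm u"
proof (cases "norm (hs_op x u) = 0")
  case False
  have "norm (hs_op x u) * norm (hs_op x u) = u \<bullet> hs_adj x (hs_op x u)"
    by (simp add: hs_op_inner[symmetric] dot_square_norm power2_eq_square)
  also have "\<dots> \<le> norm u * (norm x * norm (hs_op x u))"
    using norm_cauchy_schwarz[of u "hs_adj x (hs_op x u)"]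
      mult_left_mono[OF norm_hs_adj_le[of x "hs_op x u"], of "norm u"] by simp
  finally show ?thesis
    using False by (simp add: mult.commute mult.left_commute)
qed simp

lemma bounded_linear_hs_op: "bounded_linear (hs_op x)"
proof (rule bounded_linear_intro)
  show "hs_op x (u + v) = hs_op x u + hs_op x v" for u v
    using sums_add[OF hs_op_sums hs_op_sums, of u x v x]
    by (simp add: hs_op_def sums_iff scaleR_add_left)
  show "hs_op x (r *\<^sub>R u) = r *\<^sub>R hs_op x u" for r u
    using bounded_linear.sums[OF bounded_linear_scaleR_right[of r] hs_op_sums[of u x]]
    by (simp add: hs_op_def sums_iff)
  show "norm (hs_op x u) \<le> norm u * norm x" for u
    using norm_hs_op_le[of x u] by (simp add: mult.commute)
qed

lemma bounded_linear_hs_adj: "bounded_linear (hs_adj x)"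
proof (rule bounded_linear_intro)
  show "hs_adj x (u + v) = hs_adj x u + hs_adj x v" for u v
    by (simp add: coord_inject[symmetric] fun_eq_iff inner_add_right)
  show "hs_adj x (r *\<^sub>R u) = r *\<^sub>R hs_adj x u" for r u
    by (simp add: coord_inject[symmetric] fun_eq_iff)
  show "norm (hs_adj x u) \<le> norm u * norm x" for u
    using norm_hs_adj_le[of x u] by (simp add: mult.commute)
qed

section \<open>Positive operators and their square roots\<close>

text \<open>These are the conditions on the root inside \<open>pos_sqrt\<close>, apart from the
  equation for its square.\<close>

definition pos_op :: "('a::real_inner \<Rightarrow> 'a) \<Rightarrow> bool"
  where "pos_op A \<longleftrightarrow> bounded_linear A \<and> (\<forall>x y. A x \<bullet> y = x \<bullet> A y) \<and> (\<forall>x. 0 \<le> A x \<bullet> x)"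

lemma pos_opD:
  assumes "pos_op A"
  shows "bounded_linear A" "A x \<bullet> y = x \<bullet> A y" "0 \<le> A x \<bullet> x"
  using assms by (auto simp: pos_op_def)

lemma bounded_linear_funpow:
  assumes "bounded_linear (T :: 'a::real_normed_vector \<Rightarrow> 'a)"
  shows "bounded_linear (T ^^ k)"
  by (induction k) (auto intro: bounded_linear_ident bounded_linear_compose[OF assms] simp: o_def id_def)

lemma inner_funpow:
  fixes T :: "'a::real_inner \<Rightarrow> 'a"
  assumes "\<And>x y. T x \<bullet> y = x \<bullet> T y"
  shows "(T ^^ k) x \<bullet> y = x \<bullet> (T ^^ k) y"
  by (induction k arbitrary: x y) (auto simp: assms funpow_swap1)

lemma norm_funpow_le:
  fixes T :: "'a::real_normed_vector \<Rightarrow> 'a"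
  assumes "\<And>x. norm (T x) \<le> norm x"
  shows "norm ((T ^^ k) x) \<le> norm x"
  by (induction k) (auto intro: order_trans[OF assms])

text \<open>Evaluates \<open>A - A\<^sup>2 = A (1 - A) A + (1 - A) A (1 - A) \<ge> 0\<close>.\<close>

lemma pos_op_square_le:
  assumes A: "pos_op A" and le: "\<And>x. A x \<bullet> x \<le> x \<bullet> x"
  shows "A x \<bullet> A x \<le> A x \<bullet> x"
proof -
  interpret bounded_linear A by (rule pos_opD(1)[OF A])
  have "0 \<le> A x \<bullet> A x - A (A x) \<bullet> A x"
    using le[of "A x"] by simp
  moreover have "0 \<le> A (x - A x) \<bullet> (x - A x)"
    by (rule pos_opD(3)[OF A])
  moreover have "A (A x) \<bullet> x = A x \<bullet> A x"
    by (rule pos_opD(2)[OF A])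
  ultimately show ?thesis
    by (simp add: diff inner_diff_left inner_diff_right)
qed

text \<open>As quadratic forms \<open>A^2 \<le> A \<le> 1\<close>, so the squared norm of
  \<open>A x\<close> is at most that of \<open>x\<close>.\<close>

lemma pos_op_contraction:
  assumes A: "pos_op A" and le: "\<And>x. A x \<bullet> x \<le> x \<bullet> x"
  shows "norm (A x) \<le> norm x"
  using pos_op_square_le[OF A le, of x] le[of x] by (simp add: norm_le)

lemma pos_op_one_minus:
  assumes A: "pos_op A" and le: "\<And>x. A x \<bullet> x \<le> x \<bullet> x"
  shows "pos_op (\<lambda>x. x - A x)" "(x - A x) \<bullet> x \<le> x \<bullet> x"
  using pos_opD[OF A] le
  by (auto simp: pos_op_def inner_diff_left inner_diff_right intro!: bounded_linear_sub bounded_linear_ident)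

text \<open>The moments \<open>\<langle>T\<^sup>n x, x\<rangle>\<close> decrease to a limit, and \<open>\<parallel>T\<^sup>n x - T\<^sup>m x\<parallel>\<^sup>2\<close> is a combination of them.\<close>

lemma contraction_powers_converge:
  fixes T :: "'a::{real_inner, banach} \<Rightarrow> 'a"
  assumes T: "pos_op T" and le: "\<And>x. T x \<bullet> x \<le> x \<bullet> x"
  obtains w where "(\<lambda>n. (T ^^ n) x) \<longlonglongrightarrow> w" "T w = w"
proof -
  interpret bounded_linear T by (rule pos_opD(1)[OF T])
  define a where "a n = (T ^^ n) x \<bullet> x" for n
  have inner: "(T ^^ n) x \<bullet> (T ^^ m) x = a (n + m)" for n m
    unfolding a_def inner_funpow[of T, OF pos_opD(2)[OF T], of m, symmetric]
    by (simp add: funpow_add add.commute)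
  have even: "a (2 * k) = (T ^^ k) x \<bullet> (T ^^ k) x" for k
    using inner[of k k] by (simp add: mult_2)
  have odd: "a (Suc (2 * k)) = T ((T ^^ k) x) \<bullet> (T ^^ k) x" for k
    using inner[of "Suc k" k] by (simp add: mult_2)
  \<comment> \<open>With \<open>y = (T ^^ k) x\<close>, the step from \<open>2 * k\<close> is
    \<open>T \<le> 1\<close> at \<open>y\<close>, and the step from \<open>2 * k + 1\<close> is
    \<open>T^2 \<le> T\<close> at \<open>y\<close>.\<close>
  have "a (Suc n) \<le> a n \<and> 0 \<le> a n" for n
  proof (cases "even n")
    case True
    then obtain k where "n = 2 * k" by blast
    then show ?thesis
      using le[of "(T ^^ k) x"] by (simp add: even odd)
  next
    case False
    then obtain k where n: "n = Suc (2 * k)" by (metis oddE Suc_eq_plus1)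
    have "a (Suc n) = T ((T ^^ k) x) \<bullet> T ((T ^^ k) x)"
      using even[of "Suc k"] n by simp
    then show ?thesis
      using pos_op_square_le[OF T le, of "(T ^^ k) x"] pos_opD(3)[OF T] n by (simp add: odd)
  qed
  then have "decseq a" "\<And>n. 0 \<le> a n"
    by (auto intro: decseq_SucI)
  then have "Cauchy a"
    using decseq_convergent[of a 0] by (metis LIMSEQ_imp_Cauchy)
  have "Cauchy (\<lambda>n. (T ^^ n) x)"
    unfolding Cauchy_iff
  proof (intro allI impI)
    fix e :: real
    assume e: "0 < e"
    with \<open>Cauchy a\<close> obtain N where N: "\<And>m n. m \<ge> N \<Longrightarrow> n \<ge> N \<Longrightarrow> norm (a m - a n) < e\<^sup>2 / 2"
      unfolding Cauchy_iff by (metis half_gt_zero zero_less_power)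
    have "norm ((T ^^ m) x - (T ^^ n) x) < e" if "m \<ge> N" "n \<ge> N" for m n
    proof (rule power_less_imp_less_base)
      have "(norm ((T ^^ m) x - (T ^^ n) x))\<^sup>2 = (a (m + m) - a (m + n)) + (a (n + n) - a (m + n))"
        unfolding power2_norm_eq_inner
        by (simp add: inner_diff_left inner_diff_right inner add.commute)
      also have "\<dots> < e\<^sup>2 / 2 + e\<^sup>2 / 2"
        using N[of "m + m" "m + n"] N[of "n + n" "m + n"] that
        unfolding real_norm_def by linarith
      finally show "(norm ((T ^^ m) x - (T ^^ n) x))\<^sup>2 < e\<^sup>2" by simp
    qed (use e in simp)
    then show "\<exists>M. \<forall>m\<ge>M. \<forall>n\<ge>M. norm ((T ^^ m) x - (T ^^ n) x) < e" by blast
  qed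
  then obtain w where w: "(\<lambda>n. (T ^^ n) x) \<longlonglongrightarrow> w"
    by (auto simp: Cauchy_convergent_iff convergent_def)
  from tendsto[OF w] LIMSEQ_Suc[OF w] have "T w = w"
    by (auto intro: LIMSEQ_unique)
  with w show ?thesis by (rule that)
qed

text \<open>The coefficients of the power series of \<open>sqrt (1 - t)\<close>; only the zeroth one is positive.\<close>

definition sqrt_coeff :: "nat \<Rightarrow> real"
  where "sqrt_coeff k = ((1/2) gchoose k) * (-1) ^ k"

lemma sqrt_coeff_0 [simp]: "sqrt_coeff 0 = 1"
  by (simp add: sqrt_coeff_def)

lemma gbinomial_sign:
  fixes a :: real
  assumes "a < 0"
  shows "0 \<le> (-1) ^ k * (a gchoose k)"
  using assms pochhammer_nonneg[of "-a" k] by (simp add: gbinomial_pochhammer)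

text \<open>Absorption lowers the upper index from 1/2 to -1/2, where the sign of the binomial
  coefficient is that of \<open>(-1) ^ k\<close>; one factor -1 is left over.\<close>

lemma sqrt_coeff_Suc_nonpos: "sqrt_coeff (Suc k) \<le> 0"
proof -
  have "((1/2) gchoose (Suc k)) = (1/2) / (of_nat (Suc k)) * ((- 1/2 :: real) gchoose k)"
    using gbinomial_absorption'[of "Suc k" "1/2::real"] by simp
  then have "sqrt_coeff (Suc k) = - ((1/2) / (of_nat (Suc k)) * ((-1) ^ k * ((- 1/2 :: real) gchoose k)))"
    by (simp add: sqrt_coeff_def)
  then show ?thesis
    using gbinomial_sign[of "-1/2" k] by simp
qed

text \<open>Since only the zeroth coefficient is positive, the sum of absolute values is 1 minus a
  partial sum of the coefficients, and that partial sum has the nonnegative closed form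
  \<open>(-1) ^ n * ((-1/2) gchoose n)\<close>. The sharp constant 1 is also what makes the operator
  root positive.\<close>

lemma sum_abs_sqrt_coeff: "(\<Sum>k<n. \<bar>sqrt_coeff (Suc k)\<bar>) \<le> 1"
proof -
  have "(\<Sum>k<n. \<bar>sqrt_coeff (Suc k)\<bar>) = 1 - (\<Sum>k\<le>n. sqrt_coeff k)"
    using sqrt_coeff_Suc_nonpos
    by (simp add: lessThan_Suc_atMost[symmetric] sum.lessThan_Suc_shift sum_negf del: sum.lessThan_Suc)
  also have "(\<Sum>k\<le>n. sqrt_coeff k) = (-1) ^ n * ((-1/2) gchoose n)"
    unfolding sqrt_coeff_def gbinomial_sum_lower_neg by simp
  finally show ?thesis
    using gbinomial_sign[of "-1/2" n] by simp
qed

lemma summable_sqrt_coeff_Suc: "summable (\<lambda>k. \<bar>sqrt_coeff (Suc k)\<bar>)"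
  by (rule summableI_nonneg_bounded[OF _ sum_abs_sqrt_coeff]) simp

lemma summable_sqrt_coeff: "summable (\<lambda>k. \<bar>sqrt_coeff k\<bar>)"
  using summable_sqrt_coeff_Suc by (rule summable_Suc_iff[THEN iffD1])

text \<open>Vandermonde with 1/2 + 1/2 = 1: these are the coefficients of 1 - t, the square of
  sqrt(1 - t).\<close>

lemma sqrt_coeff_convolution:
  "(\<Sum>i\<le>n. sqrt_coeff i * sqrt_coeff (n - i)) = (if n = 0 then 1 else if n = 1 then -1 else 0)"
proof -
  have "(\<Sum>i\<le>n. sqrt_coeff i * sqrt_coeff (n - i)) =
      (\<Sum>i\<le>n. (-1) ^ n * (((1/2) gchoose i) * ((1/2) gchoose (n - i))))"
  proof (rule sum.cong)
    fix i
    assume "i \<in> {..n}"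
    then have "(-1 :: real) ^ n = (-1) ^ i * (-1) ^ (n - i)"
      by (simp add: power_add[symmetric])
    then show "sqrt_coeff i * sqrt_coeff (n - i) =
        (-1) ^ n * (((1/2) gchoose i) * ((1/2) gchoose (n - i)))"
      by (simp add: sqrt_coeff_def)
  qed simp
  also have "\<dots> = (-1) ^ n * ((1/2 + 1/2) gchoose n)"
    using gbinomial_Vandermonde[of "1/2::real" "1/2" n]
    by (simp add: sum_distrib_left[symmetric] atLeast0AtMost)
  also have "((1/2 + 1/2 :: real) gchoose n) = of_nat (1 choose n)"
    by (simp add: binomial_gbinomial)
  also have "(-1) ^ n * of_nat (1 choose n) = (if n = 0 then 1 else if n = 1 then -1 else 0 :: real)"
    by (cases n) (auto simp: binomial_eq_0)
  finally show ?thesis .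
qed


definition sqrt_one_minus :: "('a::{real_inner, banach} \<Rightarrow> 'a) \<Rightarrow> 'a \<Rightarrow> 'a"
  where "sqrt_one_minus T x = (\<Sum>k. sqrt_coeff k *\<^sub>R (T ^^ k) x)"

context
  fixes T :: "'a::{real_inner, banach} \<Rightarrow> 'a"
  assumes T: "bounded_linear T"
    and symmetric: "\<And>x y. T x \<bullet> y = x \<bullet> T y"
    and contraction: "\<And>x. norm (T x) \<le> norm x"
begin

lemma norm_sqrt_term: "norm (sqrt_coeff k *\<^sub>R (T ^^ k) x) \<le> \<bar>sqrt_coeff k\<bar> * norm x"
  using norm_funpow_le[OF contraction] by (simp add: mult_left_mono)

lemma summable_sqrt_term: "summable (\<lambda>k. norm (sqrt_coeff k *\<^sub>R (T ^^ k) x))"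
  by (rule summable_comparison_test'[OF summable_mult2[OF summable_sqrt_coeff]])
    (use norm_sqrt_term in simp)

lemma sqrt_one_minus_sums: "(\<lambda>k. sqrt_coeff k *\<^sub>R (T ^^ k) x) sums sqrt_one_minus T x"
  unfolding sqrt_one_minus_def by (rule summable_sums[OF summable_norm_cancel[OF summable_sqrt_term]])

lemma bounded_linear_sqrt_one_minus: "bounded_linear (sqrt_one_minus T)"
proof (rule bounded_linear_intro)
  fix x y :: 'a and r :: real
  note lin = bounded_linear_funpow[OF T, THEN bounded_linear.linear]
  show "sqrt_one_minus T (x + y) = sqrt_one_minus T x + sqrt_one_minus T y"
    using sums_add[OF sqrt_one_minus_sums sqrt_one_minus_sums, of x y]
    by (simp add: sqrt_one_minus_def sums_iff linear_add[OF lin] scaleR_add_right)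
  show "sqrt_one_minus T (r *\<^sub>R x) = r *\<^sub>R sqrt_one_minus T x"
    using bounded_linear.sums[OF bounded_linear_scaleR_right[of r] sqrt_one_minus_sums[of x]]
    by (simp add: sqrt_one_minus_def sums_iff linear_cmul[OF lin] mult.commute)
  have "norm (sqrt_one_minus T x) \<le> (\<Sum>k. norm (sqrt_coeff k *\<^sub>R (T ^^ k) x))"
    unfolding sqrt_one_minus_def by (rule summable_norm[OF summable_sqrt_term])
  also have "\<dots> \<le> (\<Sum>k. \<bar>sqrt_coeff k\<bar> * norm x)"
    by (intro suminf_le norm_sqrt_term summable_sqrt_term summable_mult2 summable_sqrt_coeff)
  also have "\<dots> = norm x * (\<Sum>k. \<bar>sqrt_coeff k\<bar>)"
    by (simp add: suminf_mult2[OF summable_sqrt_coeff, symmetric])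
  finally show "norm (sqrt_one_minus T x) \<le> norm x * (\<Sum>k. \<bar>sqrt_coeff k\<bar>)" .
qed

lemma sqrt_one_minus_inner_sums:
  "(\<lambda>k. sqrt_coeff k * ((T ^^ k) x \<bullet> y)) sums (sqrt_one_minus T x \<bullet> y)"
  using bounded_linear.sums[OF bounded_linear_inner_left[of y] sqrt_one_minus_sums[of x]] by simp

text \<open>Symmetry holds term by term. For positivity, the zeroth term contributes
  \<open>x \<bullet> x\<close>, and by \<open>sum_abs_sqrt_coeff\<close> all other terms together
  remove at most that much.\<close>

lemma pos_op_sqrt_one_minus: "pos_op (sqrt_one_minus T)"
  unfolding pos_op_def
proof (intro conjI allI bounded_linear_sqrt_one_minus)
  fix x y :: 'a
  show "sqrt_one_minus T x \<bullet> y = x \<bullet> sqrt_one_minus T y"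
    using sqrt_one_minus_inner_sums[of x y] sqrt_one_minus_inner_sums[of y x]
    by (simp add: inner_funpow[of T, OF symmetric] inner_commute[of _ x] sums_iff)
  have term_le: "\<bar>sqrt_coeff (Suc k) * ((T ^^ Suc k) x \<bullet> x)\<bar> \<le> \<bar>sqrt_coeff (Suc k)\<bar> * (norm x)\<^sup>2" for k
  proof -
    have "\<bar>(T ^^ Suc k) x \<bullet> x\<bar> \<le> norm ((T ^^ Suc k) x) * norm x"
      by (rule Cauchy_Schwarz_ineq2)
    also have "\<dots> \<le> norm x * norm x"
      by (rule mult_right_mono[OF norm_funpow_le[OF contraction]]) simp
    finally show ?thesis
      unfolding abs_mult power2_eq_square by (rule mult_left_mono) simp
  qed
  have "(\<lambda>k. sqrt_coeff (Suc k) * ((T ^^ Suc k) x \<bullet> x)) sums (sqrt_one_minus T x \<bullet> x - x \<bullet> x)"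
    using sums_Suc_iff[of "\<lambda>k. sqrt_coeff k * ((T ^^ k) x \<bullet> x)" "sqrt_one_minus T x \<bullet> x - x \<bullet> x"]
      sqrt_one_minus_inner_sums[of x x] by simp
  then have "(\<lambda>k. - (sqrt_coeff (Suc k) * ((T ^^ Suc k) x \<bullet> x))) sums
      (x \<bullet> x - sqrt_one_minus T x \<bullet> x)"
    by (auto dest: sums_minus)
  moreover have "(\<Sum>k<n. - (sqrt_coeff (Suc k) * ((T ^^ Suc k) x \<bullet> x))) \<le> (norm x)\<^sup>2" for n
  proof -
    have "(\<Sum>k<n. - (sqrt_coeff (Suc k) * ((T ^^ Suc k) x \<bullet> x)))
        \<le> (\<Sum>k<n. \<bar>sqrt_coeff (Suc k)\<bar> * (norm x)\<^sup>2)"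
      using term_le by (intro sum_mono) (metis abs_le_D2)
    also have "\<dots> \<le> 1 * (norm x)\<^sup>2"
      unfolding sum_distrib_right[symmetric] by (rule mult_right_mono[OF sum_abs_sqrt_coeff]) simp
    finally show ?thesis by simp
  qed
  ultimately have "x \<bullet> x - sqrt_one_minus T x \<bullet> x \<le> (norm x)\<^sup>2"
    unfolding sums_def by (intro LIMSEQ_le_const2) auto
  then show "0 \<le> sqrt_one_minus T x \<bullet> x"
    by (simp add: power2_norm_eq_inner)
qed

lemma sqrt_one_minus_has_sum:
  "((\<lambda>k. sqrt_coeff k *\<^sub>R (T ^^ k) x) has_sum sqrt_one_minus T x) UNIV"
  by (rule norm_summable_imp_has_sum[OF summable_sqrt_term sqrt_one_minus_sums])

text \<open>A Cauchy product: the double family is dominated by the product of two absolutely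
  summable coefficient sequences, so it may be summed along diagonals, where
  \<open>sqrt_coeff_convolution\<close> leaves only \<open>n = 0\<close> and
  \<open>n = 1\<close>.\<close>

lemma sqrt_one_minus_square: "sqrt_one_minus T (sqrt_one_minus T x) = x - T x"
proof -
  define F where "F = (\<lambda>(i, j). (sqrt_coeff i * sqrt_coeff j) *\<^sub>R (T ^^ (i + j)) x)"
  define S where "S = (\<Sum>k. \<bar>sqrt_coeff k\<bar>)"
  have abs_sum: "((\<lambda>k. \<bar>sqrt_coeff k\<bar>) has_sum S) UNIV"
    using norm_summable_imp_has_sum[OF _ summable_sums[OF summable_sqrt_coeff]] summable_sqrt_coeff
    by (simp add: S_def)
  have "(\<lambda>p. norm (case p of (i, j) \<Rightarrow> \<bar>sqrt_coeff i\<bar> * \<bar>sqrt_coeff j\<bar> * norm x)) summable_on UNIV \<times> UNIV"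
    unfolding Infinite_Sum.abs_summable_on_Sigma_iff
  proof (intro conjI ballI)
    have row: "((\<lambda>j. \<bar>sqrt_coeff i\<bar> * \<bar>sqrt_coeff j\<bar> * norm x) has_sum (\<bar>sqrt_coeff i\<bar> * (S * norm x))) UNIV"
      for i
      using has_sum_cmult_right[OF has_sum_cmult_left[OF abs_sum, of "norm x"], of "\<bar>sqrt_coeff i\<bar>"]
      by (simp add: mult.assoc)
    then show "(\<lambda>j. norm (case (i, j) of (i, j) \<Rightarrow> \<bar>sqrt_coeff i\<bar> * \<bar>sqrt_coeff j\<bar> * norm x)) summable_on UNIV" for i
      by (auto simp: abs_mult summable_on_def)
    have "infsum (\<lambda>j. \<bar>sqrt_coeff i\<bar> * \<bar>sqrt_coeff j\<bar> * norm x) UNIV = \<bar>sqrt_coeff i\<bar> * (S * norm x)" for i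
      by (rule infsumI[OF row])
    moreover have "S \<ge> 0"
      unfolding S_def by (rule suminf_nonneg[OF summable_sqrt_coeff]) simp
    ultimately show "(\<lambda>i. norm (infsum (\<lambda>j. norm (case (i, j) of (i, j) \<Rightarrow>
        \<bar>sqrt_coeff i\<bar> * \<bar>sqrt_coeff j\<bar> * norm x)) UNIV)) summable_on UNIV"
      using has_sum_cmult_left[OF abs_sum, of "S * norm x"]
      by (auto simp: abs_mult summable_on_def)
  qed
  then have "(\<lambda>p. norm (F p)) summable_on UNIV \<times> UNIV"
  proof (rule Infinite_Sum.abs_summable_on_comparison_test)
    fix p :: "nat \<times> nat"
    show "norm (F p) \<le> norm (case p of (i, j) \<Rightarrow> \<bar>sqrt_coeff i\<bar> * \<bar>sqrt_coeff j\<bar> * norm x)"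
      using norm_funpow_le[OF contraction, where x=x and k="fst p + snd p"]
      by (auto simp: F_def abs_mult mult_left_mono split: prod.splits)
  qed
  then have F: "F summable_on UNIV \<times> UNIV"
    by (rule abs_summable_summable)
  have inner_sum: "infsum (\<lambda>j. F (i, j)) UNIV = sqrt_coeff i *\<^sub>R (T ^^ i) (sqrt_one_minus T x)" for i
  proof (rule infsumI)
    have "bounded_linear (\<lambda>y. sqrt_coeff i *\<^sub>R (T ^^ i) y)"
      by (intro bounded_linear_compose[OF bounded_linear_scaleR_right] bounded_linear_funpow T)
    from has_sum_bounded_linear[OF this sqrt_one_minus_has_sum[of x]]
    show "((\<lambda>j. F (i, j)) has_sum sqrt_coeff i *\<^sub>R (T ^^ i) (sqrt_one_minus T x)) UNIV"
      by (simp add: F_def o_def linear_cmul[OF bounded_linear.linear[OF bounded_linear_funpow[OF T]]]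
          funpow_add)
  qed
  have "sqrt_one_minus T (sqrt_one_minus T x) = infsum (\<lambda>i. infsum (\<lambda>j. F (i, j)) UNIV) UNIV"
    unfolding inner_sum by (rule infsumI[OF sqrt_one_minus_has_sum, symmetric])
  also have "\<dots> = infsum F (UNIV \<times> UNIV)"
    by (rule infsum_Sigma_banach[OF F])
  \<comment> \<open>The diagonal index is \<open>n = i + j\<close>; keeping \<open>i\<close> as
    second component makes each diagonal the finite set \<open>{..n}\<close>.\<close>
  also have "\<dots> = infsum (\<lambda>(n, i). F (i, n - i)) (SIGMA n:UNIV. {..n})"
    by (rule infsum_reindex_bij_witness[where i = "\<lambda>(n, i). (i, n - i)" and j = "\<lambda>(i, j). (i + j, i)"])
      auto
  also have "\<dots> = infsum (\<lambda>n. infsum (\<lambda>i. F (i, n - i)) {..n}) UNIV"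
  proof -
    have "(\<lambda>(n, i). F (i, n - i)) summable_on (SIGMA n:UNIV. {..n})"
      using F by (subst summable_on_reindex_bij_witness[where i = "\<lambda>(i, j). (i + j, i)" and
          j = "\<lambda>(n, i). (i, n - i)" and T = "UNIV \<times> UNIV" and h = F]) auto
    from infsum_Sigma_banach[OF this] show ?thesis by simp
  qed
  also have "\<dots> = infsum (\<lambda>n. (\<Sum>i\<le>n. sqrt_coeff i * sqrt_coeff (n - i)) *\<^sub>R (T ^^ n) x) UNIV"
    by (intro infsum_cong) (simp add: F_def scaleR_sum_left)
  also have "\<dots> = infsum (\<lambda>n. (if n = 0 then 1 else -1) *\<^sub>R (T ^^ n) x) {0, 1}"
    unfolding sqrt_coeff_convolution by (rule infsum_cong_neutral) auto
  also have "\<dots> = x - T x"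
    by simp
  finally show ?thesis .
qed

end

text \<open>At a zero of a nonnegative quadratic form the first variation must vanish; the form is
  tested at \<open>x - s *\<^sub>R A x\<close> for small \<open>s\<close>.\<close>

lemma pos_op_inner_zero:
  assumes A: "pos_op A" and eq: "A x \<bullet> x = 0"
  shows "A x = 0"
proof -
  interpret bounded_linear A by (rule pos_opD(1)[OF A])
  define q where "q = A x \<bullet> A x"
  obtain K where K: "K \<ge> 0" "\<And>y. norm (A y) \<le> norm y * K"
    using nonneg_bounded by blast
  have "A (A x) \<bullet> A x \<le> norm (A (A x)) * norm (A x)"
    by (rule norm_cauchy_schwarz)
  also have "\<dots> \<le> (norm (A x) * K) * norm (A x)"
    by (rule mult_right_mono[OF K(2)]) simp
  finally have bound: "A (A x) \<bullet> A x \<le> K * q"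
    by (simp add: q_def dot_square_norm power2_eq_square algebra_simps)
  \<comment> \<open>Chosen so that \<open>s * K < 1\<close>: the second-order term is then at most
    \<open>q\<close>, while positivity forces it to be at least \<open>2 * q\<close>.\<close>
  define s where "s = 1 / (1 + K)"
  have s: "s > 0" "s * K < 1" using K(1) by (auto simp: s_def)
  have "A (A x) \<bullet> x = A x \<bullet> A x"
    by (rule pos_opD(2)[OF A])
  then have "A (x - s *\<^sub>R A x) \<bullet> (x - s *\<^sub>R A x) = s * (s * (A (A x) \<bullet> A x) - 2 * q)"
    using eq by (simp add: diff scaleR inner_diff_left inner_diff_right q_def algebra_simps)
  then have "2 * q \<le> s * (A (A x) \<bullet> A x)"
    using pos_opD(3)[OF A, of "x - s *\<^sub>R A x"] s by (simp add: zero_le_mult_iff)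
  also have "\<dots> \<le> (s * K) * q"
    using mult_left_mono[OF bound, of s] s by (simp add: mult.assoc)
  also have "\<dots> \<le> 1 * q"
    using s by (intro mult_right_mono) (auto simp: q_def)
  finally have "q = 0"
    using inner_ge_zero[of "A x"] unfolding q_def by linarith
  then show ?thesis by (simp add: q_def)
qed

text \<open>For commuting roots \<open>R\<close>, \<open>R'\<close> and \<open>D = R - R'\<close>, the sum of the nonnegative numbers
  \<open>\<langle>R D x, D x\<rangle>\<close> and \<open>\<langle>R' D x, D x\<rangle>\<close> is \<open>\<langle>(R\<^sup>2 - R'\<^sup>2) x, D x\<rangle> = 0\<close>.\<close>

lemma pos_op_root_unique:
  assumes R: "pos_op R" and R': "pos_op R'"
    and eq: "\<And>x. R (R x) = R' (R' x)" and comm: "\<And>x. R (R' x) = R' (R x)"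
  shows "R = R'"
proof
  fix x
  interpret R: bounded_linear R by (rule pos_opD(1)[OF R])
  interpret R': bounded_linear R' by (rule pos_opD(1)[OF R'])
  define d where "d = R x - R' x"
  have "R d + R' d = 0"
    unfolding d_def by (simp add: R.diff R'.diff eq comm)
  then have "R d \<bullet> d + R' d \<bullet> d = 0"
    by (metis inner_add_left inner_zero_left)
  then have "R d \<bullet> d = 0" "R' d \<bullet> d = 0"
    using pos_opD(3)[OF R, of d] pos_opD(3)[OF R', of d] by linarith+
  then have "R d = 0" "R' d = 0"
    by (auto intro: pos_op_inner_zero R R')
  \<comment> \<open>By symmetry \<open>d \<bullet> d\<close> equals
    \<open>x \<bullet> (R d - R' d)\<close>, and both images vanish.\<close>
  then have "d \<bullet> d = 0"
    unfolding d_def by (metis d_def diff_self inner_diff_left inner_zero_right pos_opD(2)[OF R] pos_opD(2)[OF R'])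
  then show "R x = R' x"
    by (simp add: d_def)
qed

text \<open>Needed for uniqueness: any positive root of Q commutes with Q, hence with every power of
  the series, hence with the root built from it.\<close>

lemma sqrt_one_minus_commute:
  assumes T: "bounded_linear T" "\<And>x y. T x \<bullet> y = x \<bullet> T y" "\<And>x. norm (T x) \<le> norm x"
    and A: "bounded_linear A" and comm: "\<And>x. A (T x) = T (A x)"
  shows "A (sqrt_one_minus T x) = sqrt_one_minus T (A x)"
proof -
  have "A ((T ^^ k) y) = (T ^^ k) (A y)" for k y
    by (induction k) (simp_all add: comm)
  then show ?thesis
    using bounded_linear.sums[OF A sqrt_one_minus_sums[OF T, of x]]
      linear_cmul[OF bounded_linear.linear[OF A]]
    by (simp add: sums_iff sqrt_one_minus_def)
qed

text \<open>Evaluates the definite description in \<open>pos_sqrt\<close>. Division by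
  \<open>c^2\<close> brings Q below the identity, so that \<open>1 - Q/c^2\<close> is a positive
  contraction and the series applies; the factor \<open>c\<close> undoes the scaling.\<close>

lemma pos_sqrt_eq:
  assumes Q: "pos_op Q" and c: "c > 0" and le: "\<And>x. Q x \<bullet> x \<le> c\<^sup>2 * (x \<bullet> x)"
  shows "pos_sqrt Q = (\<lambda>x. c *\<^sub>R sqrt_one_minus (\<lambda>x. x - (1 / c\<^sup>2) *\<^sub>R Q x) x)" (is "_ = ?R")
proof -
  interpret Q: bounded_linear Q by (rule pos_opD(1)[OF Q])
  define A where "A = (\<lambda>x. (1 / c\<^sup>2) *\<^sub>R Q x)"
  define T where "T = (\<lambda>x. x - A x)"
  have A: "pos_op A" and A_le: "A x \<bullet> x \<le> x \<bullet> x" for x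
    using pos_opD[OF Q] le[of x] c
    by (auto simp: A_def pos_op_def field_simps intro!: bounded_linear_compose[OF bounded_linear_scaleR_right])
  have T_pos: "pos_op T" and T_le: "\<And>x. T x \<bullet> x \<le> x \<bullet> x"
    unfolding T_def using pos_op_one_minus[OF A A_le] by auto
  note T = pos_opD(1)[OF T_pos] pos_opD(2)[OF T_pos] pos_op_contraction[OF T_pos T_le]
  have root: "pos_op (sqrt_one_minus T)" and square: "sqrt_one_minus T (sqrt_one_minus T x) = A x" for x
    using pos_op_sqrt_one_minus[OF T] sqrt_one_minus_square[OF T] by (auto simp: T_def)
  interpret root: bounded_linear "sqrt_one_minus T" by (rule pos_opD(1)[OF root])
  have R_eq: "?R = (\<lambda>x. c *\<^sub>R sqrt_one_minus T x)" and
    R_apply: "c *\<^sub>R sqrt_one_minus (\<lambda>x. x - (1 / c\<^sup>2) *\<^sub>R Q x) y = c *\<^sub>R sqrt_one_minus T y" for y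
    unfolding T_def A_def by (rule refl)+
  have R: "pos_op ?R"
    using pos_opD[OF root] c unfolding R_eq
    by (auto simp: pos_op_def intro!: bounded_linear_compose[OF bounded_linear_scaleR_right])
  have R_square: "?R (?R x) = Q x" for x
    using square[of x] c unfolding R_apply
    by (simp add: root.scaleR A_def power2_eq_square)
  show ?thesis
    unfolding pos_sqrt_def
  proof (rule the_equality)
    show "bounded_linear ?R \<and> (\<forall>x y. ?R x \<bullet> y = x \<bullet> ?R y) \<and> (\<forall>x. 0 \<le> ?R x \<bullet> x) \<and> ?R \<circ> ?R = Q"
      using R R_square unfolding pos_op_def by (auto simp: fun_eq_iff)
  next
    fix R'
    assume "bounded_linear R' \<and> (\<forall>x y. R' x \<bullet> y = x \<bullet> R' y) \<and> (\<forall>x. 0 \<le> R' x \<bullet> x) \<and> R' \<circ> R' = Q"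
    then have R': "pos_op R'" and R'_square: "R' (R' x) = Q x" for x
      unfolding pos_op_def by (auto simp: fun_eq_iff)
    interpret R': bounded_linear R' by (rule pos_opD(1)[OF R'])
    have "R' (T x) = T (R' x)" for x
      unfolding T_def A_def by (simp add: R'.diff R'.scaleR R'_square[symmetric])
    from sqrt_one_minus_commute[OF T pos_opD(1)[OF R'] this]
    have "R' (?R x) = ?R (R' x)" for x
      unfolding R_apply by (simp add: R'.scaleR)
    then show "R' = ?R"
      by (intro pos_op_root_unique R R') (simp_all only: R_square R'_square)
  qed
qed

section \<open>The polar decomposition of a Hilbert--Schmidt operator\<close>

text \<open>The Hilbert-Schmidt norm dominates the operator norm and is a countable sum over
  columns, hence measurable; adding 1 keeps the divisor positive for the zero operator.\<close>

definition hs_scale :: "'a::{real_inner, banach} l2 \<Rightarrow> real"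
  where "hs_scale x = 1 + norm x"

text \<open>\<open>1 - Q/c\<^sup>2\<close> for \<open>Q = \<Gamma> \<Gamma>'\<close>, where \<open>\<Gamma>\<close> is the operator with columns \<open>x\<close>.\<close>

definition hs_defect :: "'a::{real_inner, banach} l2 \<Rightarrow> 'a \<Rightarrow> 'a"
  where "hs_defect x y = y - (1 / (hs_scale x)\<^sup>2) *\<^sub>R hs_op x (hs_adj x y)"

definition hs_root :: "'a::{real_inner, banach} l2 \<Rightarrow> 'a \<Rightarrow> 'a"
  where "hs_root x = sqrt_one_minus (hs_defect x)"

text \<open>Partial sums \<open>v\<^sub>n\<close> of a Neumann series for \<open>c Q\<^sup>-\<^sup>1 \<Gamma> u\<close>.  They need not converge, but
  \<open>\<Gamma>' v\<^sub>n / c\<close> does, and hence so does \<open>Q\<^sup>1\<^sup>/\<^sup>2 v\<^sub>n / c\<close>, because \<open>\<parallel>Q\<^sup>1\<^sup>/\<^sup>2 v\<parallel> = \<parallel>\<Gamma>' v\<parallel>\<close>.\<close>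

definition polar_approx :: "'a::{real_inner, banach} l2 \<Rightarrow> real l2 \<Rightarrow> nat \<Rightarrow> 'a"
  where "polar_approx x u n = (\<Sum>k<n. (hs_defect x ^^ k) ((1 / hs_scale x) *\<^sub>R hs_op x u))"

text \<open>The partial isometry U in \<open>\<Gamma> = Q^(1/2) U\<close>, written as a limit so
  that measurability in \<open>x\<close> is inherited from the approximations.\<close>

definition polar :: "'a::{real_inner, banach} l2 \<Rightarrow> real l2 \<Rightarrow> 'a"
  where "polar x u = lim (\<lambda>n. hs_root x (polar_approx x u n))"

context
  fixes x :: "'a::{real_inner, banach} l2"
begin

interpretation hs: bounded_linear "hs_op x" by (rule bounded_linear_hs_op)
interpretation adj: bounded_linear "hs_adj x" by (rule bounded_linear_hs_adj)

lemma hs_scale_pos: "hs_scale x > 0"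
  by (simp add: hs_scale_def add_pos_nonneg)

lemma norm_le_hs_scale: "norm x \<le> hs_scale x"
  by (simp add: hs_scale_def)

lemma hs_gram:
  "hs_op x (hs_adj x y) \<bullet> z = hs_adj x y \<bullet> hs_adj x z"
  "hs_adj x (hs_op x u) \<bullet> v = hs_op x u \<bullet> hs_op x v"
  by (simp_all only: hs_op_inner inner_commute[of "hs_adj x (hs_op x u)"])
    (simp only: hs_op_inner[symmetric] inner_commute)

lemma pos_op_hs: "pos_op (\<lambda>y. hs_op x (hs_adj x y))" "pos_op (\<lambda>u. hs_adj x (hs_op x u))"
  unfolding pos_op_def
  by (auto intro: bounded_linear_compose[OF bounded_linear_hs_op bounded_linear_hs_adj]
      bounded_linear_compose[OF bounded_linear_hs_adj bounded_linear_hs_op]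
      simp: hs_gram inner_commute[of _ "hs_op x (hs_adj x _)"] inner_commute[of _ "hs_adj x (hs_op x _)"]
        intro: inner_commute)

lemma norm_square_le_hs_scale: "norm z \<le> norm x * norm y \<Longrightarrow> z \<bullet> z \<le> (hs_scale x)\<^sup>2 * (y \<bullet> y)"
proof -
  assume "norm z \<le> norm x * norm y"
  also have "\<dots> \<le> hs_scale x * norm y"
    by (intro mult_right_mono norm_le_hs_scale) simp
  finally have "(norm z)\<^sup>2 \<le> (hs_scale x * norm y)\<^sup>2"
    by (intro power_mono) simp_all
  then show ?thesis
    by (simp add: power_mult_distrib power2_norm_eq_inner)
qed

lemma hs_le:
  "hs_op x (hs_adj x y) \<bullet> y \<le> (hs_scale x)\<^sup>2 * (y \<bullet> y)"
  "hs_adj x (hs_op x u) \<bullet> u \<le> (hs_scale x)\<^sup>2 * (u \<bullet> u)"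
  using norm_square_le_hs_scale[OF norm_hs_adj_le] norm_square_le_hs_scale[OF norm_hs_op_le]
  by (simp_all add: hs_gram)

text \<open>Kept general in \<open>A\<close> because it serves both Q on the target space and the
  Gram operator \<open>\<Gamma>' \<Gamma>\<close> on l2.\<close>

lemma pos_op_defect:
  assumes "pos_op A" "\<And>y. A y \<bullet> y \<le> (hs_scale x)\<^sup>2 * (y \<bullet> y)"
  shows "pos_op (\<lambda>y. y - (1 / (hs_scale x)\<^sup>2) *\<^sub>R A y)"
    "(y - (1 / (hs_scale x)\<^sup>2) *\<^sub>R A y) \<bullet> y \<le> y \<bullet> y"
proof -
  have "pos_op (\<lambda>y. (1 / (hs_scale x)\<^sup>2) *\<^sub>R A y)"
    "((1 / (hs_scale x)\<^sup>2) *\<^sub>R A y) \<bullet> y \<le> y \<bullet> y" for y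
    using pos_opD[OF assms(1)] assms(2)[of y] hs_scale_pos
    by (auto simp: pos_op_def field_simps intro!: bounded_linear_compose[OF bounded_linear_scaleR_right])
  from pos_op_one_minus[OF this]
  show "pos_op (\<lambda>y. y - (1 / (hs_scale x)\<^sup>2) *\<^sub>R A y)"
    "(y - (1 / (hs_scale x)\<^sup>2) *\<^sub>R A y) \<bullet> y \<le> y \<bullet> y" by auto
qed

lemma pos_op_hs_defect: "pos_op (hs_defect x)" and hs_defect_le: "hs_defect x y \<bullet> y \<le> y \<bullet> y"
  using pos_op_defect[OF pos_op_hs(1) hs_le(1)] unfolding hs_defect_def by auto

lemmas hs_defect = pos_opD(1)[OF pos_op_hs_defect] pos_opD(2)[OF pos_op_hs_defect]
  pos_op_contraction[OF pos_op_hs_defect hs_defect_le]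

lemma pos_op_hs_root: "pos_op (hs_root x)"
  unfolding hs_root_def by (rule pos_op_sqrt_one_minus[OF hs_defect])

lemma hs_root_square: "hs_root x (hs_root x y) = (1 / (hs_scale x)\<^sup>2) *\<^sub>R hs_op x (hs_adj x y)"
  unfolding hs_root_def sqrt_one_minus_square[OF hs_defect] by (simp add: hs_defect_def)

lemma Q_half_hs_op: "Q_half (hs_op x) = (\<lambda>y. hs_scale x *\<^sub>R hs_root x y)"
  unfolding Q_half_def adjoint_hs_op o_def hs_root_def
  using pos_sqrt_eq[OF pos_op_hs(1) hs_scale_pos hs_le(1)]
  by (simp add: hs_defect_def[abs_def])

interpretation root: bounded_linear "hs_root x" by (rule pos_opD(1)[OF pos_op_hs_root])

text \<open>The residual \<open>u - \<Gamma>' v\<^sub>n / c\<close> is \<open>(1 - \<Gamma>' \<Gamma> / c\<^sup>2)\<^sup>n u\<close>, which converges to a vector in the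
  kernel of \<open>\<Gamma>\<close>.\<close>

lemma residual_converges:
  obtains w where "(\<lambda>n. (1 / hs_scale x) *\<^sub>R hs_adj x (polar_approx x u n)) \<longlonglongrightarrow> u - w"
    "hs_op x w = 0" "norm (u - w) \<le> norm u"
proof -
  define T where "T = (\<lambda>v. v - (1 / (hs_scale x)\<^sup>2) *\<^sub>R hs_adj x (hs_op x v))"
  have T_apply: "T v = v - (1 / (hs_scale x)\<^sup>2) *\<^sub>R hs_adj x (hs_op x v)" for v
    by (simp add: T_def)
  have T: "pos_op T" and T_le: "\<And>v. T v \<bullet> v \<le> v \<bullet> v"
    using pos_op_defect[OF pos_op_hs(2) hs_le(2)] unfolding T_def by auto
  obtain w where w: "(\<lambda>n. (T ^^ n) u) \<longlonglongrightarrow> w" "T w = w"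
    by (rule contraction_powers_converge[OF T T_le])
  \<comment> \<open>The intertwining \<open>\<Gamma>' (1 - \<Gamma> \<Gamma>' / c^2) = (1 -
    \<Gamma>' \<Gamma> / c^2) \<Gamma>'\<close> moves the Neumann series to l2, where it
    telescopes.\<close>
  have power: "hs_adj x ((hs_defect x ^^ k) y) = (T ^^ k) (hs_adj x y)" for k y
    by (induction k) (simp_all add: hs_defect_def T_def adj.diff adj.scaleR)
  have "(1 / hs_scale x) *\<^sub>R hs_adj x (polar_approx x u n) = u - (T ^^ n) u" for n
  proof (induction n)
    case (Suc n)
    interpret Tn: bounded_linear "T ^^ n"
      by (rule bounded_linear_funpow[OF pos_opD(1)[OF T]])
    have "(1 / hs_scale x) *\<^sub>R hs_adj x (polar_approx x u (Suc n)) =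
        u - (T ^^ n) u + (T ^^ n) ((1 / (hs_scale x)\<^sup>2) *\<^sub>R hs_adj x (hs_op x u))"
      using Suc by (simp add: polar_approx_def adj.add scaleR_add_right power adj.scaleR Tn.scaleR
          power2_eq_square)
    also have "\<dots> = u - (T ^^ n) (T u)"
      by (simp add: T_apply Tn.diff)
    finally show ?case
      by (simp add: funpow_swap1)
  qed (simp add: polar_approx_def)
  then have lim: "(\<lambda>n. (1 / hs_scale x) *\<^sub>R hs_adj x (polar_approx x u n)) \<longlonglongrightarrow> u - w"
    by (simp add: tendsto_diff[OF tendsto_const w(1)])
  have "hs_adj x (hs_op x w) = 0"
    using w(2) hs_scale_pos by (simp add: T_def)
  then have kernel: "hs_op x w = 0"
    by (metis hs_op_inner inner_eq_zero_iff inner_zero_right)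
  \<comment> \<open>The limit \<open>w\<close> is the orthogonal projection of \<open>u\<close> onto
    the fixed space of \<open>T\<close>: symmetry gives
    \<open>w \<bullet> w = u \<bullet> w\<close>, so removing \<open>w\<close> does not increase the
    norm.\<close>
  have "(T ^^ n) w = w" for n
    by (induction n) (simp_all add: w(2))
  then have "(T ^^ n) u \<bullet> w = u \<bullet> w" for n
    by (simp add: inner_funpow[of T, OF pos_opD(2)[OF T]])
  then have "w \<bullet> w = u \<bullet> w"
    using LIMSEQ_unique[OF tendsto_inner[OF w(1) tendsto_const, of w]] by simp
  moreover from this have "0 \<le> u \<bullet> w"
    by (metis inner_ge_zero)
  ultimately have "norm (u - w) \<le> norm u"
    by (simp add: norm_le inner_diff_left inner_diff_right inner_commute)
  with lim kernel show ?thesis by (rule that)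
qed

text \<open>Both sides are the quadratic form of \<open>Q / c^2\<close>. This isometry carries
  convergence and inner products from l2 over to the vectors
  \<open>hs_root x (polar_approx x u n)\<close>.\<close>

lemma hs_root_inner: "hs_root x y \<bullet> hs_root x z = ((1 / hs_scale x) *\<^sub>R hs_adj x y) \<bullet> ((1 / hs_scale x) *\<^sub>R hs_adj x z)"
proof -
  have "hs_root x y \<bullet> hs_root x z = y \<bullet> hs_root x (hs_root x z)"
    by (rule pos_opD(2)[OF pos_op_hs_root])
  then show ?thesis
    by (simp add: hs_root_square power2_eq_square hs_gram inner_commute[of y] inner_commute[of "hs_adj x y"])
qed

lemma polar_tendsto: "(\<lambda>n. hs_root x (polar_approx x u n)) \<longlonglongrightarrow> polar x u"
proof -
  obtain w where w: "(\<lambda>n. (1 / hs_scale x) *\<^sub>R hs_adj x (polar_approx x u n)) \<longlonglongrightarrow> u - w"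
    by (rule residual_converges)
  have "norm (hs_root x y - hs_root x z) =
      norm ((1 / hs_scale x) *\<^sub>R hs_adj x y - (1 / hs_scale x) *\<^sub>R hs_adj x z)" for y z
    using hs_root_inner[of "y - z" "y - z"]
    by (simp add: norm_eq_sqrt_inner root.diff adj.diff scaleR_diff_right)
  then have "Cauchy (\<lambda>n. hs_root x (polar_approx x u n))"
    using LIMSEQ_imp_Cauchy[OF w] by (simp add: Cauchy_iff)
  then show ?thesis
    unfolding polar_def by (simp add: Cauchy_convergent_iff convergent_LIMSEQ_iff)
qed

text \<open>This is \<open>Q^(1/2) U = \<Gamma>\<close>: two roots applied to the approximations
  give \<open>\<Gamma>\<close> of a sequence tending to \<open>u - w\<close>, and \<open>w\<close>
  is in the kernel.\<close>

lemma hs_root_polar: "hs_scale x *\<^sub>R hs_root x (polar x u) = hs_op x u"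
proof -
  obtain w where w: "(\<lambda>n. (1 / hs_scale x) *\<^sub>R hs_adj x (polar_approx x u n)) \<longlonglongrightarrow> u - w"
    "hs_op x w = 0"
    by (rule residual_converges)
  have "hs_scale x *\<^sub>R hs_root x (hs_root x y) = hs_op x ((1 / hs_scale x) *\<^sub>R hs_adj x y)" for y
    by (simp add: hs_root_square power2_eq_square hs.scaleR)
  then have "(\<lambda>n. hs_op x ((1 / hs_scale x) *\<^sub>R hs_adj x (polar_approx x u n)))
      \<longlonglongrightarrow> hs_scale x *\<^sub>R hs_root x (polar x u)"
    using tendsto_scaleR[OF tendsto_const root.tendsto[OF polar_tendsto], of "hs_scale x" u] by simp
  moreover have "(\<lambda>n. hs_op x ((1 / hs_scale x) *\<^sub>R hs_adj x (polar_approx x u n))) \<longlonglongrightarrow> hs_op x u"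
    using hs.tendsto[OF w(1)] w(2) by (simp add: hs.diff)
  ultimately show ?thesis by (rule LIMSEQ_unique)
qed

text \<open>Every approximation lies in the range of the symmetric root, which is orthogonal to its
  kernel. This makes the functional below independent of the chosen preimage.\<close>

lemma polar_inner_kernel: "hs_root x y = 0 \<Longrightarrow> polar x u \<bullet> y = 0"
  using LIMSEQ_unique[OF tendsto_inner[OF polar_tendsto tendsto_const, of u y], of 0]
  by (simp add: pos_opD(2)[OF pos_op_hs_root])

text \<open>U is in general only a partial isometry. The inequality holds for every operator, so the
  integrability bound on the integrand is valid at every \<open>\<omega>\<close> and
  \<open>t\<close>.\<close>

lemma norm_polar_le: "norm (polar x u) \<le> norm u"
proof -
  obtain w where w: "(\<lambda>n. (1 / hs_scale x) *\<^sub>R hs_adj x (polar_approx x u n)) \<longlonglongrightarrow> u - w"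
    "norm (u - w) \<le> norm u"
    by (rule residual_converges)
  have "norm (hs_root x y) = norm ((1 / hs_scale x) *\<^sub>R hs_adj x y)" for y
    using hs_root_inner[of y y] by (simp add: norm_eq_sqrt_inner)
  then have "norm (polar x u) = norm (u - w)"
    using LIMSEQ_unique[OF tendsto_norm[OF polar_tendsto[of u]], of "norm (u - w)"] tendsto_norm[OF w(1)]
    by simp
  with w(2) show ?thesis by simp
qed

text \<open>Injectivity enters here: it forces the kernel component \<open>w\<close> of the residual
  to vanish.\<close>

lemma polar_isometric:
  assumes "inj (hs_op x)"
  shows "polar x u \<bullet> polar x v = u \<bullet> v"
proof -
  have lim: "(\<lambda>n. (1 / hs_scale x) *\<^sub>R hs_adj x (polar_approx x u n)) \<longlonglongrightarrow> u" for u
  proof -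
    obtain w where "(\<lambda>n. (1 / hs_scale x) *\<^sub>R hs_adj x (polar_approx x u n)) \<longlonglongrightarrow> u - w"
      "hs_op x w = 0"
      by (rule residual_converges)
    moreover from this have "w = 0"
      using assms by (metis hs.zero injD)
    ultimately show ?thesis by simp
  qed
  show ?thesis
    using LIMSEQ_unique[OF tendsto_inner[OF polar_tendsto polar_tendsto, of u v]]
      tendsto_inner[OF lim lim, of u v]
    by (simp only: hs_root_inner)
qed


text \<open>\<open>SOME\<close> picks a preimage under Q^(1/2), which may have a kernel. Off the
  range the value is unspecified, which the domain \<open>D\<close> permits.\<close>

definition polar_functional :: "real l2 \<Rightarrow> 'a \<Rightarrow> real"
  where "polar_functional u y = polar x u \<bullet> (SOME z. Q_half (hs_op x) z = y)"

lemma polar_functional_Q_half: "polar_functional u (Q_half (hs_op x) z) = polar x u \<bullet> z"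
proof -
  define z' where "z' = (SOME z'. Q_half (hs_op x) z' = Q_half (hs_op x) z)"
  have "Q_half (hs_op x) z' = Q_half (hs_op x) z"
    unfolding z'_def by (rule someI) simp
  then have "hs_root x (z' - z) = 0"
    using hs_scale_pos by (simp add: Q_half_hs_op root.diff)
  then have "polar x u \<bullet> (z' - z) = 0"
    by (rule polar_inner_kernel)
  then show ?thesis
    by (simp add: polar_functional_def z'_def inner_diff_right)
qed

lemma linear_functional_on_polar:
  "linear_functional_on (range (Q_half (hs_op x))) (polar_functional u)"
proof -
  interpret Q: bounded_linear "Q_half (hs_op x)"
    unfolding Q_half_hs_op
    by (intro bounded_linear_compose[OF bounded_linear_scaleR_right] pos_opD(1)[OF pos_op_hs_root])
  show ?thesis
    unfolding linear_functional_on_def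
  proof (intro conjI ballI allI)
    show "subspace (range (Q_half (hs_op x)))"
      by (rule linear_subspace_image[OF Q.linear_axioms subspace_UNIV])
  next
    fix y z
    assume "y \<in> range (Q_half (hs_op x))" "z \<in> range (Q_half (hs_op x))"
    then show "polar_functional u (y + z) = polar_functional u y + polar_functional u z"
      by (auto simp: Q.add[symmetric] polar_functional_Q_half inner_add_right)
  next
    fix c y
    assume "y \<in> range (Q_half (hs_op x))"
    then show "polar_functional u (c *\<^sub>R y) = c * polar_functional u y"
      by (auto simp: Q.scaleR[symmetric] polar_functional_Q_half)
  qed
qed

lemma polar_functional_hs_op:
  assumes "inj (hs_op x)"
  shows "polar_functional u (hs_op x v) = u \<bullet> v"
  using polar_functional_Q_half[of u "polar x v"] polar_isometric[OF assms]
  by (simp add: Q_half_hs_op hs_root_polar)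

end

lemma l2_riesz_inner: "l2_riesz (\<lambda>v. u \<bullet> v) = u"
  unfolding l2_riesz_def
proof (rule the_equality)
  fix w
  assume "\<forall>v. u \<bullet> v = w \<bullet> v"
  then have "(w - u) \<bullet> (w - u) = 0"
    by (simp add: inner_diff_left)
  then show "w = u" by simp
qed simp

section \<open>Measurable dependence of the polar decomposition on the columns\<close>

lemma borel_measurable_suminf_banach:
  fixes f :: "nat \<Rightarrow> 'n \<Rightarrow> 'a::{banach, second_countable_topology}"
  assumes [measurable]: "\<And>i. f i \<in> borel_measurable N"
  shows "(\<lambda>p. \<Sum>i. f i p) \<in> borel_measurable N"
  unfolding suminf_eq_lim by measurable

context
  fixes N :: "'n measure" and X :: "'n \<Rightarrow> 'a::{real_inner, banach, second_countable_topology} l2"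
  assumes X [measurable]: "\<And>i. (\<lambda>p. coord (X p) i) \<in> borel_measurable N"
begin

lemma measurable_hs_op:
  assumes [measurable]: "\<And>i. (\<lambda>p. coord (U p) i) \<in> borel_measurable N"
  shows "(\<lambda>p. hs_op (X p) (U p)) \<in> borel_measurable N"
  unfolding hs_op_def by (intro borel_measurable_suminf_banach) measurable

lemma measurable_hs_scale: "(\<lambda>p. hs_scale (X p)) \<in> borel_measurable N"
proof -
  have "norm (X p) = sqrt (\<Sum>i. (norm (coord (X p) i))\<^sup>2)" for p
    by (simp add: norm_l2_square[symmetric])
  then show ?thesis
    unfolding hs_scale_def by (simp add: borel_measurable_suminf_banach)
qed

lemma measurable_hs_defect:
  assumes [measurable]: "Y \<in> borel_measurable N"
  shows "(\<lambda>p. hs_defect (X p) (Y p)) \<in> borel_measurable N"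
proof -
  note measurable_hs_scale [measurable]
  have [measurable]: "(\<lambda>p. hs_op (X p) (hs_adj (X p) (Y p))) \<in> borel_measurable N"
    by (rule measurable_hs_op) simp
  show ?thesis
    unfolding hs_defect_def by measurable
qed

lemma measurable_hs_defect_funpow:
  assumes "Y \<in> borel_measurable N"
  shows "(\<lambda>p. (hs_defect (X p) ^^ k) (Y p)) \<in> borel_measurable N"
  by (induction k) (simp_all add: assms measurable_hs_defect)

lemma measurable_hs_root:
  assumes "Y \<in> borel_measurable N"
  shows "(\<lambda>p. hs_root (X p) (Y p)) \<in> borel_measurable N"
  unfolding hs_root_def sqrt_one_minus_def
  by (intro borel_measurable_suminf_banach borel_measurable_scaleR measurable_hs_defect_funpow assms) simp

lemma measurable_polar:
  assumes "\<And>i. (\<lambda>p. coord (U p) i) \<in> borel_measurable N"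
  shows "(\<lambda>p. polar (X p) (U p)) \<in> borel_measurable N"
  unfolding polar_def polar_approx_def
  by (intro borel_measurable_lim_metric measurable_hs_root borel_measurable_sum
      measurable_hs_defect_funpow borel_measurable_scaleR borel_measurable_divide
      measurable_hs_op measurable_hs_scale assms) simp

end

section \<open>Calculus of absolutely continuous functions\<close>

text \<open>Integration starts at minus infinity; the integrands to which it is applied are cut off
  to \<open>{0..S}\<close>, so it agrees there with the integral from 0.\<close>

definition primitive :: "(real \<Rightarrow> real) \<Rightarrow> real \<Rightarrow> real"
  where "primitive p T = (\<integral>u. indicator {..T} u * p u \<partial>lborel)"

lemma integrable_cutoff:
  fixes p :: "real \<Rightarrow> real"
  shows "integrable lborel p \<Longrightarrow> integrable lborel (\<lambda>u. indicator {..T} u * p u)"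
  using integrable_real_mult_indicator[of "{..T}" lborel p] by (simp add: mult.commute)

lemma borel_measurable_primitive [measurable]:
  assumes [measurable]: "p \<in> borel_measurable borel"
  shows "primitive p \<in> borel_measurable borel"
proof -
  have [measurable]: "(\<lambda>(T, u). indicator {..T} u * p u) \<in> borel_measurable (borel \<Otimes>\<^sub>M lborel)"
  proof -
    have "(\<lambda>(T, u). indicator {..T} u * p u) = (\<lambda>z. if snd z \<le> fst z then p (snd z) else 0)"
      by (auto simp: indicator_def)
    then show ?thesis by simp
  qed
  show ?thesis
    unfolding primitive_def[abs_def] by measurable
qed

lemma primitive_add:
  assumes "integrable lborel p" "integrable lborel q"
  shows "primitive (\<lambda>u. p u + q u) T = primitive p T + primitive q T"
  using assms by (simp add: primitive_def distrib_left integrable_cutoff)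

lemma primitive_cmult: "primitive (\<lambda>u. c * p u) T = c * primitive p T"
  by (simp add: primitive_def mult.left_commute[of _ c])

lemma primitive_minus: "primitive (\<lambda>u. - p u) T = - primitive p T"
  using primitive_cmult[of "-1" p T] by simp

lemma primitive_cong_AE:
  assumes "AE u in lborel. p u = q u" "p \<in> borel_measurable borel" "q \<in> borel_measurable borel"
  shows "primitive p T = primitive q T"
  unfolding primitive_def using assms by (intro integral_cong_AE) auto

lemma abs_primitive_le:
  assumes "integrable lborel p"
  shows "\<bar>primitive p T\<bar> \<le> (\<integral>u. \<bar>p u\<bar> \<partial>lborel)"
proof -
  have "\<bar>primitive p T\<bar> \<le> (\<integral>u. \<bar>indicator {..T} u * p u\<bar> \<partial>lborel)"
    unfolding primitive_def by (rule integral_abs_bound)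
  also have "\<dots> \<le> (\<integral>u. \<bar>p u\<bar> \<partial>lborel)"
    using assms by (intro integral_mono integrable_abs integrable_cutoff) (auto simp: indicator_def)
  finally show ?thesis .
qed

lemma integrable_mult_bounded:
  fixes f b :: "real \<Rightarrow> real"
  assumes f: "integrable lborel f" and b: "b \<in> borel_measurable borel" "\<And>u. \<bar>b u\<bar> \<le> B"
  shows "integrable lborel (\<lambda>u. f u * b u)"
proof (rule Bochner_Integration.integrable_bound)
  show "integrable lborel (\<lambda>u. B * f u)" using f by simp
  have "\<bar>f u\<bar> * \<bar>b u\<bar> \<le> B * \<bar>f u\<bar>" for u
    using mult_right_mono[OF b(2)[of u], of "\<bar>f u\<bar>"] by (simp add: mult.commute)
  moreover have "0 \<le> B" using b(2)[of 0] by linarith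
  ultimately show "AE u in lborel. norm (f u * b u) \<le> norm (B * f u)"
    by (simp add: abs_mult)
qed (use f b in simp)

lemma integrable_mult_primitive:
  assumes "integrable lborel p" "integrable lborel q"
  shows "integrable lborel (\<lambda>u. p u * primitive q u)"
  using assms by (intro integrable_mult_bounded[OF _ _ abs_primitive_le]) auto

text \<open>Integration by parts for functions that are merely integrable: the product is an
  integral over the plane, split along the diagonal.\<close>

lemma integral_mult_Fubini:
  assumes p: "integrable lborel p" and q: "integrable lborel q"
  shows "(\<integral>u. p u \<partial>lborel) * (\<integral>u. q u \<partial>lborel) =
    (\<integral>u. p u * primitive q u + primitive p u * q u \<partial>lborel)"
proof -
  have [measurable]: "p \<in> borel_measurable borel" "q \<in> borel_measurable borel"
    using p q by auto
  have prod: "integrable (lborel \<Otimes>\<^sub>M lborel) (\<lambda>(u, v). p u * q v)"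
    using p q by (intro lborel_pair.Fubini_integrable) (auto simp: abs_mult)
  define upper where "upper = (\<lambda>(u, v). (if u < v then 1 else 0) * (p u * q v) :: real)"
  have upper: "integrable (lborel \<Otimes>\<^sub>M lborel) upper"
    by (rule Bochner_Integration.integrable_bound[OF prod]) (auto simp: upper_def)
  have inner: "(\<integral>v. p u * q v \<partial>lborel) = p u * primitive q u + (\<integral>v. upper (u, v) \<partial>lborel)" for u
  proof -
    have "(\<integral>v. p u * q v \<partial>lborel) =
        (\<integral>v. p u * (indicator {..u} v * q v) + p u * (indicator {u<..} v * q v) \<partial>lborel)"
      by (intro Bochner_Integration.integral_cong) (auto simp: indicator_def)
    also have "\<dots> = p u * primitive q u + (\<integral>v. p u * (indicator {u<..} v * q v) \<partial>lborel)"
      using q integrable_mult_indicator[of "{u<..}" lborel q]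
      by (subst Bochner_Integration.integral_add) (auto simp: primitive_def integrable_cutoff)
    also have "(\<lambda>v. p u * (indicator {u<..} v * q v)) = (\<lambda>v. upper (u, v))"
      by (auto simp: upper_def indicator_def)
    finally show ?thesis .
  qed
  have inner': "(\<integral>u. upper (u, v) \<partial>lborel) = primitive p v * q v" for v
  proof -
    \<comment> \<open>The strict half-plane \<open>u < v\<close> and the closed ray
      \<open>{..v}\<close> differ only in the null set \<open>u = v\<close>.\<close>
    have "AE u in lborel. upper (u, v) = indicator {..v} u * p u * q v"
      using AE_lborel_singleton[of v] by eventually_elim (auto simp: upper_def indicator_def)
    moreover have "(\<lambda>u. upper (u, v)) \<in> borel_measurable lborel"
      unfolding upper_def by simp
    ultimately have "(\<integral>u. upper (u, v) \<partial>lborel) = (\<integral>u. indicator {..v} u * p u * q v \<partial>lborel)"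
      by (intro integral_cong_AE) auto
    then show ?thesis by (simp add: primitive_def)
  qed
  have "(\<integral>u. p u \<partial>lborel) * (\<integral>u. q u \<partial>lborel) = (\<integral>u. (\<integral>v. p u * q v \<partial>lborel) \<partial>lborel)"
    by simp
  also have "\<dots> = (\<integral>u. p u * primitive q u \<partial>lborel) + (\<integral>u. (\<integral>v. upper (u, v) \<partial>lborel) \<partial>lborel)"
    unfolding inner
    using integrable_mult_primitive[OF p q] lborel_pair.integrable_fst'[OF upper]
    by (subst Bochner_Integration.integral_add) auto
  also have "(\<integral>u. (\<integral>v. upper (u, v) \<partial>lborel) \<partial>lborel) = (\<integral>v. primitive p v * q v \<partial>lborel)"
    using lborel_pair.Fubini_integral[of "\<lambda>u v. upper (u, v)"] upper inner' by simp
  finally show ?thesis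
    using integrable_mult_primitive[OF p q] integrable_mult_primitive[OF q p]
    by (simp add: mult.commute)
qed

text \<open>The whole-line identity for \<open>p\<close> and \<open>q\<close> cut off at
  \<open>T\<close>; on \<open>{..T}\<close> the cutoff does not change the primitives.\<close>

lemma primitive_mult:
  assumes p: "integrable lborel p" and q: "integrable lborel q"
  shows "primitive p T * primitive q T = primitive (\<lambda>u. p u * primitive q u + primitive p u * q u) T"
proof -
  have restrict: "indicator {..T} u * primitive (\<lambda>v. indicator {..T} v * r v) u = indicator {..T} u * primitive r u"
    for u r
    unfolding primitive_def
    by (cases "u \<le> T") (auto intro!: Bochner_Integration.integral_cong simp: indicator_def)
  have "primitive p T * primitive q T =
      (\<integral>u. indicator {..T} u * p u * primitive (\<lambda>v. indicator {..T} v * q v) u +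
        primitive (\<lambda>v. indicator {..T} v * p v) u * (indicator {..T} u * q u) \<partial>lborel)"
    using integral_mult_Fubini[OF integrable_cutoff[OF p] integrable_cutoff[OF q], of T T]
    by (simp add: primitive_def)
  also have "\<dots> = (\<integral>u. indicator {..T} u * (p u * primitive q u + primitive p u * q u) \<partial>lborel)"
  proof (intro Bochner_Integration.integral_cong refl)
    fix u
    show "indicator {..T} u * p u * primitive (\<lambda>v. indicator {..T} v * q v) u +
        primitive (\<lambda>v. indicator {..T} v * p v) u * (indicator {..T} u * q u) =
        indicator {..T} u * (p u * primitive q u + primitive p u * q u)"
      by (cases "u \<le> T") (use restrict[of u p] restrict[of u q] in auto)
  qed
  finally show ?thesis
    by (simp add: primitive_def)
qed

text \<open>Induction by the product rule, which yields \<open>n + 2\<close> equal copies of one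
  integrand. The factorials match the terms of the exponential series.\<close>

lemma primitive_power:
  assumes p: "integrable lborel p"
  shows "integrable lborel (\<lambda>u. p u * primitive p u ^ n / fact n)"
    and "primitive p T ^ Suc n / fact (Suc n) = primitive (\<lambda>u. p u * primitive p u ^ n / fact n) T"
proof -
  have int: "integrable lborel (\<lambda>u. p u * primitive p u ^ n / fact n)" for n
  proof -
    have "\<bar>primitive p u ^ n\<bar> \<le> (\<integral>u. \<bar>p u\<bar> \<partial>lborel) ^ n" for u
      unfolding power_abs by (rule power_mono[OF abs_primitive_le[OF p]]) simp
    from integrable_mult_bounded[OF p _ this] have "integrable lborel (\<lambda>u. p u * primitive p u ^ n)"
      using p by simp
    then show ?thesis by simp
  qed
  then show "integrable lborel (\<lambda>u. p u * primitive p u ^ n / fact n)" .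
  show "primitive p T ^ Suc n / fact (Suc n) = primitive (\<lambda>u. p u * primitive p u ^ n / fact n) T"
  proof (induction n arbitrary: T)
    case 0
    then show ?case by simp
  next
    case (Suc n)
    have "primitive p T ^ Suc (Suc n) / fact (Suc n) = primitive p T * (primitive p T ^ Suc n / fact (Suc n))"
      by simp
    also have "\<dots> = primitive (\<lambda>u. p u * (primitive p u ^ Suc n / fact (Suc n)) +
        primitive p u * (p u * primitive p u ^ n / fact n)) T"
      unfolding Suc by (rule primitive_mult[OF p int])
    also have "(\<lambda>u. p u * (primitive p u ^ Suc n / fact (Suc n)) +
        primitive p u * (p u * primitive p u ^ n / fact n)) =
        (\<lambda>u. real (n + 2) * (p u * primitive p u ^ Suc n / fact (Suc n)))"
    proof
      fix u
      have "a / fact n = real (Suc n) * (a / fact (Suc n))" for a :: real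
        unfolding fact_Suc by simp
      from this[of "primitive p u * (p u * primitive p u ^ n)"]
      show "p u * (primitive p u ^ Suc n / fact (Suc n)) + primitive p u * (p u * primitive p u ^ n / fact n) =
          real (n + 2) * (p u * primitive p u ^ Suc n / fact (Suc n))"
        by (simp add: algebra_simps add_divide_distrib del: fact_Suc)
    qed
    finally have "primitive p T ^ Suc (Suc n) / fact (Suc n) =
        real (n + 2) * primitive (\<lambda>u. p u * primitive p u ^ Suc n / fact (Suc n)) T"
      unfolding primitive_cmult .
    moreover have "(fact (Suc (Suc n)) :: real) = real (n + 2) * fact (Suc n)"
      by (simp add: fact_Suc)
    ultimately show ?case
      by (simp add: divide_divide_eq_left' mult.commute divide_eq_eq del: fact_Suc power_Suc)
  qed
qed

text \<open>The chain rule for an exponent that is only absolutely continuous: the exponential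
  series is integrated term by term, dominated by
  \<open>\<bar>p u\<bar> * (B ^ n / fact n)\<close>.\<close>

lemma primitive_exp:
  assumes p: "integrable lborel p"
  shows "integrable lborel (\<lambda>u. p u * exp (primitive p u))"
    and "exp (primitive p T) = 1 + primitive (\<lambda>u. p u * exp (primitive p u)) T"
proof -
  define B where "B = (\<integral>u. \<bar>p u\<bar> \<partial>lborel)"
  have B: "\<bar>primitive p u\<bar> \<le> B" for u
    unfolding B_def by (rule abs_primitive_le[OF p])
  have "\<bar>exp (primitive p u)\<bar> \<le> exp B" for u
    using B[of u] by simp
  then show "integrable lborel (\<lambda>u. p u * exp (primitive p u))"
    by (rule integrable_mult_bounded[OF p, rotated]) (use p in simp)
  define g where "g n u = indicator {..T} u * (p u * primitive p u ^ n / fact n)" for n u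
  have int: "integrable lborel (g n)" for n
    unfolding g_def by (rule integrable_cutoff[OF primitive_power(1)[OF p]])
  have norm_g: "norm (g n u) \<le> \<bar>p u\<bar> * (B ^ n / fact n)" for n u
  proof -
    have "norm (g n u) \<le> \<bar>p u\<bar> * (\<bar>primitive p u\<bar> ^ n / fact n)"
      by (auto simp: g_def indicator_def abs_mult power_abs)
    also have "\<dots> \<le> \<bar>p u\<bar> * (B ^ n / fact n)"
      by (intro mult_left_mono divide_right_mono power_mono B) auto
    finally show ?thesis .
  qed
  have summable_B: "summable (\<lambda>n. B ^ n / fact n)"
    using summable_exp[of B] by (simp add: field_simps)
  have "(\<lambda>n. \<integral>u. g n u \<partial>lborel) sums (\<integral>u. (\<Sum>n. g n u) \<partial>lborel)"
  proof (rule sums_integral[OF int])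
    show "AE u in lborel. summable (\<lambda>n. norm (g n u))"
    proof (rule AE_I2)
      fix u
      show "summable (\<lambda>n. norm (g n u))"
        by (rule summable_comparison_test'[OF summable_mult[OF summable_B, of "\<bar>p u\<bar>"]])
          (use norm_g in simp)
    qed
    have "(\<integral>u. norm (g n u) \<partial>lborel) \<le> B * (B ^ n / fact n)" for n
    proof -
      have "(\<integral>u. norm (g n u) \<partial>lborel) \<le> (\<integral>u. \<bar>p u\<bar> * (B ^ n / fact n) \<partial>lborel)"
        using p by (intro integral_mono norm_g integrable_norm int) auto
      then show ?thesis by (simp add: B_def)
    qed
    then show "summable (\<lambda>n. \<integral>u. norm (g n u) \<partial>lborel)"
      by (intro summable_comparison_test'[OF summable_mult[OF summable_B, of B]]) auto
  qed
  also have "(\<lambda>n. \<integral>u. g n u \<partial>lborel) = (\<lambda>n. primitive p T ^ Suc n / fact (Suc n))"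
    unfolding primitive_power(2)[OF p] by (simp add: primitive_def g_def)
  also have "(\<lambda>u. \<Sum>n. g n u) = (\<lambda>u. indicator {..T} u * (p u * exp (primitive p u)))"
  proof
    fix u
    have "(\<lambda>n. primitive p u ^ n / fact n) sums exp (primitive p u)"
      using exp_converges[of "primitive p u"] by (simp add: field_simps)
    from sums_mult[OF this, of "indicator {..T} u * p u"]
    show "(\<Sum>n. g n u) = indicator {..T} u * (p u * exp (primitive p u))"
      by (simp add: g_def sums_iff mult.assoc)
  qed
  finally have "(\<lambda>n. primitive p T ^ Suc n / fact (Suc n)) sums primitive (\<lambda>u. p u * exp (primitive p u)) T"
    by (simp add: primitive_def)
  moreover have "(\<lambda>n. primitive p T ^ Suc n / fact (Suc n)) sums (exp (primitive p T) - 1)"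
    using sums_Suc_iff[of "\<lambda>n. primitive p T ^ n / fact n" "exp (primitive p T) - 1"]
      exp_converges[of "primitive p T"]
    by (simp add: field_simps)
  ultimately show "exp (primitive p T) = 1 + primitive (\<lambda>u. p u * exp (primitive p u)) T"
    by (auto dest: sums_unique2)
qed

text \<open>Product rule for a bond volatility curve. The exponential is 1 plus a primitive; the
  constant 1 accounts for the separate summand \<open>- q u\<close>.\<close>

lemma primitive_exp_mult:
  assumes p: "integrable lborel p" and q: "integrable lborel q"
  shows "exp (- primitive p T) * (- primitive q T) =
    primitive (\<lambda>u. exp (- primitive p u) * (p u * primitive q u - q u)) T"
proof -
  define r where "r = (\<lambda>u. - p u * exp (- primitive p u))"
  have p': "integrable lborel (\<lambda>u. - p u)" and q': "integrable lborel (\<lambda>u. - q u)"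
    using p q by auto
  have r: "integrable lborel r" and exp: "exp (- primitive p u) = 1 + primitive r u" for u
    using primitive_exp(1)[OF p'] primitive_exp(2)[OF p', of u] unfolding r_def primitive_minus .
  have "exp (- primitive p T) * (- primitive q T) =
      primitive r T * primitive (\<lambda>u. - q u) T + primitive (\<lambda>u. - q u) T"
    unfolding exp primitive_minus by (simp add: algebra_simps)
  also have "\<dots> = primitive (\<lambda>u. (r u * primitive (\<lambda>u. - q u) u + primitive r u * (- q u)) + (- q u)) T"
    unfolding primitive_mult[OF r q']
    using integrable_mult_primitive[OF r q'] integrable_mult_primitive[OF q' r] q'
    by (intro primitive_add[symmetric] Bochner_Integration.integrable_add) (simp_all add: mult.commute)
  also have "(\<lambda>u. (r u * primitive (\<lambda>u. - q u) u + primitive r u * (- q u)) + (- q u)) =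
      (\<lambda>u. exp (- primitive p u) * (p u * primitive q u - q u))"
  proof
    fix u
    have eq: "primitive r u = exp (- primitive p u) - 1"
      unfolding exp by simp
    then show "(r u * primitive (\<lambda>u. - q u) u + primitive r u * (- q u)) + (- q u) =
        exp (- primitive p u) * (p u * primitive q u - q u)"
      unfolding eq unfolding r_def primitive_minus by (simp add: algebra_simps)
  qed
  finally show ?thesis .
qed

section \<open>From forward curves to price curves\<close>

definition cutoff :: "real \<Rightarrow> (real \<Rightarrow> real) \<Rightarrow> real \<Rightarrow> real"
  where "cutoff S d u = indicator {0..S} u * d u"

lemma square_integrable_cutoff:
  "square_integrable S d \<longleftrightarrow>
    cutoff S d \<in> borel_measurable borel \<and> integrable lborel (\<lambda>u. (cutoff S d u)\<^sup>2)"
proof -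
  have "indicator {0..S} u * (d u)\<^sup>2 = (cutoff S d u)\<^sup>2" for u
    by (simp add: cutoff_def indicator_def)
  then show ?thesis
    by (simp add: square_integrable_def set_borel_measurable_def set_integrable_def cutoff_def[abs_def])
qed

lemma set_integral_square_cutoff: "(LBINT u:{0..S}. (d u)\<^sup>2) = (\<integral>u. (cutoff S d u)\<^sup>2 \<partial>lborel)"
  unfolding set_lebesgue_integral_def
  by (rule Bochner_Integration.integral_cong) (auto simp: cutoff_def indicator_def)

lemma set_integral_primitive:
  "T \<in> {0..S} \<Longrightarrow> (LBINT u:{0..T}. d u) = primitive (cutoff S d) T"
  unfolding set_lebesgue_integral_def primitive_def
  by (rule Bochner_Integration.integral_cong) (auto simp: cutoff_def indicator_def)

lemma abs_le_half_square: "c > 0 \<Longrightarrow> \<bar>z\<bar> \<le> (c + z\<^sup>2 / c) / 2" for c z :: real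
  using sum_squares_bound[of c "\<bar>z\<bar>"] by (simp add: field_simps power2_eq_square)

text \<open>Cauchy-Schwarz on a bounded interval in the form
  \<open>2 * \<bar>z\<bar> \<le> c + z^2 / c\<close>, with \<open>c\<close> left free to be
  optimized. \<open>max 0 S\<close> is the length of the interval for either sign of
  \<open>S\<close>.\<close>

lemma square_integrable_L1:
  assumes "square_integrable S d"
  shows "integrable lborel (cutoff S d)"
    and "c > 0 \<Longrightarrow> (\<integral>u. \<bar>cutoff S d u\<bar> \<partial>lborel) \<le> (c * max 0 S + (\<integral>u. (cutoff S d u)\<^sup>2 \<partial>lborel) / c) / 2"
proof -
  have meas: "cutoff S d \<in> borel_measurable borel" and sq: "integrable lborel (\<lambda>u. (cutoff S d u)\<^sup>2)"
    using assms by (auto simp: square_integrable_cutoff)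
  have int: "integrable lborel (\<lambda>u. (c * indicator {0..S} u + (cutoff S d u)\<^sup>2 / c) / 2)" for c
    using sq by (intro Bochner_Integration.integrable_divide Bochner_Integration.integrable_add
        Bochner_Integration.integrable_mult_right integrable_real_indicator)
      (simp_all add: emeasure_lborel_Icc_eq)
  have le: "\<bar>cutoff S d u\<bar> \<le> (c * indicator {0..S} u + (cutoff S d u)\<^sup>2 / c) / 2" if "c > 0" for c u
    using abs_le_half_square[OF that, of "d u"] by (auto simp: cutoff_def indicator_def)
  show L1: "integrable lborel (cutoff S d)"
    by (rule Bochner_Integration.integrable_bound[OF int[of 1]]) (use meas le[of 1] in auto)
  assume c: "c > 0"
  have "(\<integral>u. \<bar>cutoff S d u\<bar> \<partial>lborel) \<le> (\<integral>u. (c * indicator {0..S} u + (cutoff S d u)\<^sup>2 / c) / 2 \<partial>lborel)"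
    by (intro integral_mono integrable_abs L1 int le c)
  also have "\<dots> = (c * max 0 S + (\<integral>u. (cutoff S d u)\<^sup>2 \<partial>lborel) / c) / 2"
    using sq by (simp add: max_def)
  finally show "(\<integral>u. \<bar>cutoff S d u\<bar> \<partial>lborel) \<le> (c * max 0 S + (\<integral>u. (cutoff S d u)\<^sup>2 \<partial>lborel) / c) / 2" .
qed

context
  fixes S :: real and repH :: "'h::{real_inner, banach, second_countable_topology} \<Rightarrow> real \<Rightarrow> real"
  assumes S: "0 \<le> S" and H: "L2_space S repH"
begin

abbreviation (input) curve :: "'h \<Rightarrow> real \<Rightarrow> real"
  where "curve x \<equiv> cutoff S (repH x)"

lemma square_integrable_repH: "square_integrable S (repH x)"
  using H unfolding L2_space_def by blast

lemma measurable_curve [measurable]: "curve x \<in> borel_measurable borel"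
  using square_integrable_repH square_integrable_cutoff by blast

lemma integrable_curve: "integrable lborel (curve x)"
  by (rule square_integrable_L1(1)[OF square_integrable_repH])

lemma norm_curve: "(norm x)\<^sup>2 = (\<integral>u. (curve x u)\<^sup>2 \<partial>lborel)"
  using H unfolding L2_space_def set_integral_square_cutoff by blast

lemma curve_add: "AE u in lborel. curve (x + y) u = curve x u + curve y u"
proof -
  have "AE u in lborel. u \<in> {0..S} \<longrightarrow> repH (x + y) u = repH x u + repH y u"
    using H unfolding L2_space_def by blast
  then show ?thesis by eventually_elim (auto simp: cutoff_def indicator_def)
qed

lemma curve_scaleR: "AE u in lborel. curve (c *\<^sub>R x) u = c * curve x u"
proof -
  have "AE u in lborel. u \<in> {0..S} \<longrightarrow> repH (c *\<^sub>R x) u = c * repH x u"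
    using H unfolding L2_space_def by blast
  then show ?thesis by eventually_elim (auto simp: cutoff_def indicator_def)
qed

lemma curve_diff: "AE u in lborel. curve (x - y) u = curve x u - curve y u"
  using curve_add[of "x - y" y] by eventually_elim simp

lemma curve_exists:
  assumes "square_integrable S d"
  shows "\<exists>x. AE u in lborel. curve x u = cutoff S d u"
proof -
  obtain x where "AE u in lborel. u \<in> {0..S} \<longrightarrow> repH x u = d u"
    using H assms unfolding L2_space_def by blast
  then have "AE u in lborel. curve x u = cutoff S d u"
    by eventually_elim (auto simp: cutoff_def indicator_def)
  then show ?thesis ..
qed

lemma norm_le_of_curve_le:
  assumes "AE u in lborel. \<bar>curve x u\<bar> \<le> c * \<bar>curve y u\<bar>" "0 \<le> c"
  shows "norm x \<le> c * norm y"
proof (rule power2_le_imp_le)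
  have sq: "integrable lborel (\<lambda>u. (curve z u)\<^sup>2)" for z
    using square_integrable_repH square_integrable_cutoff by blast
  have "(\<integral>u. (curve x u)\<^sup>2 \<partial>lborel) \<le> (\<integral>u. c\<^sup>2 * (curve y u)\<^sup>2 \<partial>lborel)"
  proof (rule integral_mono_AE)
    show "AE u in lborel. (curve x u)\<^sup>2 \<le> c\<^sup>2 * (curve y u)\<^sup>2"
      using assms(1)
    proof eventually_elim
      case (elim u)
      then have "\<bar>curve x u\<bar>\<^sup>2 \<le> (c * \<bar>curve y u\<bar>)\<^sup>2"
        by (intro power_mono) auto
      then show ?case by (simp add: power_mult_distrib)
    qed
  qed (use sq in auto)
  then show "(norm x)\<^sup>2 \<le> (c * norm y)\<^sup>2"
    by (simp add: norm_curve power_mult_distrib)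
qed (use assms(2) in simp)

text \<open>Lets identities between elements of H be verified pointwise almost everywhere.\<close>

lemma curve_inject:
  assumes "AE u in lborel. curve x u = curve y u"
  shows "x = y"
proof -
  have "AE u in lborel. \<bar>curve (x - y) u\<bar> \<le> 0 * \<bar>curve x u\<bar>"
    using curve_diff[of x y] assms by eventually_elim simp
  from norm_le_of_curve_le[OF this] show ?thesis by simp
qed

definition integrated :: "'h \<Rightarrow> real \<Rightarrow> real"
  where "integrated x = primitive (curve x)"

lemma measurable_integrated [measurable]: "integrated x \<in> borel_measurable borel"
  unfolding integrated_def by measurable

lemma integrated_add: "integrated (x + y) T = integrated x T + integrated y T"
  unfolding integrated_def
  using primitive_cong_AE[OF curve_add] primitive_add[OF integrable_curve integrable_curve] by simp

lemma integrated_scaleR: "integrated (c *\<^sub>R x) T = c * integrated x T"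
  unfolding integrated_def
  using primitive_cong_AE[OF curve_scaleR] primitive_cmult by simp

text \<open>The constant comes from the L1 bound with \<open>c = norm x\<close>, which gives
  \<open>(norm x * S + norm x) / 2\<close>.\<close>

lemma abs_integrated_le: "\<bar>integrated x T\<bar> \<le> norm x * ((S + 1) / 2)"
proof (cases "x = 0")
  case True
  then show ?thesis using integrated_scaleR[of 0 x] by simp
next
  case False
  have "\<bar>integrated x T\<bar> \<le> (\<integral>u. \<bar>curve x u\<bar> \<partial>lborel)"
    unfolding integrated_def by (rule abs_primitive_le[OF integrable_curve])
  also have "\<dots> \<le> (norm x * max 0 S + (norm x)\<^sup>2 / norm x) / 2"
    unfolding norm_curve using square_integrable_L1(2)[OF square_integrable_repH, of "norm x" x] False
    by simp
  also have "\<dots> = norm x * ((S + 1) / 2)"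
    using S False by (simp add: field_simps power2_eq_square)
  finally show ?thesis .
qed

lemma bounded_linear_integrated: "bounded_linear (\<lambda>x. integrated x T)"
  by (rule bounded_linear_intro[where K = "(S + 1) / 2"])
    (simp_all only: integrated_add integrated_scaleR abs_integrated_le real_norm_def real_scaleR_def)

text \<open>The product with \<open>b\<close> as an element of H; it exists for bounded measurable
  \<open>b\<close> and is then unique by \<open>curve_inject\<close>.\<close>

definition multiply :: "(real \<Rightarrow> real) \<Rightarrow> 'h \<Rightarrow> 'h"
  where "multiply b x = (SOME y. AE u in lborel. curve y u = b u * curve x u)"

lemma curve_multiply:
  assumes b: "b \<in> borel_measurable borel" "\<And>u. \<bar>b u\<bar> \<le> B"
  shows "AE u in lborel. curve (multiply b x) u = b u * curve x u"
proof -
  have eq: "cutoff S (\<lambda>u. b u * repH x u) = (\<lambda>u. b u * curve x u)"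
    by (auto simp: cutoff_def)
  have "square_integrable S (\<lambda>u. b u * repH x u)"
    unfolding square_integrable_cutoff eq
  proof
    show "(\<lambda>u. b u * curve x u) \<in> borel_measurable borel"
      using b(1) by simp
    have "\<bar>(b u)\<^sup>2\<bar> \<le> B\<^sup>2" for u
      using power_mono[OF b(2)[of u], of 2] by simp
    moreover have "integrable lborel (\<lambda>u. (curve x u)\<^sup>2)"
      using square_integrable_repH square_integrable_cutoff by blast
    ultimately have "integrable lborel (\<lambda>u. (curve x u)\<^sup>2 * (b u)\<^sup>2)"
      using b(1) by (intro integrable_mult_bounded) auto
    then show "integrable lborel (\<lambda>u. (b u * curve x u)\<^sup>2)"
      by (simp add: power_mult_distrib mult.commute)
  qed
  from someI_ex[OF curve_exists[OF this]] show ?thesis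
    unfolding eq multiply_def .
qed

lemma norm_multiply_le:
  assumes b: "b \<in> borel_measurable borel" "\<And>u. \<bar>b u\<bar> \<le> B"
  shows "norm (multiply b x) \<le> B * norm x"
proof (rule norm_le_of_curve_le)
  show "AE u in lborel. \<bar>curve (multiply b x) u\<bar> \<le> B * \<bar>curve x u\<bar>"
    using curve_multiply[OF b, of x] by eventually_elim (auto simp: abs_mult intro: mult_right_mono b(2))
  show "0 \<le> B" using b(2)[of 0] by linarith
qed

text \<open>Splits \<open>b' x' - b x\<close> as \<open>b' (x' - x) + (b' - b) x\<close>.\<close>

lemma norm_multiply_diff_le:
  assumes b: "b \<in> borel_measurable borel" "\<And>u. \<bar>b u\<bar> \<le> B"
    and b': "b' \<in> borel_measurable borel" "\<And>u. \<bar>b' u\<bar> \<le> B'"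
    and e: "\<And>u. \<bar>b' u - b u\<bar> \<le> e"
  shows "norm (multiply b' x' - multiply b x) \<le> B' * norm (x' - x) + e * norm x"
proof -
  have diff: "(\<lambda>u. b' u - b u) \<in> borel_measurable borel"
    using b b' by simp
  have "AE u in lborel. curve (multiply b' x' - multiply b x) u =
      curve (multiply b' (x' - x) + multiply (\<lambda>u. b' u - b u) x) u"
    using curve_diff[of "multiply b' x'" "multiply b x"]
      curve_add[of "multiply b' (x' - x)" "multiply (\<lambda>u. b' u - b u) x"]
      curve_multiply[OF b, of x] curve_multiply[OF b', of x'] curve_multiply[OF b', of "x' - x"]
      curve_multiply[OF diff e, of x] curve_diff[of x' x]
    by eventually_elim (simp add: algebra_simps)
  then have "multiply b' x' - multiply b x = multiply b' (x' - x) + multiply (\<lambda>u. b' u - b u) x"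
    by (rule curve_inject)
  also have "norm \<dots> \<le> B' * norm (x' - x) + e * norm x"
    using norm_multiply_le[OF b', of "x' - x"] norm_multiply_le[OF diff e, of x]
    by (intro norm_triangle_le) simp
  finally show ?thesis .
qed

lemma tendsto_multiply:
  assumes b: "\<And>n. b n \<in> borel_measurable borel" "\<And>n. \<exists>B. \<forall>u. \<bar>b n u\<bar> \<le> B"
    and l: "l \<in> borel_measurable borel" "\<And>u. \<bar>l u\<bar> \<le> B"
    and lim: "uniform_limit UNIV b l F" and X: "(X \<longlongrightarrow> x) F"
  shows "((\<lambda>n. multiply (b n) (X n)) \<longlongrightarrow> multiply l x) F"
proof (rule tendstoI)
  fix e :: real
  assume e: "e > 0"
  have B: "0 \<le> B" using l(2)[of 0] by linarith
  \<comment> \<open>\<open>d\<close> bounds the multiplier error and \<open>d'\<close> the vector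
    error, each contributing at most \<open>e / 2\<close>; \<open>B + d\<close> bounds the nearby
    multipliers, and the added 1 keeps the denominators positive.\<close>
  define d where "d = e / (2 * (norm x + 1))"
  have d: "d > 0" using e by (simp add: d_def add_nonneg_pos)
  define d' where "d' = e / (2 * (B + d + 1))"
  have d': "d' > 0" using e B d by (simp add: d'_def)
  have "\<forall>\<^sub>F n in F. \<forall>u\<in>UNIV. dist (b n u) (l u) < d"
    using uniform_limitD[OF lim d] .
  moreover have "\<forall>\<^sub>F n in F. dist (X n) x < d'"
    using tendstoD[OF X d'] .
  ultimately show "\<forall>\<^sub>F n in F. dist (multiply (b n) (X n)) (multiply l x) < e"
  proof eventually_elim
    case (elim n)
    have "\<bar>b n u\<bar> \<le> B + d" for u
      using elim(1)[rule_format, of u] l(2)[of u] by (simp add: dist_real_def)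
    moreover have "\<bar>b n u - l u\<bar> \<le> d" for u
      using elim(1)[rule_format, of u] by (simp add: dist_real_def)
    ultimately have "norm (multiply (b n) (X n) - multiply l x) \<le> (B + d) * norm (X n - x) + d * norm x"
      by (rule norm_multiply_diff_le[OF l b(1)])
    also have "(B + d) * norm (X n - x) \<le> (B + d + 1) * d'"
      using elim(2) B d by (intro mult_mono) (auto simp: dist_norm)
    also have "(B + d + 1) * d' = e / 2"
      using B d by (simp add: d'_def field_simps)
    also have "d * norm x < d * (norm x + 1)"
      using d by simp
    also have "d * (norm x + 1) = e / 2"
      using norm_ge_zero[of x] by (simp add: d_def field_simps add_nonneg_eq_0_iff)
    finally show ?case
      by (simp add: dist_norm)
  qed
qed

definition price_factor :: "'h \<Rightarrow> real \<Rightarrow> real"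
  where "price_factor a u = exp (- integrated a u)"

lemma measurable_price_factor [measurable]: "price_factor a \<in> borel_measurable borel"
  unfolding price_factor_def by measurable

lemma abs_price_factor_le: "\<bar>price_factor a u\<bar> \<le> exp (norm a * ((S + 1) / 2))"
  using abs_integrated_le[of a u] by (simp add: price_factor_def)

lemma abs_price_factor_integrated_le:
  "\<bar>price_factor a u * integrated s u\<bar> \<le> exp (norm a * ((S + 1) / 2)) * (norm s * ((S + 1) / 2))"
  unfolding abs_mult by (intro mult_mono abs_price_factor_le abs_integrated_le) auto

lemma uniform_limit_integrated:
  assumes "(X \<longlongrightarrow> x) F"
  shows "uniform_limit UNIV (\<lambda>n. integrated (X n)) (integrated x) F"
proof (rule uniform_limitI)
  fix e :: real
  assume "e > 0"
  then have "e / ((S + 1) / 2) > 0" using S by simp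
  from tendstoD[OF assms this] show "\<forall>\<^sub>F n in F. \<forall>u\<in>UNIV. dist (integrated (X n) u) (integrated x u) < e"
  proof (eventually_elim, intro ballI)
    fix n u
    assume n: "dist (X n) x < e / ((S + 1) / 2)"
    have "dist (integrated (X n) u) (integrated x u) = \<bar>integrated (X n - x) u\<bar>"
      using integrated_add[of "X n - x" x u] by (simp add: dist_real_def)
    also have "\<dots> \<le> norm (X n - x) * ((S + 1) / 2)"
      by (rule abs_integrated_le)
    also have "\<dots> < e"
      using n S by (simp add: dist_norm field_simps)
    finally show "dist (integrated (X n) u) (integrated x u) < e" .
  qed
qed

lemma uniform_limit_price_factor:
  assumes X: "(X \<longlongrightarrow> x) F"
  shows "uniform_limit UNIV (\<lambda>n. price_factor (X n)) (price_factor x) F"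
  unfolding price_factor_def
proof (rule uniform_limit_compose_uniformly_continuous_on[OF uniform_limit_integrated[OF X]])
  \<comment> \<open>The exponential is uniformly continuous only on bounded sets; once
    \<open>X n\<close> is within distance 1 of \<open>x\<close>, all integrated curves stay in this
    ball.\<close>
  let ?B = "cball (0::real) ((norm x + 1) * ((S + 1) / 2))"
  show "uniformly_continuous_on ?B (\<lambda>y. exp (- y))"
    by (intro compact_uniformly_continuous continuous_intros compact_cball)
  have "\<forall>\<^sub>F n in F. dist (X n) x < 1"
    using tendstoD[OF X] by simp
  then show "\<forall>\<^sub>F n in F. \<forall>u\<in>UNIV. integrated (X n) u \<in> ?B"
  proof (eventually_elim, intro ballI)
    fix n u
    assume "dist (X n) x < 1"
    then have "norm (X n) \<le> norm x + 1"
      using norm_triangle_ineq2[of "X n" x] by (simp add: dist_norm)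
    then have "norm (X n) * ((S + 1) / 2) \<le> (norm x + 1) * ((S + 1) / 2)"
      using S by (intro mult_right_mono) auto
    then show "integrated (X n) u \<in> ?B"
      using abs_integrated_le[of "X n" u] by (simp add: dist_real_def)
  qed
qed simp

text \<open>The derivative of \<open>T \<mapsto> exp (- \<integral>\<^sub>0\<^sup>T a) (- \<integral>\<^sub>0\<^sup>T s)\<close>.\<close>

definition price_slope :: "'h \<Rightarrow> 'h \<Rightarrow> 'h"
  where "price_slope a s = multiply (\<lambda>u. price_factor a u * integrated s u) a - multiply (price_factor a) s"

lemma curve_price_slope:
  "AE u in lborel. curve (price_slope a s) u = price_factor a u * (curve a u * integrated s u - curve s u)"
proof -
  have "AE u in lborel. curve (multiply (\<lambda>u. price_factor a u * integrated s u) a) u =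
      (price_factor a u * integrated s u) * curve a u"
    by (rule curve_multiply[OF _ abs_price_factor_integrated_le]) measurable
  moreover have "AE u in lborel. curve (multiply (price_factor a) s) u = price_factor a u * curve s u"
    by (rule curve_multiply[OF measurable_price_factor abs_price_factor_le])
  ultimately show ?thesis
    unfolding price_slope_def
    using curve_diff[of "multiply (\<lambda>u. price_factor a u * integrated s u) a" "multiply (price_factor a) s"]
    by eventually_elim (simp add: algebra_simps)
qed

lemma integrated_price_slope: "integrated (price_slope a s) T = price_factor a T * (- integrated s T)"
proof -
  have "integrated (price_slope a s) T =
      primitive (\<lambda>u. price_factor a u * (curve a u * integrated s u - curve s u)) T"
    unfolding integrated_def[of "price_slope a s"]
    by (rule primitive_cong_AE[OF curve_price_slope]) simp_all
  then show ?thesis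
    using primitive_exp_mult[OF integrable_curve integrable_curve, of a T s]
    by (simp add: integrated_def price_factor_def)
qed

lemma bounded_linear_price_slope: "bounded_linear (price_slope a)"
proof (rule bounded_linear_intro)
  fix s t :: 'h and c :: real
  have "AE u in lborel. curve (price_slope a (s + t)) u = curve (price_slope a s + price_slope a t) u"
    using curve_price_slope[of a "s + t"] curve_price_slope[of a s] curve_price_slope[of a t]
      curve_add[of s t] curve_add[of "price_slope a s" "price_slope a t"]
    by eventually_elim (simp add: integrated_add algebra_simps)
  then show "price_slope a (s + t) = price_slope a s + price_slope a t"
    by (rule curve_inject)
  have "AE u in lborel. curve (price_slope a (c *\<^sub>R s)) u = curve (c *\<^sub>R price_slope a s) u"
    using curve_price_slope[of a "c *\<^sub>R s"] curve_price_slope[of a s]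
      curve_scaleR[of c s] curve_scaleR[of c "price_slope a s"]
    by eventually_elim (simp only: integrated_scaleR, simp add: algebra_simps)
  then show "price_slope a (c *\<^sub>R s) = c *\<^sub>R price_slope a s"
    by (rule curve_inject)
  have "norm (price_slope a s) \<le>
      exp (norm a * ((S + 1) / 2)) * (norm s * ((S + 1) / 2)) * norm a + exp (norm a * ((S + 1) / 2)) * norm s"
    unfolding price_slope_def
    by (intro order_trans[OF norm_triangle_ineq4] add_mono norm_multiply_le
        abs_price_factor_integrated_le abs_price_factor_le) measurable
  then show "norm (price_slope a s) \<le>
      norm s * (exp (norm a * ((S + 1) / 2)) * ((S + 1) / 2) * norm a + exp (norm a * ((S + 1) / 2)))"
    by (simp add: algebra_simps)
qed

text \<open>Joint continuity is what turns measurability of forward curve and volatility into that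
  of the price volatility. It holds because the multipliers converge uniformly.\<close>

lemma continuous_price_slope: "continuous_on UNIV (\<lambda>q. price_slope (fst q) (snd q))"
  unfolding continuous_on_def
proof
  fix p :: "'h \<times> 'h"
  let ?F = "at p"
  have fst: "(fst \<longlongrightarrow> fst p) ?F" and snd: "(snd \<longlongrightarrow> snd p) ?F"
    by (intro tendsto_intros)+
  have bdd: "\<exists>B. \<forall>u. \<bar>price_factor a u * integrated s u\<bar> \<le> B" "\<exists>B. \<forall>u. \<bar>price_factor a u\<bar> \<le> B" for a s
    using abs_price_factor_integrated_le abs_price_factor_le by blast+
  have bounded: "bounded (range (price_factor a))" "bounded (range (integrated a))" for a
    unfolding bounded_iff using abs_price_factor_le[of a] abs_integrated_le[of a]
    by (metis rangeE real_norm_def)+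
  show "((\<lambda>q. price_slope (fst q) (snd q)) \<longlongrightarrow> price_slope (fst p) (snd p)) ?F"
    unfolding price_slope_def
  proof (rule tendsto_diff)
    show "((\<lambda>q. multiply (\<lambda>u. price_factor (fst q) u * integrated (snd q) u) (fst q)) \<longlongrightarrow>
        multiply (\<lambda>u. price_factor (fst p) u * integrated (snd p) u) (fst p)) ?F"
      by (rule tendsto_multiply[OF _ _ _ abs_price_factor_integrated_le
            uniform_lim_mult[OF uniform_limit_price_factor[OF fst] uniform_limit_integrated[OF snd] bounded] fst])
        (simp_all add: bdd)
    show "((\<lambda>q. multiply (price_factor (fst q)) (snd q)) \<longlongrightarrow> multiply (price_factor (fst p)) (snd p)) ?F"
      by (rule tendsto_multiply[OF _ _ _ abs_price_factor_le uniform_limit_price_factor[OF fst] snd])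
        (simp_all add: bdd)
  qed
qed


section \<open>Price curves as elements of \<open>H^1\<close>\<close>

context
  fixes repG :: "'g::{real_inner, banach, second_countable_topology} \<Rightarrow> real \<Rightarrow> real"
  assumes G: "H1_space S repG"
begin

definition extend_zero :: "(real \<Rightarrow> real) \<Rightarrow> real \<Rightarrow> real"
  where "extend_zero g T = (if T \<in> {0..S} then g T else 0)"

text \<open>The isometric copy of H in G formed by the curves vanishing at 0: an element of H
  becomes the derivative, and the boundary term of the G-norm disappears.\<close>

definition embed :: "'h \<Rightarrow> 'g"
  where "embed y = inv repG (extend_zero (integrated y))"

lemma integrated_0: "integrated y 0 = 0"
proof -
  have "integrated y 0 = primitive (\<lambda>_. 0) 0"
    unfolding integrated_def primitive_def
  proof (rule integral_cong_AE)
    show "AE u in lborel. indicator {..0} u * curve y u = indicator {..0} u * 0"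
      using AE_lborel_singleton[of 0] by eventually_elim (auto simp: cutoff_def indicator_def)
  qed simp_all
  then show ?thesis by (simp add: primitive_def)
qed

lemma is_derivative_integrated: "is_derivative S (extend_zero (integrated y)) (repH y)"
proof -
  have "integrated y T = (LBINT u:{0..T}. repH y u)" if "T \<in> {0..S}" for T
    using set_integral_primitive[OF that] by (simp add: integrated_def)
  then show ?thesis
    using square_integrable_repH S integrated_0 by (simp add: is_derivative_def extend_zero_def)
qed

lemma inj_repG: "inj repG" and range_repG: "range repG = H1_functions S"
  using G unfolding H1_space_def bij_betw_def by auto

lemma repG_add: "repG (x + y) T = repG x T + repG y T"
  and repG_scaleR: "repG (c *\<^sub>R x) T = c * repG x T"
  using G unfolding H1_space_def by auto

lemma norm_repG:
  "is_derivative S (repG x) d \<Longrightarrow> (norm x)\<^sup>2 = (repG x 0)\<^sup>2 + (LBINT u:{0..S}. (d u)\<^sup>2)"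
  using G unfolding H1_space_def by blast

lemma repG_embed: "repG (embed y) = extend_zero (integrated y)"
proof -
  have "extend_zero (integrated y) \<in> H1_functions S"
    using is_derivative_integrated by (auto simp: H1_functions_def extend_zero_def)
  then show ?thesis
    unfolding embed_def by (intro f_inv_into_f) (simp add: range_repG)
qed

lemma norm_embed: "norm (embed y) = norm y"
proof -
  have "(norm (embed y))\<^sup>2 = (extend_zero (integrated y) 0)\<^sup>2 + (LBINT u:{0..S}. (repH y u)\<^sup>2)"
    using norm_repG[of "embed y", unfolded repG_embed, OF is_derivative_integrated] .
  also have "extend_zero (integrated y) 0 = 0"
    by (simp add: extend_zero_def integrated_0)
  finally have "(norm (embed y))\<^sup>2 = (norm y)\<^sup>2"
    by (simp add: norm_curve set_integral_square_cutoff)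
  then show ?thesis by simp
qed

lemma bounded_linear_embed: "bounded_linear embed"
proof (rule bounded_linear_intro)
  show "embed (x + y) = embed x + embed y" for x y
    by (rule injD[OF inj_repG])
      (auto simp: fun_eq_iff repG_add repG_embed extend_zero_def integrated_add)
  show "embed (c *\<^sub>R x) = c *\<^sub>R embed x" for c x
    by (rule injD[OF inj_repG])
      (auto simp: fun_eq_iff repG_scaleR repG_embed extend_zero_def integrated_scaleR)
  show "norm (embed x) \<le> norm x * 1" for x
    by (simp add: norm_embed)
qed

definition price_columns :: "'h \<Rightarrow> 'h l2 \<Rightarrow> 'g l2"
  where "price_columns a x = Abs_l2 (\<lambda>i. embed (price_slope a (coord x i)))"

lemma bounded_linear_embed_slope: "bounded_linear (\<lambda>s. embed (price_slope a s))"
  by (rule bounded_linear_compose[OF bounded_linear_embed bounded_linear_price_slope])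

lemma coord_price_columns [simp]: "coord (price_columns a x) i = embed (price_slope a (coord x i))"
proof -
  obtain K where K: "\<And>s. norm (embed (price_slope a s)) \<le> norm s * K"
    using bounded_linear.bounded[OF bounded_linear_embed_slope] by blast
  have "summable (\<lambda>i. (norm (embed (price_slope a (coord x i))))\<^sup>2)"
  proof (rule summable_comparison_test'[OF summable_mult2[OF summable_coord[of x], of "K\<^sup>2"]])
    show "norm ((norm (embed (price_slope a (coord x i))))\<^sup>2) \<le> (norm (coord x i))\<^sup>2 * K\<^sup>2" for i
      using power_mono[OF K[of "coord x i"], of 2] by (simp add: power_mult_distrib)
  qed
  then show ?thesis
    by (simp add: price_columns_def coord_Abs_l2)
qed

lemma embed_slope_hs_op: "embed (price_slope a (hs_op x u)) = hs_op (price_columns a x) u"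
  using bounded_linear.sums[OF bounded_linear_embed_slope hs_op_sums, of a u x]
    linear_cmul[OF bounded_linear.linear[OF bounded_linear_embed_slope]]
  by (simp add: hs_op_def sums_iff)

text \<open>Evaluation \<open>x \<mapsto> integrated x T\<close> is continuous on H, so the series
  over \<open>i\<close> may be taken inside the integral; the remaining curve is a primitive of
  \<open>price_slope\<close> by \<open>integrated_price_slope\<close>.\<close>

lemma price_vol_hs_op: "price_vol S repH repG f \<sigma> t \<omega> = hs_op (price_columns (f t \<omega>) (\<sigma> t \<omega>))"
proof
  fix u
  have "P_hat repH f t \<omega> T * (\<Sum>i. bond_vol repH \<sigma> i t \<omega> T * coord u i) =
      integrated (price_slope (f t \<omega>) (hs_op (\<sigma> t \<omega>) u)) T" if T: "T \<in> {0..S}" for T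
  proof -
    have "(\<lambda>i. integrated (coord u i *\<^sub>R coord (\<sigma> t \<omega>) i) T) sums integrated (hs_op (\<sigma> t \<omega>) u) T"
      by (rule bounded_linear.sums[OF bounded_linear_integrated hs_op_sums])
    from sums_minus[OF this, unfolded integrated_scaleR]
    have "(\<Sum>i. bond_vol repH \<sigma> i t \<omega> T * coord u i) = - integrated (hs_op (\<sigma> t \<omega>) u) T"
      unfolding bond_vol_def set_integral_primitive[OF T]
      by (simp add: sums_iff integrated_def mult.commute)
    moreover have "P_hat repH f t \<omega> T = price_factor (f t \<omega>) T"
      unfolding P_hat_def set_integral_primitive[OF T] by (simp add: price_factor_def integrated_def)
    ultimately show ?thesis
      by (simp add: integrated_price_slope)
  qed
  then have "price_vol S repH repG f \<sigma> t \<omega> u = embed (price_slope (f t \<omega>) (hs_op (\<sigma> t \<omega>) u))"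
    unfolding price_vol_def embed_def extend_zero_def by (intro arg_cong[of _ _ "inv repG"]) auto
  then show "price_vol S repH repG f \<sigma> t \<omega> u = hs_op (price_columns (f t \<omega>) (\<sigma> t \<omega>)) u"
    by (simp add: embed_slope_hs_op)
qed

lemma measurable_price_columns:
  assumes a: "a \<in> borel_measurable N" and x: "\<And>i. (\<lambda>p. coord (x p) i) \<in> borel_measurable N"
  shows "(\<lambda>p. coord (price_columns (a p) (x p)) i) \<in> borel_measurable N"
proof -
  have "continuous_on UNIV (\<lambda>q. embed (price_slope (fst q) (snd q)))"
    by (rule bounded_linear.continuous_on[OF bounded_linear_embed continuous_price_slope])
  then show ?thesis
    unfolding coord_price_columns
    by (rule borel_measurable_continuous_Pair[where H = "\<lambda>a s. embed (price_slope a s)", OF a x])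
qed

end

end

section \<open>Predictable processes\<close>

lemma prod_leb_pair_sigma_finite:
  fixes S :: real
  assumes "prob_space M"
  shows "pair_sigma_finite M (restrict_space lborel {0..S})"
proof -
  interpret prob_space M by fact
  have "finite_measure (restrict_space lborel {0..S})"
    by (rule finite_measureI) (subst emeasure_restrict_space, auto simp: space_restrict_space emeasure_lborel_Icc_eq)
  then interpret R: finite_measure "restrict_space lborel {0..S}" .
  show ?thesis ..
qed

lemma space_prod_leb [simp]: "space (prod_leb M S) = space M \<times> {0..S}"
  by (simp add: prod_leb_def space_pair_measure)

text \<open>\<open>P\<close> and \<open>Q\<close> may define non-measurable sets, so the exceptional
  sets are first enlarged to measurable null sets.\<close>

lemma AE_prod_leb_product:
  assumes M: "prob_space M"
    and P: "AE \<omega> in M. P \<omega>" and Q: "AE t in lborel. t \<in> {0..S} \<longrightarrow> Q t"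
  shows "AE (\<omega>, t) in prod_leb M S. P \<omega> \<and> Q t"
proof -
  interpret pair_sigma_finite M "restrict_space lborel {0..S}"
    by (rule prod_leb_pair_sigma_finite[OF M])
  from P obtain N where N: "{\<omega>\<in>space M. \<not> P \<omega>} \<subseteq> N" "N \<in> null_sets M"
    by (rule AE_E3) (auto simp: null_sets_def)
  have "AE t in restrict_space lborel {0..S}. Q t"
    using Q by (simp add: AE_restrict_space_iff)
  then obtain N' where N': "{t\<in>space (restrict_space lborel {0..S}). \<not> Q t} \<subseteq> N'"
    "N' \<in> null_sets (restrict_space lborel {0..S})"
    by (rule AE_E3) (auto simp: null_sets_def)
  have [measurable]: "N \<in> sets M" "N' \<in> sets (restrict_space lborel {0..S})"
    using N(2) N'(2) by auto
  have "AE \<omega> in M. AE t in restrict_space lborel {0..S}. \<omega> \<notin> N \<and> t \<notin> N'"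
    using AE_not_in[OF N(2)]
  proof eventually_elim
    case (elim \<omega>)
    show ?case using AE_not_in[OF N'(2)] by eventually_elim (simp add: elim)
  qed
  then have "AE p in prod_leb M S. fst p \<notin> N \<and> snd p \<notin> N'"
    unfolding prod_leb_def by (intro AE_pair_measure) simp_all
  moreover have "AE p in prod_leb M S. p \<in> space M \<times> {0..S}"
    using AE_space[of "prod_leb M S"] by simp
  ultimately show ?thesis
    by eventually_elim (use N(1) N'(1) in auto)
qed

text \<open>A measurable null cover is cut into its time sections, which are restricted to the
  shorter interval and reassembled. It carries injectivity over to \<open>{0..S}\<close>.\<close>

lemma AE_prod_leb_mono:
  assumes M: "prob_space M" and le: "S \<le> Sbar" and P: "AE p in prod_leb M Sbar. P p"
  shows "AE p in prod_leb M S. P p"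
proof -
  interpret S: pair_sigma_finite M "restrict_space lborel {0..S}"
    by (rule prod_leb_pair_sigma_finite[OF M])
  interpret Sbar: pair_sigma_finite M "restrict_space lborel {0..Sbar}"
    by (rule prod_leb_pair_sigma_finite[OF M])
  from P obtain N where N: "{p\<in>space M \<times> {0..Sbar}. \<not> P p} \<subseteq> N" "N \<in> null_sets (prod_leb M Sbar)"
    by (rule AE_E3) (auto simp: null_sets_def)
  have N_sets [measurable]: "N \<in> sets (M \<Otimes>\<^sub>M restrict_space lborel {0..Sbar})"
    using N(2) by (auto simp: prod_leb_def)
  have ident: "(\<lambda>p. p) \<in> prod_leb M S \<rightarrow>\<^sub>M M \<Otimes>\<^sub>M restrict_space lborel {0..Sbar}"
  proof -
    have "(\<lambda>t. t) \<in> restrict_space lborel {0..S} \<rightarrow>\<^sub>M restrict_space lborel {0..Sbar}"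
      using le by (intro measurable_restrict_space2 measurable_restrict_space1) auto
    then have "(\<lambda>p. (fst p, snd p)) \<in> prod_leb M S \<rightarrow>\<^sub>M M \<Otimes>\<^sub>M restrict_space lborel {0..Sbar}"
      unfolding prod_leb_def by (intro measurable_Pair measurable_compose[OF measurable_snd]) auto
    then show ?thesis by simp
  qed
  have "AE \<omega> in M. AE t in restrict_space lborel {0..Sbar}. (\<omega>, t) \<notin> N"
    using AE_not_in[OF N(2)] unfolding prod_leb_def by (rule Sbar.AE_pair)
  then have "AE \<omega> in M. AE t in restrict_space lborel {0..S}. (\<omega>, t) \<notin> N"
  proof eventually_elim
    case (elim \<omega>)
    then have "AE t in lborel. t \<in> {0..Sbar} \<longrightarrow> (\<omega>, t) \<notin> N"
      by (simp add: AE_restrict_space_iff)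
    then have "AE t in lborel. t \<in> {0..S} \<longrightarrow> (\<omega>, t) \<notin> N"
      by eventually_elim (use le in auto)
    then show ?case by (simp add: AE_restrict_space_iff)
  qed
  moreover have "{p \<in> space (M \<Otimes>\<^sub>M restrict_space lborel {0..S}). p \<notin> N} \<in> sets (M \<Otimes>\<^sub>M restrict_space lborel {0..S})"
  proof -
    have "(\<lambda>p. p) -` (space (M \<Otimes>\<^sub>M restrict_space lborel {0..Sbar}) - N) \<inter> space (prod_leb M S) \<in> sets (prod_leb M S)"
      by (rule measurable_sets[OF ident]) measurable
    also have "(\<lambda>p. p) -` (space (M \<Otimes>\<^sub>M restrict_space lborel {0..Sbar}) - N) \<inter> space (prod_leb M S) =
        {p \<in> space (M \<Otimes>\<^sub>M restrict_space lborel {0..S}). p \<notin> N}"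
      using le by (auto simp: space_pair_measure)
    finally show ?thesis by (simp add: prod_leb_def)
  qed
  ultimately have "AE p in prod_leb M S. p \<notin> N"
    unfolding prod_leb_def by (rule S.AE_pair_measure[rotated])
  moreover have "AE p in prod_leb M S. p \<in> space M \<times> {0..S}"
    using AE_space[of "prod_leb M S"] by simp
  ultimately show ?thesis
  proof eventually_elim
    case (elim p)
    then have "p \<in> space M \<times> {0..Sbar}" using le by auto
    with elim N(1) show ?case by blast
  qed
qed

lemma wiener_filtration_space: "space (wiener_filtration M S W t) = space M"
  and wiener_filtration_sets:
    "(\<And>i s. s \<in> {0..S} \<Longrightarrow> W i s \<in> borel_measurable M) \<Longrightarrow> sets (wiener_filtration M S W t) \<subseteq> sets M"
proof -
  let ?G = "\<lambda>u. {W i s -` A \<inter> space M | i s A. 0 \<le> s \<and> s \<le> u \<and> A \<in> sets borel} \<union> null_sets M"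
  let ?I = "\<Inter>u\<in>{u. u = S \<or> t < u \<and> u < S}. wiener_sigma M W u"
  \<comment> \<open>The index set of the intersection always contains \<open>u = S\<close>.\<close>
  have I: "?I \<subseteq> wiener_sigma M W S" by blast
  have "?G S \<subseteq> Pow (space M)"
    using sets.sets_into_space[of _ M] by (auto simp: null_sets_def)
  then have "wiener_sigma M W S \<subseteq> Pow (space M)"
    unfolding wiener_sigma_def using sigma_sets_into_sp by blast
  with I have Pow: "?I \<subseteq> Pow (space M)" by blast
  then show "space (wiener_filtration M S W t) = space M"
    unfolding wiener_filtration_def by (rule space_measure_of)
  assume "\<And>i s. s \<in> {0..S} \<Longrightarrow> W i s \<in> borel_measurable M"
  then have "?G S \<subseteq> sets M"
    by (auto intro: measurable_sets)
  then have "wiener_sigma M W S \<subseteq> sets M"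
    unfolding wiener_sigma_def by (rule sets.sigma_sets_subset)
  with I have "?I \<subseteq> sets M" by blast
  then show "sets (wiener_filtration M S W t) \<subseteq> sets M"
    unfolding wiener_filtration_def sets_measure_of[OF Pow] by (rule sets.sigma_sets_subset)
qed

locale filtration =
  fixes M :: "'w measure" and F :: "real \<Rightarrow> 'w measure"
  assumes space_F: "\<And>t. space (F t) = space M"
    and sets_F: "\<And>t. sets (F t) \<subseteq> sets M"
begin

abbreviation (input) rectangles :: "real \<Rightarrow> ('w \<times> real) set set"
  where "rectangles S \<equiv> {A \<times> {0} | A. A \<in> sets (F 0)} \<union>
     {A \<times> {s<..t} | A s t. 0 \<le> s \<and> s < t \<and> t \<le> S \<and> A \<in> sets (F s)}"

lemma rectangles_Pow: "0 \<le> S \<Longrightarrow> rectangles S \<subseteq> Pow (space M \<times> {0..S})"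
  using sets.sets_into_space[of _ "F _"] by (fastforce simp: space_F)

lemma rectangles_mono:
  assumes "S \<le> S'"
  shows "rectangles S \<subseteq> rectangles S'"
proof (rule Un_mono[OF subset_refl], rule subsetI)
  fix R
  assume "R \<in> {A \<times> {s<..t} | A s t. 0 \<le> s \<and> s < t \<and> t \<le> S \<and> A \<in> sets (F s)}"
  then obtain A s t where R: "R = A \<times> {s<..t}" "0 \<le> s" "s < t" "t \<le> S" "A \<in> sets (F s)"
    by blast
  then have "t \<le> S'" using assms by simp
  with R show "R \<in> {A \<times> {s<..t} | A s t. 0 \<le> s \<and> s < t \<and> t \<le> S' \<and> A \<in> sets (F s)}"
    by blast
qed

lemma space_predictable [simp]: "0 \<le> S \<Longrightarrow> space (predictable_sigma M F S) = space M \<times> {0..S}"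
  unfolding predictable_sigma_def by (rule space_measure_of[OF rectangles_Pow])

lemma rectangle_sets:
  assumes "0 \<le> S" "R \<in> rectangles S"
  shows "R \<in> sets (predictable_sigma M F S)"
  unfolding predictable_sigma_def sets_measure_of[OF rectangles_Pow[OF assms(1)]]
  using assms(2) by (rule sigma_sets.Basic)

lemma measurable_predictable_sigmaI:
  assumes "0 \<le> S" "f \<in> space N \<rightarrow> space M \<times> {0..S}"
    and "\<And>R. R \<in> rectangles S \<Longrightarrow> f -` R \<inter> space N \<in> sets N"
  shows "f \<in> N \<rightarrow>\<^sub>M predictable_sigma M F S"
  unfolding predictable_sigma_def
  by (rule measurable_measure_of[OF rectangles_Pow[OF assms(1)] assms(2,3)])

lemma ident_prod_leb:
  assumes S: "0 \<le> S"
  shows "(\<lambda>p. p) \<in> prod_leb M S \<rightarrow>\<^sub>M predictable_sigma M F S"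
proof (rule measurable_predictable_sigmaI[OF S])
  fix R
  assume R: "R \<in> rectangles S"
  then obtain A B where R_eq: "R = A \<times> B" "A \<in> sets M" "B \<in> sets borel" "B \<subseteq> {0..S}"
  proof (elim UnE CollectE exE conjE)
    fix A
    assume "R = A \<times> {0}" "A \<in> sets (F 0)"
    then show ?thesis using sets_F[of 0] S by (intro that[of A "{0}"]) auto
  next
    fix A s t
    assume "R = A \<times> {s<..t}" "0 \<le> s" "t \<le> S" "A \<in> sets (F s)"
    then show ?thesis using sets_F[of s] by (intro that[of A "{s<..t}"]) auto
  qed
  have "B \<in> sets (restrict_space lborel {0..S})"
    using R_eq by (simp add: sets_restrict_space_iff)
  then have "R \<in> sets (prod_leb M S)"
    unfolding prod_leb_def R_eq(1) using R_eq(2) by (rule pair_measureI[rotated])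
  then have "R \<inter> space (prod_leb M S) \<in> sets (prod_leb M S)"
    by (rule sets.Int[OF _ sets.top])
  then show "(\<lambda>p. p) -` R \<inter> space (prod_leb M S) \<in> sets (prod_leb M S)"
    by (simp only: vimage_ident)
qed auto

lemma strip_sets:
  assumes "0 \<le> S" "S \<le> Sbar"
  shows "space M \<times> {0..S} \<in> sets (predictable_sigma M F Sbar)"
proof -
  have top: "space M \<in> sets (F t)" for t
    using sets.top[of "F t"] by (simp add: space_F)
  have "space M \<times> {0} \<in> sets (predictable_sigma M F Sbar)"
  proof (rule rectangle_sets)
    show "space M \<times> {0} \<in> rectangles Sbar"
      using top[of 0] by blast
  qed (use assms in simp)
  moreover have "space M \<times> {0<..S} \<in> sets (predictable_sigma M F Sbar)" if "S \<noteq> 0"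
  proof (rule rectangle_sets)
    have "0 < S" using assms that by simp
    then show "space M \<times> {0<..S} \<in> rectangles Sbar"
      using assms top[of 0] by blast
  qed (use assms in simp)
  moreover have "space M \<times> {0..S} = space M \<times> {0} \<union> space M \<times> {0<..S}"
    using assms by auto
  ultimately show ?thesis
    by (cases "S = 0") auto
qed

text \<open>The integrand has to live on all of \<open>{0..Sbar}\<close>, while
  \<open>\<psi>\<close> is given up to \<open>S\<close> only. Rectangles for \<open>S\<close> are
  also rectangles for \<open>Sbar\<close>, and the strip up to \<open>S\<close> is
  predictable.\<close>

lemma predictable_extend_zero:
  fixes \<psi> :: "real \<Rightarrow> 'w \<Rightarrow> 'v::real_normed_vector"
  assumes S: "0 \<le> S" "S \<le> Sbar" and \<psi>: "predictable M F S \<psi>"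
  shows "predictable M F Sbar (\<lambda>t \<omega>. if t \<le> S then \<psi> t \<omega> else 0)"
proof -
  let ?N = "predictable_sigma M F Sbar"
  have strip: "{p \<in> space ?N. snd p \<le> S} = space M \<times> {0..S}"
    using S by auto
  have "(\<lambda>p. p) \<in> restrict_space ?N {p. snd p \<le> S} \<rightarrow>\<^sub>M predictable_sigma M F S"
  proof (rule measurable_predictable_sigmaI[OF S(1)])
    show "(\<lambda>p. p) \<in> space (restrict_space ?N {p. snd p \<le> S}) \<rightarrow> space M \<times> {0..S}"
      using S by (auto simp: space_restrict_space)
    fix R
    assume R: "R \<in> rectangles S"
    then have "R \<in> rectangles Sbar"
      by (rule rectangles_mono[OF S(2), THEN subsetD])
    then have "R \<in> sets ?N"
      by (rule rectangle_sets[rotated]) (use S in simp)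
    then have "{p. snd p \<le> S} \<inter> R \<in> sets (restrict_space ?N {p. snd p \<le> S})"
      unfolding sets_restrict_space by (rule imageI)
    moreover have "R \<subseteq> space M \<times> {0..S}"
      using R rectangles_Pow[OF S(1)] by blast
    then have "(\<lambda>p. p) -` R \<inter> space (restrict_space ?N {p. snd p \<le> S}) = {p. snd p \<le> S} \<inter> R"
      using S by (auto simp: space_restrict_space)
    ultimately show "(\<lambda>p. p) -` R \<inter> space (restrict_space ?N {p. snd p \<le> S}) \<in> sets (restrict_space ?N {p. snd p \<le> S})"
      by simp
  qed
  from measurable_compose[OF this \<psi>[unfolded predictable_def case_prod_unfold]]
  have "(\<lambda>p. if snd p \<le> S then \<psi> (snd p) (fst p) else 0) \<in> borel_measurable ?N"
    using strip_sets[OF S] by (subst measurable_If_restrict_space_iff) (auto simp: strip)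
  then show ?thesis
    unfolding predictable_def by (simp add: case_prod_unfold)
qed

lemma measurable_predictable_step:
  fixes X :: "'w \<Rightarrow> 'v::real_normed_vector"
  assumes s: "0 \<le> s" "s < t" "t \<le> S" and X: "X \<in> borel_measurable (F s)"
  shows "(\<lambda>p. indicator {s<..t} (snd p) *\<^sub>R X (fst p)) \<in> borel_measurable (predictable_sigma M F S)"
proof -
  let ?N = "predictable_sigma M F S" and ?B = "{p. snd p \<in> {s<..t}}"
  have S: "0 \<le> S" using s by simp
  have rect: "A \<times> {s<..t} \<in> sets ?N" if "A \<in> sets (F s)" for A
    using s that by (intro rectangle_sets) auto
  have "fst \<in> restrict_space ?N ?B \<rightarrow>\<^sub>M F s"
  proof (rule measurableI)
    fix p
    assume "p \<in> space (restrict_space ?N ?B)"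
    then show "fst p \<in> space (F s)"
      using S by (auto simp: space_restrict_space space_F)
  next
    fix A
    assume A: "A \<in> sets (F s)"
    then have "A \<subseteq> space M" using sets.sets_into_space[OF A] by (simp add: space_F)
    then have "fst -` A \<inter> space (restrict_space ?N ?B) = A \<times> {s<..t}"
      using S s by (auto simp: space_restrict_space)
    moreover have "A \<times> {s<..t} \<in> sets (restrict_space ?N ?B)"
      using rect[OF A] by (auto simp: sets_restrict_space intro!: image_eqI[of _ _ "A \<times> {s<..t}"])
    ultimately show "fst -` A \<inter> space (restrict_space ?N ?B) \<in> sets (restrict_space ?N ?B)"
      by simp
  qed
  then have "(\<lambda>p. X (fst p)) \<in> borel_measurable (restrict_space ?N ?B)"
    by (rule measurable_compose[OF _ X])
  moreover have "{p \<in> space ?N. snd p \<in> {s<..t}} = space M \<times> {s<..t}"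
    using S s by auto
  moreover have "space M \<times> {s<..t} \<in> sets ?N"
    using rect[of "space M"] sets.top[of "F s"] by (simp add: space_F)
  ultimately have "(\<lambda>p. if snd p \<in> {s<..t} then X (fst p) else 0) \<in> borel_measurable ?N"
    by (subst measurable_If_restrict_space_iff) simp_all
  then show ?thesis
    by (rule measurable_cong[THEN iffD1, rotated]) (simp add: indicator_def)
qed

text \<open>Continuous adapted processes are limits of their left-endpoint discretizations.\<close>

lemma ae_predictable_continuous:
  fixes f :: "real \<Rightarrow> 'w \<Rightarrow> 'v::{real_normed_vector, banach, second_countable_topology}"
  assumes M: "prob_space M" and S: "0 < S"
    and adapted: "\<And>t. t \<in> {0..S} \<Longrightarrow> f t \<in> borel_measurable (F t)"
    and cont: "AE \<omega> in M. continuous_on {0..S} (\<lambda>t. f t \<omega>)"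
  shows "ae_predictable M F S f"
proof -
  \<comment> \<open>The grid with \<open>Suc n\<close> cells, so that \<open>n = 0\<close> is not
    degenerate.\<close>
  define a where "a n k = S * real k / real (Suc n)" for n k
  define step where "step n p = (\<Sum>k<Suc n. indicator {a n k<..a n (Suc k)} (snd p) *\<^sub>R f (a n k) (fst p))"
    for n p
  have diff: "a n (Suc k) - a n k = S / real (Suc n)" for n k
    by (simp add: a_def diff_divide_distrib[symmetric] algebra_simps)
  moreover have "S / real (Suc n) > 0" for n
    using S by simp
  ultimately have "a n k < a n (Suc k)" for n k
    by (metis diff_gt_0_iff_gt)
  moreover have "0 \<le> a n k" for n k
    using S by (simp add: a_def)
  ultimately have a: "0 \<le> a n k" "a n k < a n (Suc k)" "a n (Suc k) - a n k = S / real (Suc n)" for n k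
    using diff by auto
  have a_le: "a n (Suc k) \<le> S" if "k < Suc n" for n k
    using S that by (simp add: a_def field_simps)
  have step: "step n \<in> borel_measurable (predictable_sigma M F S)" for n
    unfolding step_def
  proof (intro borel_measurable_sum measurable_predictable_step a a_le adapted)
    show "a n k \<in> {0..S}" if "k \<in> {..<Suc n}" for k
      using a[of n k] a_le[of k n] that by auto
  qed auto
  define Y where "Y t \<omega> = lim (\<lambda>n. step n (\<omega>, t))" for t \<omega>
  have "predictable M F S Y"
    unfolding predictable_def Y_def case_prod_beta prod.collapse
    by (intro borel_measurable_lim_metric step)
  moreover have "AE (\<omega>, t) in prod_leb M S. f t \<omega> = Y t \<omega>"
  proof -
    \<comment> \<open>The left-open cells miss time 0, a null set.\<close>
    have "AE t in lborel. t \<in> {0..S} \<longrightarrow> t \<in> {0<..S}"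
      using AE_lborel_singleton[of 0] by eventually_elim auto
    from AE_prod_leb_product[OF M cont this] show ?thesis
    proof eventually_elim
      case (elim p)
      obtain \<omega> t where p: "p = (\<omega>, t)" by fastforce
      with elim have cont: "continuous_on {0..S} (\<lambda>t. f t \<omega>)" and t: "0 < t" "t \<le> S" by auto
      \<comment> \<open>The cells partition \<open>{0<..S}\<close>, shown by telescoping indicators
        of rays; the discretization is then a single sampled value.\<close>
      have one: "(\<Sum>k<Suc n. indicator {a n k<..a n (Suc k)} t) = (1::real)" for n
      proof -
        have "(\<Sum>k<Suc n. indicator {a n k<..a n (Suc k)} t) =
            (\<Sum>k<Suc n. indicator {..a n (Suc k)} t - (indicator {..a n k} t :: real))"
        proof (rule sum.cong)
          fix k
          show "indicator {a n k<..a n (Suc k)} t = indicator {..a n (Suc k)} t - (indicator {..a n k} t :: real)"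
            using a(2)[of n k] by (auto simp: indicator_def)
        qed simp
        also have "\<dots> = indicator {..a n (Suc n)} t - indicator {..a n 0} t"
          by (rule sum_lessThan_telescope)
        also have "\<dots> = 1"
          using t by (simp add: a_def)
        finally show ?thesis .
      qed
      have "(\<lambda>n. step n (\<omega>, t)) \<longlonglongrightarrow> f t \<omega>"
      proof (rule LIMSEQ_I)
        fix e :: real
        assume e: "0 < e"
        obtain d where d: "d > 0" "\<And>s. s \<in> {0..S} \<Longrightarrow> dist s t < d \<Longrightarrow> dist (f s \<omega>) (f t \<omega>) < e / 2"
          using cont t half_gt_zero[OF e] unfolding continuous_on_iff by (metis atLeastAtMost_iff less_imp_le)
        obtain N where N: "S / real (Suc N) < d"
          using reals_Archimedean[of "d / S"] d S by (auto simp: field_simps)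
        have "norm (step n (\<omega>, t) - f t \<omega>) < e" if n: "n \<ge> N" for n
        proof -
          have small: "S / real (Suc n) < d"
            using N n S by (intro le_less_trans[OF _ N] divide_left_mono) auto
          have "step n (\<omega>, t) - f t \<omega> =
              (\<Sum>k<Suc n. indicator {a n k<..a n (Suc k)} t *\<^sub>R (f (a n k) \<omega> - f t \<omega>))"
            using one[of n] by (simp add: step_def scaleR_diff_right sum_subtractf scaleR_sum_left[symmetric] del: sum.lessThan_Suc)
          also have "norm \<dots> \<le> (\<Sum>k<Suc n. indicator {a n k<..a n (Suc k)} t * (e / 2))"
          proof (rule sum_norm_le)
            fix k
            assume k: "k \<in> {..<Suc n}"
            show "norm (indicator {a n k<..a n (Suc k)} t *\<^sub>R (f (a n k) \<omega> - f t \<omega>)) \<le>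
                indicator {a n k<..a n (Suc k)} t * (e / 2)"
            proof (cases "t \<in> {a n k<..a n (Suc k)}")
              case True
              then have "dist (a n k) t < d"
                using a(3)[of n k] small by (simp add: dist_real_def)
              moreover have "a n k \<in> {0..S}"
                using a(1,2)[of n k] a_le[of k n] k by auto
              ultimately show ?thesis
                using d(2)[of "a n k"] True by (simp add: dist_norm less_imp_le)
            qed simp
          qed
          also have "\<dots> = e / 2"
            unfolding sum_distrib_right[symmetric] one by simp
          finally show ?thesis using e by simp
        qed
        then show "\<exists>N. \<forall>n\<ge>N. norm (step n (\<omega>, t) - f t \<omega>) < e" by blast
      qed
      then show ?case
        by (simp add: p Y_def limI)
    qed
  qed
  ultimately show ?thesis
    unfolding ae_predictable_def by blast
qed

end

section \<open>Stochastic integrals of processes that agree almost everywhere\<close>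

text \<open>\<open>measure\<close> is 0 on non-measurable sets, so measurability must be transferred
  together with the value; completeness of \<open>M\<close> does this.\<close>

lemma measure_cong_complete:
  assumes complete: "\<And>A N. N \<in> null_sets M \<Longrightarrow> A \<subseteq> N \<Longrightarrow> A \<in> sets M"
    and eq: "AE \<omega> in M. P \<omega> \<longleftrightarrow> Q \<omega>"
  shows "measure M {\<omega>\<in>space M. P \<omega>} = measure M {\<omega>\<in>space M. Q \<omega>}"
proof -
  obtain N where N: "{\<omega>\<in>space M. \<not> (P \<omega> \<longleftrightarrow> Q \<omega>)} \<subseteq> N" "N \<in> null_sets M"
    using eq by (rule AE_E3) (auto simp: null_sets_def)
  have trans: "{\<omega>\<in>space M. R \<omega>} \<in> sets M"
    if "{\<omega>\<in>space M. R' \<omega>} \<in> sets M" "{\<omega>\<in>space M. \<not> (R' \<omega> \<longleftrightarrow> R \<omega>)} \<subseteq> N" for R R'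
  proof -
    have "{\<omega>\<in>space M. R \<omega>} = ({\<omega>\<in>space M. R' \<omega>} - N) \<union> ({\<omega>\<in>space M. R \<omega>} \<inter> N)"
      using that(2) by blast
    also have "\<dots> \<in> sets M"
      using that(1) N(2) complete[OF N(2)] by (intro sets.Un sets.Diff) auto
    finally show ?thesis .
  qed
  have N': "{\<omega>\<in>space M. \<not> (Q \<omega> \<longleftrightarrow> P \<omega>)} \<subseteq> N"
    using N(1) by blast
  show ?thesis
  proof (cases "{\<omega>\<in>space M. P \<omega>} \<in> sets M")
    case True
    moreover have "{\<omega>\<in>space M. Q \<omega>} \<in> sets M"
      by (rule trans[OF True N(1)])
    ultimately show ?thesis
      using eq by (intro measure_eq_AE) auto
  next
    case False
    moreover have "{\<omega>\<in>space M. Q \<omega>} \<notin> sets M"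
      using trans[OF _ N'] False by blast
    ultimately show ?thesis
      by (simp add: measure_notin_sets)
  qed
qed

text \<open>By Fubini, for almost every \<open>\<omega>\<close> the integrands agree at almost every
  time, so the \<open>L^2\<close> distances to any elementary process coincide; the other conditions
  do not involve the integrand, apart from predictability up to null sets.\<close>

lemma has_ito_integral_cong:
  assumes M: "prob_space M"
    and complete: "\<And>A N. N \<in> null_sets M \<Longrightarrow> A \<subseteq> N \<Longrightarrow> A \<in> sets M"
    and eq: "AE (\<omega>, t) in prod_leb M S. \<Phi> t \<omega> = \<Psi> t \<omega>"
  shows "has_ito_integral M F W S \<Phi> X \<longleftrightarrow> has_ito_integral M F W S \<Psi> X"
proof -
  interpret pair_sigma_finite M "restrict_space lborel {0..S}"
    by (rule prod_leb_pair_sigma_finite[OF M])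
  have "ae_predictable M F S \<Phi> \<longleftrightarrow> ae_predictable M F S \<Psi>"
  proof -
    have "(AE (\<omega>, t) in prod_leb M S. \<Phi> t \<omega> = Y t \<omega>) \<longleftrightarrow> (AE (\<omega>, t) in prod_leb M S. \<Psi> t \<omega> = Y t \<omega>)" for Y
    proof
      assume "AE (\<omega>, t) in prod_leb M S. \<Phi> t \<omega> = Y t \<omega>"
      with eq show "AE (\<omega>, t) in prod_leb M S. \<Psi> t \<omega> = Y t \<omega>" by eventually_elim auto
    next
      assume "AE (\<omega>, t) in prod_leb M S. \<Psi> t \<omega> = Y t \<omega>"
      with eq show "AE (\<omega>, t) in prod_leb M S. \<Phi> t \<omega> = Y t \<omega>" by eventually_elim auto
    qed
    then show ?thesis by (simp add: ae_predictable_def)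
  qed
  moreover have "measure M {\<omega>\<in>space M. ennreal \<epsilon> <
      (\<integral>\<^sup>+t\<in>{0..S}. ennreal ((norm (E t \<omega> - \<Phi> t \<omega>))\<^sup>2) \<partial>lborel)} =
    measure M {\<omega>\<in>space M. ennreal \<epsilon> <
      (\<integral>\<^sup>+t\<in>{0..S}. ennreal ((norm (E t \<omega> - \<Psi> t \<omega>))\<^sup>2) \<partial>lborel)}" for E \<epsilon>
  proof (rule measure_cong_complete[OF complete])
    have "AE \<omega> in M. AE t in restrict_space lborel {0..S}. \<Phi> t \<omega> = \<Psi> t \<omega>"
      using AE_pair[OF eq[unfolded prod_leb_def]] by simp
    then show "AE \<omega> in M.
        (ennreal \<epsilon> < (\<integral>\<^sup>+t\<in>{0..S}. ennreal ((norm (E t \<omega> - \<Phi> t \<omega>))\<^sup>2) \<partial>lborel)) \<longleftrightarrow>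
        (ennreal \<epsilon> < (\<integral>\<^sup>+t\<in>{0..S}. ennreal ((norm (E t \<omega> - \<Psi> t \<omega>))\<^sup>2) \<partial>lborel))"
    proof eventually_elim
      case (elim \<omega>)
      then have "AE t in lborel. t \<in> {0..S} \<longrightarrow> \<Phi> t \<omega> = \<Psi> t \<omega>"
        by (simp add: AE_restrict_space_iff)
      then have "AE t in lborel. ennreal ((norm (E t \<omega> - \<Phi> t \<omega>))\<^sup>2) * indicator {0..S} t =
          ennreal ((norm (E t \<omega> - \<Psi> t \<omega>))\<^sup>2) * indicator {0..S} t"
        by eventually_elim (simp add: indicator_def)
      then have "(\<integral>\<^sup>+t\<in>{0..S}. ennreal ((norm (E t \<omega> - \<Phi> t \<omega>))\<^sup>2) \<partial>lborel) =
          (\<integral>\<^sup>+t\<in>{0..S}. ennreal ((norm (E t \<omega> - \<Psi> t \<omega>))\<^sup>2) \<partial>lborel)"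
        by (rule nn_integral_cong_AE)
      then show ?case by simp
    qed
  qed
  ultimately show ?thesis
    unfolding has_ito_integral_def by simp
qed

section \<open>Completeness of the bond market\<close>

lemma Blinfun_inner: "Blinfun (\<lambda>z. h \<bullet> z) = blinfun_inner_right h"
  by (rule blinfun_eqI) (simp add: bounded_linear_Blinfun_apply bounded_linear_inner_right)

lemma norm_blinfun_inner_right_le: "norm (blinfun_inner_right h) \<le> norm h"
  by (rule norm_blinfun_bound) (simp_all add: Cauchy_Schwarz_ineq2)

lemma borel_measurable_coord:
  "X \<in> borel_measurable N \<Longrightarrow> (\<lambda>p. coord (X p) i) \<in> borel_measurable N"
  by (rule borel_measurable_continuous_on[OF linear_continuous_on[OF bounded_linear_coord]])

lemma (in bond_market) filtration: "filtration M F"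
proof
  have "W i s \<in> borel_measurable M" if "s \<in> {0..Sbar}" for i s
    using wiener that unfolding cylindrical_wiener_def standard_wiener_def by blast
  then show "sets (F t) \<subseteq> sets M" for t
    unfolding filtration by (rule wiener_filtration_sets)
  show "space (F t) = space M" for t
    unfolding filtration by (rule wiener_filtration_space)
qed

theorem theorem4p1:
  fixes M :: "'w measure"
    and Sbar S :: real
    and W :: "nat \<Rightarrow> real \<Rightarrow> 'w \<Rightarrow> real"
    and F :: "real \<Rightarrow> 'w measure"
    and repH :: "'h::{real_inner, banach, second_countable_topology} \<Rightarrow> real \<Rightarrow> real"
    and repG :: "'g::{real_inner, banach, second_countable_topology} \<Rightarrow> real \<Rightarrow> real"
    and f0 :: 'h
    and f \<alpha> :: "real \<Rightarrow> 'w \<Rightarrow> 'h"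
    and \<sigma> :: "real \<Rightarrow> 'w \<Rightarrow> 'h l2"
    and \<Gamma> :: "real \<Rightarrow> 'w \<Rightarrow> real l2 \<Rightarrow> 'g"
  assumes market: "bond_market M Sbar W F repH repG f0 f \<alpha> \<sigma>"
    and \<Gamma>: "\<Gamma> = price_vol Sbar repH repG f \<sigma>"
    and injective: "AE (\<omega>, t) in prod_leb M Sbar. inj (\<Gamma> t \<omega>)"
    and S: "0 \<le> S" "S \<le> Sbar"
  shows "\<forall>\<psi> :: real \<Rightarrow> 'w \<Rightarrow> real l2.
    predictable M F S \<psi> \<and>
    (\<integral>\<^sup>+\<omega>. (\<integral>\<^sup>+s\<in>{0..S}. ennreal ((norm (\<psi> s \<omega>))\<^sup>2) \<partial>lborel) \<partial>M) < \<infinity> \<longrightarrow>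
    (\<exists>D \<phi>. price_integrable M F Sbar \<Gamma> D \<phi> \<and>
      (\<integral>\<^sup>+\<omega>. (\<integral>\<^sup>+t\<in>{0..Sbar}. ennreal ((norm (phi_Q_half \<Gamma> \<phi> t \<omega>))\<^sup>2) \<partial>lborel) \<partial>M) < \<infinity> \<and>
      (AE \<omega> in M. price_integral M F W S \<Gamma> \<phi> \<omega> = ito_integral M F W S \<psi> \<omega>))"
proof (intro allI impI, elim conjE)
  fix \<psi> :: "real \<Rightarrow> 'w \<Rightarrow> real l2"
  assume \<psi>: "predictable M F S \<psi>"
    and finite: "(\<integral>\<^sup>+\<omega>. (\<integral>\<^sup>+s\<in>{0..S}. ennreal ((norm (\<psi> s \<omega>))\<^sup>2) \<partial>lborel) \<partial>M) < \<infinity>"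
  interpret bond_market M Sbar W F repH repG f0 f \<alpha> \<sigma> by (rule market)
  interpret F: filtration M F by (rule filtration)
  interpret pair_sigma_finite M "restrict_space lborel {0..S}"
    by (rule prod_leb_pair_sigma_finite[OF prob_space_axioms])
  have Sbar: "0 \<le> Sbar" using Sbar_pos by simp
  define columns where "columns = price_columns Sbar repH repG"
  \<comment> \<open>Stopping at \<open>S\<close> makes the integrand vanish under Q^(1/2) on the
    rest of \<open>{0..Sbar}\<close>, so its norm is controlled by the integral of
    \<open>\<psi>\<close> up to \<open>S\<close>.\<close>
  define \<psi>' where "\<psi>' t \<omega> = (if t \<le> S then \<psi> t \<omega> else 0)" for t \<omega>
  define x where "x t \<omega> = columns (f t \<omega>) (\<sigma> t \<omega>)" for t \<omega>
  define D where "D t \<omega> = range (Q_half (hs_op (x t \<omega>)))" for t \<omega>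
  define \<phi> where "\<phi> t \<omega> = polar_functional (x t \<omega>) (\<psi>' t \<omega>)" for t \<omega>
  have \<Gamma>_eq: "\<Gamma> t \<omega> = hs_op (x t \<omega>)" for t \<omega>
    unfolding \<Gamma> x_def columns_def by (rule price_vol_hs_op[OF Sbar H_space G_space])
  have comp: "\<phi> t \<omega> \<circ> Q_half (\<Gamma> t \<omega>) = (\<lambda>z. polar (x t \<omega>) (\<psi>' t \<omega>) \<bullet> z)" for t \<omega>
    by (simp add: \<Gamma>_eq \<phi>_def fun_eq_iff polar_functional_Q_half)
  have phi_Q: "phi_Q_half \<Gamma> \<phi> t \<omega> = blinfun_inner_right (polar (x t \<omega>) (\<psi>' t \<omega>))" for t \<omega>
    unfolding phi_Q_half_def comp by (rule Blinfun_inner)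
  have norm_phi_Q: "norm (phi_Q_half \<Gamma> \<phi> t \<omega>) \<le> norm (\<psi>' t \<omega>)" for t \<omega>
    unfolding phi_Q by (rule order_trans[OF norm_blinfun_inner_right_le norm_polar_le])
  have bound: "(\<integral>\<^sup>+t\<in>{0..Sbar}. ennreal ((norm (phi_Q_half \<Gamma> \<phi> t \<omega>))\<^sup>2) \<partial>lborel) \<le>
      (\<integral>\<^sup>+s\<in>{0..S}. ennreal ((norm (\<psi> s \<omega>))\<^sup>2) \<partial>lborel)" for \<omega>
  proof (rule nn_integral_mono)
    fix t
    show "ennreal ((norm (phi_Q_half \<Gamma> \<phi> t \<omega>))\<^sup>2) * indicator {0..Sbar} t \<le>
        ennreal ((norm (\<psi> t \<omega>))\<^sup>2) * indicator {0..S} t"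
    proof (cases "t \<in> {0..S}")
      case True
      then have "(norm (phi_Q_half \<Gamma> \<phi> t \<omega>))\<^sup>2 \<le> (norm (\<psi> t \<omega>))\<^sup>2"
        using norm_phi_Q[of t \<omega>] by (intro power_mono) (auto simp: \<psi>'_def)
      then show ?thesis
        using True S by (simp add: ennreal_leI)
    next
      \<comment> \<open>For \<open>t > S\<close> the functional composed with Q^(1/2) is zero; for
        \<open>t < 0\<close> both indicators vanish.\<close>
      case False
      then show ?thesis
        using norm_phi_Q[of t \<omega>] by (auto simp: \<psi>'_def indicator_def)
    qed
  qed
  have "(\<integral>\<^sup>+\<omega>. (\<integral>\<^sup>+t\<in>{0..Sbar}. ennreal ((norm (phi_Q_half \<Gamma> \<phi> t \<omega>))\<^sup>2) \<partial>lborel) \<partial>M) \<le>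
      (\<integral>\<^sup>+\<omega>. (\<integral>\<^sup>+s\<in>{0..S}. ennreal ((norm (\<psi> s \<omega>))\<^sup>2) \<partial>lborel) \<partial>M)"
    by (intro nn_integral_mono bound)
  then have expectation:
    "(\<integral>\<^sup>+\<omega>. (\<integral>\<^sup>+t\<in>{0..Sbar}. ennreal ((norm (phi_Q_half \<Gamma> \<phi> t \<omega>))\<^sup>2) \<partial>lborel) \<partial>M) < \<infinity>"
    using finite by (rule le_less_trans)
  have "AE \<omega> in M. (\<integral>\<^sup>+s\<in>{0..S}. ennreal ((norm (\<psi> s \<omega>))\<^sup>2) \<partial>lborel) \<noteq> \<infinity>"
  proof (rule nn_integral_PInf_AE)
    have "(\<lambda>p. \<psi> (snd p) (fst p)) \<in> borel_measurable (M \<Otimes>\<^sub>M restrict_space lborel {0..S})"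
      using measurable_compose[OF F.ident_prod_leb[OF S(1)] \<psi>[unfolded predictable_def case_prod_unfold]]
      by (simp add: prod_leb_def)
    then have "(\<lambda>p. ennreal ((norm (\<psi> (snd p) (fst p)))\<^sup>2)) \<in>
        borel_measurable (M \<Otimes>\<^sub>M restrict_space lborel {0..S})"
      by (rule measurable_compose[where g = "\<lambda>v. ennreal ((norm v)\<^sup>2)"]) measurable
    then have "(\<lambda>\<omega>. \<integral>\<^sup>+s. ennreal ((norm (\<psi> s \<omega>))\<^sup>2) \<partial>restrict_space lborel {0..S}) \<in> borel_measurable M"
      by (intro M2.borel_measurable_nn_integral) (simp add: case_prod_unfold)
    then show "(\<lambda>\<omega>. \<integral>\<^sup>+s\<in>{0..S}. ennreal ((norm (\<psi> s \<omega>))\<^sup>2) \<partial>lborel) \<in> borel_measurable M"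
      by (simp add: nn_integral_restrict_space)
  qed (use finite in simp)
  then have paths: "AE \<omega> in M. (\<integral>\<^sup>+t\<in>{0..Sbar}. ennreal ((norm (phi_Q_half \<Gamma> \<phi> t \<omega>))\<^sup>2) \<partial>lborel) < \<infinity>"
    by eventually_elim (use le_less_trans[OF bound] in \<open>simp add: less_top\<close>)
  have predictable: "ae_predictable M F Sbar (phi_Q_half \<Gamma> \<phi>)"
  proof -
    \<comment> \<open>The forward curve is adapted and almost surely continuous, hence only almost
      everywhere equal to a predictable process; the predictable version of the integrand is built
      from \<open>g\<close>.\<close>
    obtain g where g: "predictable M F Sbar g" "AE (\<omega>, t) in prod_leb M Sbar. f t \<omega> = g t \<omega>"
      using F.ae_predictable_continuous[OF prob_space_axioms Sbar_pos adapted_f continuous_f]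
      unfolding ae_predictable_def by blast
    define Y where "Y t \<omega> = blinfun_inner_right (polar (columns (g t \<omega>) (\<sigma> t \<omega>)) (\<psi>' t \<omega>))" for t \<omega>
    have \<psi>': "predictable M F Sbar \<psi>'"
      unfolding \<psi>'_def[abs_def] by (rule F.predictable_extend_zero[OF S \<psi>])
    have "(\<lambda>p. polar (columns (g (snd p) (fst p)) (\<sigma> (snd p) (fst p))) (\<psi>' (snd p) (fst p)))
        \<in> borel_measurable (predictable_sigma M F Sbar)"
      using g(1) predictable_\<sigma> \<psi>' unfolding predictable_def case_prod_unfold columns_def
      by (intro measurable_polar measurable_price_columns[OF Sbar H_space G_space] borel_measurable_coord)
    then have "predictable M F Sbar Y"
      unfolding predictable_def case_prod_unfold Y_def
      by (rule borel_measurable_continuous_on[OF linear_continuous_on[OF bounded_linear_blinfun_inner_right]])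
    moreover have "AE (\<omega>, t) in prod_leb M Sbar. phi_Q_half \<Gamma> \<phi> t \<omega> = Y t \<omega>"
      using g(2) by eventually_elim (auto simp: phi_Q Y_def x_def)
    ultimately show ?thesis
      unfolding ae_predictable_def by blast
  qed
  have "price_integrable M F Sbar \<Gamma> D \<phi>"
    unfolding price_integrable_def
  proof (intro conjI ballI predictable paths)
    show "linear_functional_on (D t \<omega>) (\<phi> t \<omega>)" for t \<omega>
      unfolding D_def \<phi>_def by (rule linear_functional_on_polar)
    show "AE (\<omega>, t) in prod_leb M Sbar.
        range (Q_half (\<Gamma> t \<omega>)) \<subseteq> D t \<omega> \<and> bounded_linear (\<phi> t \<omega> \<circ> Q_half (\<Gamma> t \<omega>))"
      unfolding comp by (auto simp: D_def \<Gamma>_eq bounded_linear_inner_right)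
  qed
  moreover have "price_integral M F W S \<Gamma> \<phi> = ito_integral M F W S \<psi>"
  proof -
    \<comment> \<open>Provides \<open>t \<le> S\<close>, where \<open>\<psi>'\<close> and
      \<open>\<psi>\<close> coincide.\<close>
    have "AE p in prod_leb M S. p \<in> space M \<times> {0..S}"
      using AE_space[of "prod_leb M S"] by simp
    with AE_prod_leb_mono[OF prob_space_axioms S(2) injective]
    have eq: "AE (\<omega>, t) in prod_leb M S. l2_riesz (\<lambda>u. \<phi> t \<omega> (\<Gamma> t \<omega> u)) = \<psi> t \<omega>"
    proof eventually_elim
      case (elim p)
      then show ?case
        by (auto simp: \<Gamma>_eq \<phi>_def polar_functional_hs_op l2_riesz_inner \<psi>'_def)
    qed
    \<comment> \<open>The two predicates agree for every \<open>X\<close>, so \<open>SOME\<close> in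
      \<open>ito_integral\<close> selects the same random variable on both sides.\<close>
    have "has_ito_integral M F W S (\<lambda>t \<omega>. l2_riesz (\<lambda>u. \<phi> t \<omega> (\<Gamma> t \<omega> u))) X =
        has_ito_integral M F W S \<psi> X" for X
      by (rule has_ito_integral_cong[OF prob_space_axioms _ eq]) (erule complete, assumption)
    then show ?thesis
      by (simp add: price_integral_def ito_integral_def fun_eq_iff)
  qed
  ultimately show "\<exists>D \<phi>. price_integrable M F Sbar \<Gamma> D \<phi> \<and>
      (\<integral>\<^sup>+\<omega>. (\<integral>\<^sup>+t\<in>{0..Sbar}. ennreal ((norm (phi_Q_half \<Gamma> \<phi> t \<omega>))\<^sup>2) \<partial>lborel) \<partial>M) < \<infinity> \<and>
      (AE \<omega> in M. price_integral M F W S \<Gamma> \<phi> \<omega> = ito_integral M F W S \<psi> \<omega>)"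
    using expectation by (intro exI[of _ D] exI[of _ \<phi>]) simp
qed

end
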